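(* Assume that the sets $\Lambda_i=\{a_i-k^2\pi^2\mid k\in\mathbb{N}\}$, $1\le i\le N$, are pairwise disjoint. Then $\Phi=\{\phi_{i,k}\mid1\le i\le N,\ k\in\mathbb{N}\}$ is a Riesz basis of $\mathcal{H}^0$, of dual Riesz basis $\Psi=\{\psi_{i,k}\mid1\le i\le N,\ k\in\mathbb{N}\}$. Moreover, $\mathcal{A}$ generates a $C_0$-semigroup.
   Context: $N$ is a positive integer, $a_1,\ldots,a_N\in\mathbb{R}$, $\mathbb{N}=\{0,1,2,\ldots\}$, $\mathcal{H}^0=(L^2(0,1))^N$ with its usual inner product. The unbounded operator $\mathcal{A}$ on $\mathcal{H}^0$ is $\mathcal{A}(f^j)_{1\le j\le N}=((f^j)''+a_jf^j)_{1\le j\le N}$ on the domain of all $(f^j)\in(H^2(0,1))^N$ with $(f^N)'(0)=(f^N)'(1)=0$ and $(f^j)'(0)=f^{j+1}(1)$, $(f^j)'(1)=0$ for $1\le j\le N-1$. Let $\lambda_{i,k}=a_i-k^2\pi^2$; $\mu_0=1$, $\mu_k=\sqrt2$ for $k\ge1$; $r_{i,k}^j$ is one of the two (possibly complex) square roots of $\lambda_{i,k}-a_j$ (the expressions below do not depend on the choice). The vectors $\phi_{i,k}=(\phi_{i,k}^j)_{1\le j\le N}$ (eigenvectors of $\mathcal{A}$) and $\psi_{i,k}=(\psi_{i,k}^j)_{1\le j\le N}$ (eigenvectors of $\mathcal{A}^*$) are $\phi_{i,k}^j(x)=\frac{(-1)^{k+i-j}\mu_k}{\prod_{j'=j}^{i-1}r_{i,k}^{j'}\sinh(r_{i,k}^{j'})}\cosh(r_{i,k}^j(1-x))$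 if $1\le j\le i-1$, $\phi_{i,k}^i(x)=\mu_k\cos(k\pi x)$, $\phi_{i,k}^j=0$ if $j\ge i+1$; $\psi_{i,k}^j=0$ if $1\le j\le i-1$, $\psi_{i,k}^i(x)=\mu_k\cos(k\pi x)$, $\psi_{i,k}^j(x)=\frac{(-1)^{j-i}\mu_k}{\prod_{j'=i+1}^{j}r_{i,k}^{j'}\sinh(r_{i,k}^{j'})}\cosh(r_{i,k}^jx)$ if $i+1\le j\le N$. *)

theory Defs
  imports "HOL-Analysis.Analysis"
begin

section \<open>The Hilbert space of real-valued square integrable functions on (0,1)\<close>

abbreviation unit_measure :: "real measure" where
  "unit_measure \<equiv> lebesgue_on {0<..<1}"

definition square_integrable :: "(real \<Rightarrow> real) \<Rightarrow> bool" where
  "square_integrable f \<longleftrightarrow>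
     f \<in> borel_measurable unit_measure \<and> integrable unit_measure (\<lambda>x. (f x)\<^sup>2)"

definition l2_eq :: "(real \<Rightarrow> real) \<Rightarrow> (real \<Rightarrow> real) \<Rightarrow> bool" where
  "l2_eq f g \<longleftrightarrow>
     square_integrable f \<and> square_integrable g \<and> (AE x in unit_measure. f x = g x)"

lemma square_integrable_0: "square_integrable (\<lambda>x. 0)"
  by (simp add: square_integrable_def)

lemma square_integrable_mult:
  assumes "square_integrable f" "square_integrable g"
  shows "integrable unit_measure (\<lambda>x. f x * g x)"
proof (rule Bochner_Integration.integrable_bound)
  show "integrable unit_measure (\<lambda>x. (f x)\<^sup>2 + (g x)\<^sup>2)"
    using assms by (simp add: square_integrable_def)
  show "(\<lambda>x. f x * g x) \<in> borel_measurable unit_measure"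
    using assms by (intro borel_measurable_times) (auto simp: square_integrable_def)
  have "\<bar>u * v\<bar> \<le> u\<^sup>2 + v\<^sup>2" for u v :: real
  proof -
    have "0 \<le> (\<bar>u\<bar> - \<bar>v\<bar>)\<^sup>2" by simp
    then have "2 * (\<bar>u\<bar> * \<bar>v\<bar>) \<le> u\<^sup>2 + v\<^sup>2" by (simp add: power2_diff)
    moreover have "0 \<le> \<bar>u\<bar> * \<bar>v\<bar>" by simp
    ultimately show ?thesis unfolding abs_mult by linarith
  qed
  then show "AE x in unit_measure. norm (f x * g x) \<le> norm ((f x)\<^sup>2 + (g x)\<^sup>2)"
    by (simp add: sum_power2_ge_zero)
qed

lemma square_integrable_add:
  assumes "square_integrable f" "square_integrable g"
  shows "square_integrable (\<lambda>x. f x + g x)"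
proof -
  have "integrable unit_measure (\<lambda>x. (f x)\<^sup>2 + (g x)\<^sup>2 + 2 * (f x * g x))"
    using assms square_integrable_mult[OF assms]
    by (intro Bochner_Integration.integrable_add integrable_mult_right)
       (auto simp: square_integrable_def)
  moreover have "(\<lambda>x. (f x + g x)\<^sup>2) = (\<lambda>x. (f x)\<^sup>2 + (g x)\<^sup>2 + 2 * (f x * g x))"
    by (simp add: power2_sum mult.assoc)
  moreover have "(\<lambda>x. f x + g x) \<in> borel_measurable unit_measure"
    using assms by (intro borel_measurable_add) (auto simp: square_integrable_def)
  ultimately show ?thesis
    by (simp add: square_integrable_def)
qed

lemma square_integrable_scale:
  "square_integrable f \<Longrightarrow> square_integrable (\<lambda>x. c * f x)"
  unfolding square_integrable_def power_mult_distrib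
  by (intro conjI borel_measurable_times borel_measurable_const integrable_mult_right) auto

lemma square_integrable_continuous:
  assumes "continuous_on {0..1} f"
  shows "square_integrable f"
proof -
  have "continuous_on {0<..<1} f"
    using assms by (rule continuous_on_subset) auto
  then have m: "f \<in> borel_measurable unit_measure"
    by (intro continuous_imp_measurable_on_sets_lebesgue) auto
  have "bounded (f ` {0..1})"
    using assms by (intro compact_imp_bounded compact_continuous_image) auto
  then obtain B where B: "\<And>x. x \<in> {0..1} \<Longrightarrow> \<bar>f x\<bar> \<le> B"
    unfolding bounded_iff by (metis image_eqI real_norm_def)
  have fin: "emeasure unit_measure (space unit_measure) < \<infinity>"
    by (simp add: emeasure_restrict_space)
  have "integrable unit_measure (\<lambda>x. (f x)\<^sup>2)"
  proof (rule Bochner_Integration.integrable_bound)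
    show "integrable unit_measure (\<lambda>x. B\<^sup>2)"
      by (rule finite_measure.integrable_const)
         (intro finite_measureI, use fin in auto)
    show "(\<lambda>x. (f x)\<^sup>2) \<in> borel_measurable unit_measure"
      using m by (rule borel_measurable_power)
    have "(f x)\<^sup>2 \<le> B\<^sup>2" if "x \<in> {0<..<1}" for x
      using B[of x] that abs_le_square_iff[of "f x" B] by auto
    then show "AE x in unit_measure. norm ((f x)\<^sup>2) \<le> norm (B\<^sup>2)"
      by (intro AE_I2) (auto simp: space_restrict_space)
  qed
  with m show ?thesis by (simp add: square_integrable_def)
qed

quotient_type l2 = "real \<Rightarrow> real" / partial: l2_eq
  morphisms rep_l2 mk_l2
proof (rule part_equivpI)
  show "\<exists>f. l2_eq f f"
    by (rule exI[of _ "\<lambda>x. 0"]) (simp add: l2_eq_def square_integrable_0)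
  show "symp l2_eq"
    by (rule sympI) (auto simp: l2_eq_def)
  show "transp l2_eq"
    by (rule transpI) (auto simp: l2_eq_def)
qed

instantiation l2 :: real_inner
begin

lift_definition zero_l2 :: l2 is "\<lambda>x. 0"
  by (simp add: l2_eq_def square_integrable_0)

lift_definition plus_l2 :: "l2 \<Rightarrow> l2 \<Rightarrow> l2" is "\<lambda>f g x. f x + g x"
  by (auto simp: l2_eq_def intro: square_integrable_add)

lift_definition scaleR_l2 :: "real \<Rightarrow> l2 \<Rightarrow> l2" is "\<lambda>c f x. c * f x"
  by (auto simp: l2_eq_def intro: square_integrable_scale)

lift_definition inner_l2 :: "l2 \<Rightarrow> l2 \<Rightarrow> real" is
  "\<lambda>f g. integral\<^sup>L unit_measure (\<lambda>x. f x * g x)"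
proof -
  fix f f' g g' assume "l2_eq f f'" "l2_eq g g'"
  then show "integral\<^sup>L unit_measure (\<lambda>x. f x * g x) =
      integral\<^sup>L unit_measure (\<lambda>x. f' x * g' x)"
    by (intro integral_cong_AE) (auto simp: l2_eq_def square_integrable_def)
qed

definition uminus_l2 :: "l2 \<Rightarrow> l2" where "uminus_l2 u = (- 1) *\<^sub>R u"

definition minus_l2 :: "l2 \<Rightarrow> l2 \<Rightarrow> l2" where "minus_l2 u v = u + - v"

definition norm_l2 :: "l2 \<Rightarrow> real" where "norm_l2 u = sqrt (inner u u)"

definition sgn_l2 :: "l2 \<Rightarrow> l2" where "sgn_l2 u = inverse (norm u) *\<^sub>R u"

definition dist_l2 :: "l2 \<Rightarrow> l2 \<Rightarrow> real" where "dist_l2 u v = norm (u - v)"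

definition uniformity_l2 :: "(l2 \<times> l2) filter" where
  "uniformity_l2 = (INF e\<in>{0 <..}. principal {(x, y). dist x y < e})"

definition open_l2 :: "l2 set \<Rightarrow> bool" where
  "open_l2 S = (\<forall>x\<in>S. \<forall>\<^sub>F (x', y) in uniformity. x' = x \<longrightarrow> y \<in> S)"

instance
proof
  fix u v w :: l2 and c d :: real
  show "u + v + w = u + (v + w)"
    by transfer (auto simp: l2_eq_def add.assoc intro!: square_integrable_add)
  show "u + v = v + u"
    by transfer (auto simp: l2_eq_def add.commute intro!: square_integrable_add)
  show "0 + u = u"
    by transfer (auto simp: l2_eq_def)
  show "- u + u = 0"
    unfolding uminus_l2_def
    by transfer (auto simp: l2_eq_def square_integrable_0
        intro!: square_integrable_add square_integrable_scale
          square_integrable_scale[of _ "- 1", simplified])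
  show "u - v = u + - v" by (rule minus_l2_def)
  show "c *\<^sub>R (u + v) = c *\<^sub>R u + c *\<^sub>R v"
    by transfer (auto simp: l2_eq_def distrib_left
        intro!: square_integrable_add square_integrable_scale)
  show "(c + d) *\<^sub>R u = c *\<^sub>R u + d *\<^sub>R u"
    by transfer (auto simp: l2_eq_def distrib_right
        intro!: square_integrable_add square_integrable_scale)
  show "c *\<^sub>R d *\<^sub>R u = (c * d) *\<^sub>R u"
    by transfer (auto simp: l2_eq_def mult.assoc intro!: square_integrable_scale)
  show "1 *\<^sub>R u = u"
    by transfer (auto simp: l2_eq_def)
  show "sgn u = inverse (norm u) *\<^sub>R u" by (rule sgn_l2_def)
  show "dist u v = norm (u - v)" by (rule dist_l2_def)
  show "uniformity = (INF e\<in>{0 <..}. principal {(x::l2, y). dist x y < e})"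
    by (rule uniformity_l2_def)
  show "open S = (\<forall>x\<in>S. \<forall>\<^sub>F (x', y) in uniformity. x' = x \<longrightarrow> y \<in> S)" for S :: "l2 set"
    by (rule open_l2_def)
  show "norm u = sqrt (inner u u)" by (rule norm_l2_def)
  show "inner u v = inner v u"
    by transfer (simp add: mult.commute)
  show "inner (u + v) w = inner u w + inner v w"
    by transfer (auto simp: l2_eq_def distrib_right square_integrable_mult)
  show "inner (c *\<^sub>R u) v = c * inner u v"
    by transfer (simp add: mult.assoc)
  show "0 \<le> inner u u"
    by transfer simp
  show "inner u u = 0 \<longleftrightarrow> u = 0"
  proof transfer
    fix f assume f: "l2_eq f f"
    then have "integral\<^sup>L unit_measure (\<lambda>x. f x * f x) = 0 \<longleftrightarrow>
        (AE x in unit_measure. f x * f x = 0)"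
      by (intro integral_nonneg_eq_0_iff_AE square_integrable_mult) (auto simp: l2_eq_def)
    then show "integral\<^sup>L unit_measure (\<lambda>x. f x * f x) = 0 \<longleftrightarrow> l2_eq f (\<lambda>x. 0)"
      using f by (auto simp: l2_eq_def square_integrable_0)
  qed
qed

end

section \<open>Sobolev space and traces\<close>

text \<open>Test functions are continuously differentiable with compact support in (0,1).\<close>

definition test_function :: "(real \<Rightarrow> real) \<Rightarrow> bool" where
  "test_function \<theta> \<longleftrightarrow>
     (\<forall>x. \<theta> field_differentiable (at x)) \<and> continuous_on UNIV (deriv \<theta>) \<and>
     (\<exists>c d. 0 < c \<and> d < 1 \<and> (\<forall>x. x \<notin> {c..d} \<longrightarrow> \<theta> x = 0))"

definition has_weak_deriv :: "l2 \<Rightarrow> l2 \<Rightarrow> bool" where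
  "has_weak_deriv u v \<longleftrightarrow>
     (\<forall>\<theta>. test_function \<theta> \<longrightarrow>
        integral\<^sup>L unit_measure (\<lambda>x. rep_l2 u x * deriv \<theta> x) =
        - integral\<^sup>L unit_measure (\<lambda>x. rep_l2 v x * \<theta> x))"

definition weak_deriv :: "l2 \<Rightarrow> l2" where
  "weak_deriv u = (THE v. has_weak_deriv u v)"

definition H1 :: "l2 set" where
  "H1 = {u. \<exists>v. has_weak_deriv u v}"

definition H2 :: "l2 set" where
  "H2 = {u \<in> H1. weak_deriv u \<in> H1}"

text \<open>The value at a point of [0,1] of the continuous representative
  (which every element of \<^const>\<open>H1\<close> has).\<close>

definition trace_at :: "l2 \<Rightarrow> real \<Rightarrow> real" where
  "trace_at u x = (THE y. \<exists>g. continuous_on {0..1} g \<and> u = mk_l2 g \<and> y = g x)"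

section \<open>Riesz bases\<close>

definition orthonormal_basis :: "'i set \<Rightarrow> ('i \<Rightarrow> 'h::real_inner) \<Rightarrow> bool" where
  "orthonormal_basis I b \<longleftrightarrow>
     (\<forall>p\<in>I. \<forall>q\<in>I. inner (b p) (b q) = (if p = q then 1 else 0)) \<and>
     closure (span (b ` I)) = UNIV"

definition riesz_basis :: "'i set \<Rightarrow> ('i \<Rightarrow> 'h::real_inner) \<Rightarrow> bool" where
  "riesz_basis I \<phi> \<longleftrightarrow>
     (\<exists>(U :: 'h \<Rightarrow> 'h) b. bounded_linear U \<and> bij U \<and> bounded_linear (inv U) \<and>
        orthonormal_basis I b \<and> (\<forall>p\<in>I. \<phi> p = U (b p)))"

definition dual_riesz_basis :: "'i set \<Rightarrow> ('i \<Rightarrow> 'h::real_inner) \<Rightarrow> ('i \<Rightarrow> 'h) \<Rightarrow> bool" where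
  "dual_riesz_basis I \<phi> \<psi> \<longleftrightarrow>
     riesz_basis I \<psi> \<and>
     (\<forall>p\<in>I. \<forall>q\<in>I. inner (\<phi> p) (\<psi> q) = (if p = q then 1 else 0))"

section \<open>Strongly continuous semigroups\<close>

definition C0_semigroup :: "(real \<Rightarrow> 'h::real_normed_vector \<Rightarrow> 'h) \<Rightarrow> bool" where
  "C0_semigroup T \<longleftrightarrow>
     (\<forall>t\<ge>0. bounded_linear (T t)) \<and>
     T 0 = id \<and>
     (\<forall>s\<ge>0. \<forall>t\<ge>0. T (s + t) = T s \<circ> T t) \<and>
     (\<forall>f. ((\<lambda>t. T t f) \<longlongrightarrow> f) (at_right 0))"

definition generator_dom :: "(real \<Rightarrow> 'h::real_normed_vector \<Rightarrow> 'h) \<Rightarrow> 'h set" where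
  "generator_dom T = {f. \<exists>g. ((\<lambda>t. (1 / t) *\<^sub>R (T t f - f)) \<longlongrightarrow> g) (at_right 0)}"

definition generator :: "(real \<Rightarrow> 'h::real_normed_vector \<Rightarrow> 'h) \<Rightarrow> 'h \<Rightarrow> 'h" where
  "generator T f = Lim (at_right 0) (\<lambda>t. (1 / t) *\<^sub>R (T t f - f))"

text \<open>An unbounded operator is given by its domain \<open>D\<close> and a function \<open>A\<close>
  whose values outside \<open>D\<close> are irrelevant.\<close>

definition generates_C0_semigroup :: "'h::real_normed_vector set \<Rightarrow> ('h \<Rightarrow> 'h) \<Rightarrow> bool" where
  "generates_C0_semigroup D A \<longleftrightarrow>
     (\<exists>T. C0_semigroup T \<and> generator_dom T = D \<and> (\<forall>f\<in>D. generator T f = A f))"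

section \<open>The cascade operator\<close>

text \<open>The space \<open>(L\<^sup>2(0,1))\<^sup>N\<close> is \<open>l2 ^ 'n\<close>, with an enumeration
  \<open>e\<close> of the index type by \<open>{1..N}\<close>: the \<open>j\<close>-th component of \<open>f\<close> is \<open>f $ e j\<close>.\<close>

definition vec_of :: "nat \<Rightarrow> (nat \<Rightarrow> 'n::finite) \<Rightarrow> (nat \<Rightarrow> l2) \<Rightarrow> l2 ^ 'n" where
  "vec_of N e F = (\<chi> l. F (the_inv_into {1..N} e l))"

lemma vec_of_nth:
  assumes "bij_betw e {1..N} UNIV" "j \<in> {1..N}"
  shows "vec_of N e F $ e j = F j"
  using assms by (simp add: vec_of_def bij_betw_def the_inv_into_f_f)

definition cascade_dom :: "nat \<Rightarrow> (nat \<Rightarrow> 'n::finite) \<Rightarrow> (l2 ^ 'n) set" where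
  "cascade_dom N e = {f.
     (\<forall>j\<in>{1..N}. f $ e j \<in> H2) \<and>
     trace_at (weak_deriv (f $ e N)) 0 = 0 \<and>
     trace_at (weak_deriv (f $ e N)) 1 = 0 \<and>
     (\<forall>j\<in>{1..N-1}.
        trace_at (weak_deriv (f $ e j)) 0 = trace_at (f $ e (j + 1)) 1 \<and>
        trace_at (weak_deriv (f $ e j)) 1 = 0)}"

definition cascade_op ::
  "nat \<Rightarrow> (nat \<Rightarrow> 'n::finite) \<Rightarrow> (nat \<Rightarrow> real) \<Rightarrow> l2 ^ 'n \<Rightarrow> l2 ^ 'n" where
  "cascade_op N e a f =
     vec_of N e (\<lambda>j. weak_deriv (weak_deriv (f $ e j)) + a j *\<^sub>R (f $ e j))"

section \<open>Eigenvalues and eigenvectors\<close>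

definition ev :: "(nat \<Rightarrow> real) \<Rightarrow> nat \<Rightarrow> nat \<Rightarrow> real" where
  "ev a i k = a i - (real k)\<^sup>2 * pi\<^sup>2"

definition ev_set :: "(nat \<Rightarrow> real) \<Rightarrow> nat \<Rightarrow> real set" where
  "ev_set a i = {ev a i k | k. True}"

definition mu :: "nat \<Rightarrow> real" where
  "mu k = (if k = 0 then 1 else sqrt 2)"

definition square_roots :: "nat \<Rightarrow> (nat \<Rightarrow> real) \<Rightarrow> (nat \<Rightarrow> nat \<Rightarrow> nat \<Rightarrow> complex) \<Rightarrow> bool" where
  "square_roots N a r \<longleftrightarrow>
     (\<forall>i\<in>{1..N}. \<forall>j\<in>{1..N}. \<forall>k. (r i k j)\<^sup>2 = complex_of_real (ev a i k - a j))"

definition phi_expr ::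
  "(nat \<Rightarrow> nat \<Rightarrow> nat \<Rightarrow> complex) \<Rightarrow> nat \<Rightarrow> nat \<Rightarrow> nat \<Rightarrow> real \<Rightarrow> complex" where
  "phi_expr r i k j x =
     (if j < i then
        (- 1) ^ (k + i - j) * complex_of_real (mu k)
          / (\<Prod>j'=j..i-1. r i k j' * sinh (r i k j'))
          * cosh (r i k j * complex_of_real (1 - x))
      else if j = i then complex_of_real (mu k * cos (real k * pi * x))
      else 0)"

definition psi_expr ::
  "(nat \<Rightarrow> nat \<Rightarrow> nat \<Rightarrow> complex) \<Rightarrow> nat \<Rightarrow> nat \<Rightarrow> nat \<Rightarrow> real \<Rightarrow> complex" where
  "psi_expr r i k j x =
     (if j < i then 0
      else if j = i then complex_of_real (mu k * cos (real k * pi * x))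
      else
        (- 1) ^ (j - i) * complex_of_real (mu k)
          / (\<Prod>j'=i+1..j. r i k j' * sinh (r i k j'))
          * cosh (r i k j * complex_of_real x))"

text \<open>These expressions are real, so that taking real parts below only changes their type.\<close>

lemma square_root_of_real:
  assumes "z\<^sup>2 = complex_of_real c"
  shows "z \<in> \<real> \<or> (\<exists>y. z = \<i> * complex_of_real y)"
proof -
  have "Im (z\<^sup>2) = 0" using assms by simp
  then have "Re z = 0 \<or> Im z = 0" by (auto simp: power2_eq_square)
  then show ?thesis
    by (auto simp: complex_is_Real_iff complex_eq_iff)
qed

lemma cosh_root_real:
  assumes "z\<^sup>2 = complex_of_real c"
  shows "cosh (z * complex_of_real x) \<in> \<real>"
  using square_root_of_real[OF assms]
proof
  assume "z \<in> \<real>"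
  then obtain y where "z = complex_of_real y" by (auto elim: Reals_cases)
  then show ?thesis by (simp add: cosh_def complex_is_Real_iff Im_exp)
next
  assume "\<exists>y. z = \<i> * complex_of_real y"
  then obtain y where "z = \<i> * complex_of_real y" by blast
  then have "cosh (z * complex_of_real x) = cos (complex_of_real (y * x))"
    by (simp add: cosh_conv_cos mult.assoc)
  then show ?thesis by (simp add: cos_of_real del: of_real_mult)
qed

lemma sinh_root_real:
  assumes "z\<^sup>2 = complex_of_real c"
  shows "z * sinh z \<in> \<real>"
  using square_root_of_real[OF assms]
proof
  assume "z \<in> \<real>"
  then obtain y where "z = complex_of_real y" by (auto elim: Reals_cases)
  then show ?thesis by (simp add: sinh_def complex_is_Real_iff Im_exp)
next
  assume "\<exists>y. z = \<i> * complex_of_real y"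
  then obtain y where y: "z = \<i> * complex_of_real y" by blast
  have "z * sinh z = - (complex_of_real y * sin (complex_of_real y))"
    unfolding y sinh_conv_sin by (simp add: algebra_simps)
  then show ?thesis by (simp add: sin_of_real)
qed

lemma phi_expr_real:
  assumes "square_roots N a r" "i \<in> {1..N}" "j \<in> {1..N}"
  shows "complex_of_real (Re (phi_expr r i k j x)) = phi_expr r i k j x"
proof -
  have r: "(r i k j')\<^sup>2 = complex_of_real (ev a i k - a j')" if "j' \<in> {1..N}" for j'
    using assms that by (simp add: square_roots_def)
  have "(\<Prod>j'=j..i-1. r i k j' * sinh (r i k j')) \<in> \<real>"
    using assms(2,3) by (intro prod_in_Reals sinh_root_real[OF r]) auto
  moreover have "cosh (r i k j * complex_of_real (1 - x)) \<in> \<real>"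
    using assms(3) by (intro cosh_root_real[OF r])
  ultimately have "phi_expr r i k j x \<in> \<real>"
    unfolding phi_expr_def
    by (simp only: split: if_split)
       (intro conjI impI Reals_mult Reals_divide Reals_power Reals_of_real Reals_0
         Reals_minus Reals_1)
  then show ?thesis by (simp add: of_real_Re)
qed

lemma psi_expr_real:
  assumes "square_roots N a r" "i \<in> {1..N}" "j \<in> {1..N}"
  shows "complex_of_real (Re (psi_expr r i k j x)) = psi_expr r i k j x"
proof -
  have r: "(r i k j')\<^sup>2 = complex_of_real (ev a i k - a j')" if "j' \<in> {1..N}" for j'
    using assms that by (simp add: square_roots_def)
  have "(\<Prod>j'=i+1..j. r i k j' * sinh (r i k j')) \<in> \<real>"
    using assms(2,3) by (intro prod_in_Reals sinh_root_real[OF r]) auto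
  moreover have "cosh (r i k j * complex_of_real x) \<in> \<real>"
    using assms(3) by (intro cosh_root_real[OF r])
  ultimately have "psi_expr r i k j x \<in> \<real>"
    unfolding psi_expr_def
    by (simp only: split: if_split)
       (intro conjI impI Reals_mult Reals_divide Reals_power Reals_of_real Reals_0
         Reals_minus Reals_1)
  then show ?thesis by (simp add: of_real_Re)
qed

definition phi :: "nat \<Rightarrow> (nat \<Rightarrow> 'n::finite) \<Rightarrow> (nat \<Rightarrow> nat \<Rightarrow> nat \<Rightarrow> complex)
    \<Rightarrow> nat \<times> nat \<Rightarrow> l2 ^ 'n" where
  "phi N e r = (\<lambda>(i, k). vec_of N e (\<lambda>j. mk_l2 (\<lambda>x. Re (phi_expr r i k j x))))"

definition psi :: "nat \<Rightarrow> (nat \<Rightarrow> 'n::finite) \<Rightarrow> (nat \<Rightarrow> nat \<Rightarrow> nat \<Rightarrow> complex)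
    \<Rightarrow> nat \<times> nat \<Rightarrow> l2 ^ 'n" where
  "psi N e r = (\<lambda>(i, k). vec_of N e (\<lambda>j. mk_l2 (\<lambda>x. Re (psi_expr r i k j x))))"

end

theory Submission
  imports Defs "HOL-Real_Asymp.Real_Asymp"
begin

text \<open>
  Everything rests on two facts: the matrix of eigenvectors is triangular, and both the operator and
  the semigroup can be recognised from their coefficients against the dual family.

  The Riesz basis. The cosines \<open>cosine k\<close> form an orthonormal basis of \<open>L\<^sup>2(0,1)\<close>
  (\<open>orthonormal_basis_cosine\<close>), so placing them in the components gives an orthonormal basis
  \<open>mode\<close> of the product. The vector \<open>\<phi>\<^sub>i\<^sub>,\<^sub>k\<close> is \<open>mode (i, k)\<close> plus terms in the components below
  \<open>i\<close>. Hence \<open>\<phi> = (I + K) mode\<close> with \<open>K\<close> strictly triangular, and \<open>I + K\<close> is inverted by a finite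
  Neumann series as soon as \<open>K\<close> is bounded. The entries of \<open>K\<close> send \<open>cosine k\<close> to a multiple of
  \<open>cosh(r(1 - x))\<close>. Since \<open>r\<close> is \<open>\<i>\<close> times a frequency within \<open>O(1/k)\<close> of \<open>k\<pi>\<close>, that profile is
  \<open>(-1)\<^sup>k cos(k\<pi>x)\<close> up to an error of order \<open>1/k\<close>, and \<open>r sinh r\<close> tends in absolute value to
  \<open>\<bar>a\<^sub>j - a\<^sub>i\<bar>/2\<close>. The disjointness of the sets of eigenvalues is what keeps that limit and each single
  denominator away from zero. So an entry of \<open>K\<close> is a bounded multiplier plus a square summable
  remainder (\<open>bounded_operator_of_profiles\<close>).

  The dual basis. A family biorthogonal to a Riesz basis is the image of the same orthonormal basis
  under the adjoint of the inverse, hence a Riesz basis (\<open>biorthogonal_riesz_basis\<close>). It remains to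
  see that \<open>\<psi>\<close> is biorthogonal to \<open>\<phi>\<close>, which for different \<open>i\<close> follows from the eigenvalues being
  different.

  The generator. On a Riesz basis with eigenvalues bounded above there is a diagonal semigroup, and
  \<open>h\<close> is its generator at \<open>f\<close> exactly when \<open>\<langle>h, \<psi>\<^sub>p\<rangle> = \<lambda>\<^sub>p \<langle>f, \<psi>\<^sub>p\<rangle>\<close> for all \<open>p\<close>
  (\<open>riesz_basis_semigroup\<close>). The cascade operator satisfies the very same characterisation
  (\<open>cascade_op_iff_weak\<close>), so it is the generator, domain included.
  In one direction this is Green's formula, whose boundary terms telescope along the cascade. In the
  other, testing with \<open>\<psi>\<^sub>j\<^sub>,\<^sub>k\<close> isolates the component \<open>j\<close> once the later components are known to solve
  their equations, and leaves the cosine coefficients of a Neumann problem; these determine a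
  solution in \<open>H\<^sup>2\<close> (\<open>neumann_iff_cosines\<close>).
\<close>

section \<open>Bessel families and orthonormal bases\<close>

text \<open>A Bessel family is one for which \<open>c \<mapsto> \<Sum> c\<^sub>p v\<^sub>p\<close> is bounded on finitely supported coefficients. The
  square of the norm is used so that the bounds add up without square roots.\<close>

definition bessel_family :: "'i set \<Rightarrow> ('i \<Rightarrow> 'h::real_inner) \<Rightarrow> real \<Rightarrow> bool" where
  "bessel_family I v B \<longleftrightarrow>
     (\<forall>F c. finite F \<and> F \<subseteq> I \<longrightarrow> (norm (\<Sum>p\<in>F. c p *\<^sub>R v p))\<^sup>2 \<le> B * (\<Sum>p\<in>F. (c p)\<^sup>2))"

definition orthonormal_family :: "'i set \<Rightarrow> ('i \<Rightarrow> 'h::real_inner) \<Rightarrow> bool" where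
  "orthonormal_family I b \<longleftrightarrow> (\<forall>p\<in>I. \<forall>q\<in>I. inner (b p) (b q) = (if p = q then 1 else 0))"

lemma bessel_familyD:
  "bessel_family I v B \<Longrightarrow> finite F \<Longrightarrow> F \<subseteq> I \<Longrightarrow>
     (norm (\<Sum>p\<in>F. c p *\<^sub>R v p))\<^sup>2 \<le> B * (\<Sum>p\<in>F. (c p)\<^sup>2)"
  unfolding bessel_family_def by blast

lemma orthonormal_norm_sum:
  assumes "orthonormal_family I b" "finite F" "F \<subseteq> I"
  shows "(norm (\<Sum>p\<in>F. c p *\<^sub>R b p))\<^sup>2 = (\<Sum>p\<in>F. (c p)\<^sup>2)"
proof -
  have "(norm (\<Sum>p\<in>F. c p *\<^sub>R b p))\<^sup>2 = (\<Sum>p\<in>F. \<Sum>q\<in>F. c p * (c q * inner (b p) (b q)))"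
    by (simp add: power2_norm_eq_inner inner_sum_left inner_sum_right mult.left_commute inner_commute sum_distrib_left)
  also have "\<dots> = (\<Sum>p\<in>F. \<Sum>q\<in>F. if q = p then (c p)\<^sup>2 else 0)"
    using assms by (intro sum.cong refl) (auto simp: orthonormal_family_def subset_iff power2_eq_square)
  also have "\<dots> = (\<Sum>p\<in>F. (c p)\<^sup>2)"
    using assms(2) by simp
  finally show ?thesis .
qed

lemma bessel_multiple_orthonormal:
  assumes "orthonormal_family I b" "\<And>p. p \<in> I \<Longrightarrow> \<bar>m p\<bar> \<le> M"
  shows "bessel_family I (\<lambda>p. m p *\<^sub>R b p) (M\<^sup>2)"
  unfolding bessel_family_def
proof safe
  fix F c assume F: "finite F" "F \<subseteq> I"
  have "(norm (\<Sum>p\<in>F. c p *\<^sub>R m p *\<^sub>R b p))\<^sup>2 = (\<Sum>p\<in>F. (c p * m p)\<^sup>2)"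
    using orthonormal_norm_sum[OF assms(1) F, of "\<lambda>p. c p * m p"] by simp
  also have "\<dots> \<le> (\<Sum>p\<in>F. M\<^sup>2 * (c p)\<^sup>2)"
  proof (rule sum_mono)
    fix p assume "p \<in> F"
    then have "\<bar>m p\<bar> \<le> \<bar>M\<bar>" using assms(2)[of p] F by auto
    then have "(m p)\<^sup>2 \<le> M\<^sup>2" by (simp only: abs_le_square_iff)
    then show "(c p * m p)\<^sup>2 \<le> M\<^sup>2 * (c p)\<^sup>2"
      by (subst mult.commute) (simp add: power_mult_distrib mult_left_mono)
  qed
  finally show "(norm (\<Sum>p\<in>F. c p *\<^sub>R m p *\<^sub>R b p))\<^sup>2 \<le> M\<^sup>2 * (\<Sum>p\<in>F. (c p)\<^sup>2)"
    by (simp add: sum_distrib_left)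
qed

text \<open>The Hilbert-Schmidt case: by Cauchy-Schwarz the sum of the squared norms is itself a Bessel bound.\<close>

lemma bessel_square_summable:
  assumes "\<And>F. finite F \<Longrightarrow> F \<subseteq> I \<Longrightarrow> (\<Sum>p\<in>F. (norm (v p))\<^sup>2) \<le> B"
  shows "bessel_family I v B"
  unfolding bessel_family_def
proof safe
  fix F c assume F: "finite F" "F \<subseteq> I"
  have "norm (\<Sum>p\<in>F. c p *\<^sub>R v p) \<le> (\<Sum>p\<in>F. \<bar>c p\<bar> * norm (v p))"
    by (rule order_trans[OF norm_sum]) simp
  then have "(norm (\<Sum>p\<in>F. c p *\<^sub>R v p))\<^sup>2 \<le> (\<Sum>p\<in>F. \<bar>c p\<bar> * norm (v p))\<^sup>2"
    by (intro power_mono) auto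
  also have "\<dots> \<le> (\<Sum>p\<in>F. (c p)\<^sup>2) * (\<Sum>p\<in>F. (norm (v p))\<^sup>2)"
    using Cauchy_Schwarz_ineq_sum[of "\<lambda>p. \<bar>c p\<bar>" "\<lambda>p. norm (v p)" F] by simp
  also have "\<dots> \<le> (\<Sum>p\<in>F. (c p)\<^sup>2) * B"
    using assms[OF F] by (intro mult_left_mono sum_nonneg) auto
  finally show "(norm (\<Sum>p\<in>F. c p *\<^sub>R v p))\<^sup>2 \<le> B * (\<Sum>p\<in>F. (c p)\<^sup>2)"
    by (simp add: mult.commute)
qed

lemma bessel_add:
  assumes "bessel_family I v B" "bessel_family I w B'"
  shows "bessel_family I (\<lambda>p. v p + w p) (2 * B + 2 * B')"
  unfolding bessel_family_def
proof safe
  fix F c assume F: "finite F" "F \<subseteq> I"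
  let ?x = "\<Sum>p\<in>F. c p *\<^sub>R v p" and ?y = "\<Sum>p\<in>F. c p *\<^sub>R w p"
  have "(norm (?x + ?y))\<^sup>2 + (norm (?x - ?y))\<^sup>2 = 2 * (norm ?x)\<^sup>2 + 2 * (norm ?y)\<^sup>2"
    by (simp add: power2_norm_eq_inner inner_left_distrib inner_right_distrib
        inner_diff_left inner_diff_right)
  then have "(norm (?x + ?y))\<^sup>2 \<le> 2 * (norm ?x)\<^sup>2 + 2 * (norm ?y)\<^sup>2"
    using zero_le_power2[of "norm (?x - ?y)"] by linarith
  also have "\<dots> \<le> 2 * (B * (\<Sum>p\<in>F. (c p)\<^sup>2)) + 2 * (B' * (\<Sum>p\<in>F. (c p)\<^sup>2))"
    using bessel_familyD[OF assms(1) F, of c] bessel_familyD[OF assms(2) F, of c] by linarith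
  finally show "(norm (\<Sum>p\<in>F. c p *\<^sub>R (v p + w p)))\<^sup>2 \<le> (2 * B + 2 * B') * (\<Sum>p\<in>F. (c p)\<^sup>2)"
    by (simp add: scaleR_add_right sum.distrib algebra_simps)
qed

text \<open>The Bessel bound controls the tails of \<open>\<Sum> c\<^sub>p v\<^sub>p\<close> by the tails of \<open>\<Sum> c\<^sub>p\<^sup>2\<close>, so the partial sums are
  Cauchy. This is convergence in the unconditional sense and in general not absolute convergence.\<close>

lemma bessel_summable:
  fixes v :: "'i \<Rightarrow> 'h::{real_inner, complete_space}"
  assumes v: "bessel_family I v B" and c: "(\<lambda>p. (c p)\<^sup>2) summable_on I"
  shows "(\<lambda>p. c p *\<^sub>R v p) summable_on I"
proof -
  let ?S = "\<lambda>F. \<Sum>p\<in>F. c p *\<^sub>R v p"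
  have "\<exists>F. finite F \<and> F \<subseteq> I \<and>
      (\<forall>G. finite G \<and> F \<subseteq> G \<and> G \<subseteq> I \<longrightarrow> dist (?S F) (?S G) < \<epsilon>)" if e: "\<epsilon> > 0" for \<epsilon>
  proof -
    define d where "d = \<epsilon>\<^sup>2 / (\<bar>B\<bar> + 1)"
    have d: "d > 0" using e by (simp add: d_def add_nonneg_pos)
    obtain F where F: "finite F" "F \<subseteq> I" "dist (\<Sum>p\<in>F. (c p)\<^sup>2) (infsum (\<lambda>p. (c p)\<^sup>2) I) \<le> d / 2"
      using infsum_finite_approximation[OF c, of "d/2"] d by auto
    have "dist (?S F) (?S G) < \<epsilon>" if G: "finite G" "F \<subseteq> G" "G \<subseteq> I" for G
    proof -
      have "?S G - ?S F = ?S (G - F)"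
        using G by (simp add: sum_diff)
      then have "(dist (?S F) (?S G))\<^sup>2 \<le> B * (\<Sum>p\<in>G-F. (c p)\<^sup>2)"
        using bessel_familyD[OF v, of "G - F" c] G
        by (simp add: dist_commute[of "?S F"] dist_norm[of "?S G"] subset_iff)
      also have "\<dots> \<le> \<bar>B\<bar> * (d / 2)"
      proof (intro mult_mono)
        have "(\<Sum>p\<in>G. (c p)\<^sup>2) \<le> infsum (\<lambda>p. (c p)\<^sup>2) I"
          using c G by (intro finite_sum_le_infsum) auto
        then show "(\<Sum>p\<in>G-F. (c p)\<^sup>2) \<le> d / 2"
          using F G by (auto simp: sum_diff dist_real_def abs_if split: if_splits)
      qed (auto intro: sum_nonneg)
      also have "\<dots> < (\<bar>B\<bar> + 1) * d" using d by (intro mult_strict_mono) auto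
      also have "\<dots> = \<epsilon>\<^sup>2" by (simp add: d_def)
      finally show ?thesis using e by (simp add: power2_less_imp_less)
    qed
    then show ?thesis using F by blast
  qed
  then have "cauchy_filter (filtermap ?S (finite_subsets_at_top I))"
    unfolding cauchy_filter_metric_filtermap eventually_finite_subsets_at_top
    apply safe
    subgoal premises p for \<epsilon>
    proof -
      obtain F where F: "finite F" "F \<subseteq> I"
        "\<And>G. finite G \<and> F \<subseteq> G \<and> G \<subseteq> I \<Longrightarrow> dist (?S F) (?S G) < \<epsilon>/2"
        using p(1)[of "\<epsilon>/2"] p(2) by auto
      have "dist (?S G) (?S G') < \<epsilon>" if "finite G \<and> F \<subseteq> G \<and> G \<subseteq> I"
        "finite G' \<and> F \<subseteq> G' \<and> G' \<subseteq> I" for G G'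
        using F(3)[OF that(1)] F(3)[OF that(2)] by (rule dist_triangle_half_r)
      then show ?thesis
        using F(1,2) by (intro exI[of _ "\<lambda>G. finite G \<and> F \<subseteq> G \<and> G \<subseteq> I"]) blast
    qed
    done
  moreover have "complete (UNIV :: 'h set)"
    by (rule complete_UNIV)
  ultimately obtain x where "filtermap ?S (finite_subsets_at_top I) \<le> nhds x"
    using cauchy_filter_complete_converges[of "filtermap ?S (finite_subsets_at_top I)" UNIV]
    by (auto simp: filtermap_bot_iff)
  then show ?thesis
    unfolding summable_on_def has_sum_def filterlim_def by blast
qed

lemma has_sum_bessel_bound:
  assumes v: "bessel_family I v B" and c: "(\<lambda>p. (c p)\<^sup>2) summable_on I"
    and s: "((\<lambda>p. c p *\<^sub>R v p) has_sum x) I"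
  shows "(norm x)\<^sup>2 \<le> B * infsum (\<lambda>p. (c p)\<^sup>2) I"
proof (rule tendsto_le)
  show "((\<lambda>F. (norm (\<Sum>p\<in>F. c p *\<^sub>R v p))\<^sup>2) \<longlongrightarrow> (norm x)\<^sup>2) (finite_subsets_at_top I)"
    using s unfolding has_sum_def by (intro tendsto_intros)
  show "((\<lambda>F. B * (\<Sum>p\<in>F. (c p)\<^sup>2)) \<longlongrightarrow> B * infsum (\<lambda>p. (c p)\<^sup>2) I) (finite_subsets_at_top I)"
    by (intro tendsto_intros infsum_tendsto c)
  show "\<forall>\<^sub>F F in finite_subsets_at_top I. (norm (\<Sum>p\<in>F. c p *\<^sub>R v p))\<^sup>2 \<le> B * (\<Sum>p\<in>F. (c p)\<^sup>2)"
    by (intro eventually_finite_subsets_at_top_weakI bessel_familyD[OF v])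
qed simp

lemma bessel_inequality:
  assumes b: "orthonormal_family I b"
  shows "(\<lambda>p. (inner x (b p))\<^sup>2) summable_on I" "infsum (\<lambda>p. (inner x (b p))\<^sup>2) I \<le> (norm x)\<^sup>2"
proof -
  have *: "(\<Sum>p\<in>F. (inner x (b p))\<^sup>2) \<le> (norm x)\<^sup>2" if F: "finite F" "F \<subseteq> I" for F
  proof -
    let ?y = "\<Sum>p\<in>F. inner x (b p) *\<^sub>R b p"
    have "0 \<le> (norm (x - ?y))\<^sup>2" by simp
    also have "\<dots> = (norm x)\<^sup>2 - 2 * inner x ?y + (norm ?y)\<^sup>2"
      by (simp add: power2_norm_eq_inner inner_diff_left inner_diff_right inner_commute)
    also have "inner x ?y = (\<Sum>p\<in>F. (inner x (b p))\<^sup>2)"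
      by (simp add: inner_sum_right power2_eq_square)
    finally show ?thesis
      using orthonormal_norm_sum[OF b F, of "\<lambda>p. inner x (b p)"] by linarith
  qed
  show s: "(\<lambda>p. (inner x (b p))\<^sup>2) summable_on I"
    by (rule nonneg_bdd_above_summable_on) (auto intro!: bdd_aboveI2[where M = "(norm x)\<^sup>2"] *)
  show "infsum (\<lambda>p. (inner x (b p))\<^sup>2) I \<le> (norm x)\<^sup>2"
    using s * by (intro infsum_le_finite_sums) auto
qed

lemma has_sum_single:
  assumes "p \<in> I" "\<And>q. q \<in> I \<Longrightarrow> q \<noteq> p \<Longrightarrow> f q = 0"
  shows "(f has_sum f p) I"
proof -
  have "(f has_sum f p) {p}"
    by (rule has_sum_finiteI) auto
  then show ?thesis
    using assms by (subst (asm) has_sum_cong_neutral[where T = I and g = f]) auto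
qed

text \<open>This is the way operators are constructed below: to prescribe a bounded operator on an orthonormal
  family it is enough that the prescribed images form a Bessel family.\<close>

lemma synthesis_operator:
  fixes v :: "'i \<Rightarrow> 'k::{real_inner, complete_space}" and b :: "'i \<Rightarrow> 'h::real_inner"
  assumes b: "orthonormal_family I b" and v: "bessel_family I v B" and B: "B \<ge> 0"
  obtains T where "bounded_linear T" "\<And>x. (norm (T x))\<^sup>2 \<le> B * (norm x)\<^sup>2"
    "\<And>p. p \<in> I \<Longrightarrow> T (b p) = v p"
    "\<And>x. ((\<lambda>p. inner x (b p) *\<^sub>R v p) has_sum T x) I"
proof
  define T where "T x = infsum (\<lambda>p. inner x (b p) *\<^sub>R v p) I" for x
  show T: "((\<lambda>p. inner x (b p) *\<^sub>R v p) has_sum T x) I" for x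
    unfolding T_def by (intro has_sum_infsum bessel_summable[OF v] bessel_inequality[OF b])
  show bd: "(norm (T x))\<^sup>2 \<le> B * (norm x)\<^sup>2" for x
    using has_sum_bessel_bound[OF v bessel_inequality(1)[OF b] T, of x]
      mult_left_mono[OF bessel_inequality(2)[OF b, of x] B] by linarith
  have bd': "norm (T x) \<le> norm x * sqrt B" for x
    using real_sqrt_le_mono[OF bd[of x]] by (simp add: real_sqrt_mult mult.commute)
  show "bounded_linear T"
  proof (rule bounded_linear_intro[OF _ _ bd'])
    show "T (x + y) = T x + T y" for x y
      using has_sum_add[OF T[of x] T[of y]] T[of "x + y"]
      by (intro has_sum_unique[of _ I]) (auto simp: inner_left_distrib scaleR_add_left)
    show "T (c *\<^sub>R x) = c *\<^sub>R T x" for c x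
    proof (rule has_sum_unique[OF T])
      show "((\<lambda>p. inner (c *\<^sub>R x) (b p) *\<^sub>R v p) has_sum c *\<^sub>R T x) I"
        using has_sum_bounded_linear[OF bounded_linear_scaleR_right T, of c x] by (simp add: o_def)
    qed
  qed
  show "T (b p) = v p" if p: "p \<in> I" for p
  proof (rule has_sum_unique[OF T])
    show "((\<lambda>q. inner (b p) (b q) *\<^sub>R v q) has_sum v p) I"
      using has_sum_single[OF p, of "\<lambda>q. inner (b p) (b q) *\<^sub>R v q"] b p
      by (auto simp: orthonormal_family_def)
  qed
qed

lemma bounded_linear_eq_on_dense_span:
  fixes F G :: "'a::real_normed_vector \<Rightarrow> 'b::real_normed_vector"
  assumes F: "bounded_linear F" and G: "bounded_linear G"
    and d: "closure (span S) = UNIV" and e: "\<And>x. x \<in> S \<Longrightarrow> F x = G x"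
  shows "F x = G x"
proof -
  have D: "bounded_linear (\<lambda>x. F x - G x)"
    by (intro bounded_linear_sub F G)
  have "span S \<subseteq> {x. F x - G x = 0}"
  proof (rule span_minimal)
    show "subspace {x. F x - G x = 0}"
      using D by (intro linear_subspace_kernel bounded_linear.linear)
  qed (use e in auto)
  moreover have "closed {x. F x - G x = 0}"
    using D by (intro closed_Collect_eq continuous_intros linear_continuous_on) 
  ultimately have "closure (span S) \<subseteq> {x. F x - G x = 0}"
    by (rule closure_minimal)
  then show ?thesis using d by auto
qed

text \<open>If the family is total, then the sum \<open>y\<close> of the Fourier series of \<open>x\<close>, which exists by
  completeness, has the same coefficients as \<open>x\<close> and hence equals \<open>x\<close>; its partial sums lie in the
  span.\<close>

lemma orthonormal_basis_iff_total:
  fixes b :: "'i \<Rightarrow> 'h::{real_inner, complete_space}"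
  shows "orthonormal_basis I b \<longleftrightarrow>
    orthonormal_family I b \<and> (\<forall>x. (\<forall>p\<in>I. inner x (b p) = 0) \<longrightarrow> x = 0)"
proof safe
  assume b: "orthonormal_basis I b"
  then show "orthonormal_family I b"
    by (simp add: orthonormal_basis_def orthonormal_family_def)
  fix x assume x: "\<forall>p\<in>I. inner x (b p) = 0"
  have "inner x y = 0" for y
    using b x by (intro bounded_linear_eq_on_dense_span[of "inner x" "\<lambda>_. 0" "b ` I" y])
      (auto simp: orthonormal_basis_def bounded_linear_inner_right)
  then show "x = 0" by (metis inner_eq_zero_iff)
next
  assume b: "orthonormal_family I b" and total: "\<forall>x. (\<forall>p\<in>I. inner x (b p) = 0) \<longrightarrow> x = 0"
  have bb: "bessel_family I b 1"
    using bessel_multiple_orthonormal[OF b, of "\<lambda>_. 1" 1] by simp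
  have "x \<in> closure (span (b ` I))" for x
  proof -
    obtain y where y: "((\<lambda>p. inner x (b p) *\<^sub>R b p) has_sum y) I"
      using bessel_summable[OF bb bessel_inequality(1)[OF b]] unfolding summable_on_def by blast
    have "inner y (b p) = inner x (b p)" if p: "p \<in> I" for p
    proof (rule has_sum_unique)
      show "((\<lambda>q. inner (inner x (b q) *\<^sub>R b q) (b p)) has_sum inner y (b p)) I"
        using has_sum_bounded_linear[OF bounded_linear_inner_left y] by (simp add: o_def)
      show "((\<lambda>q. inner (inner x (b q) *\<^sub>R b q) (b p)) has_sum inner x (b p)) I"
        using has_sum_single[OF p, of "\<lambda>q. inner (inner x (b q) *\<^sub>R b q) (b p)"] b p
        by (auto simp: orthonormal_family_def)
    qed
    then have "x = y"
      using total[rule_format, of "x - y"] by (simp add: inner_diff_left)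
    have "((\<lambda>F. \<Sum>p\<in>F. inner x (b p) *\<^sub>R b p) \<longlongrightarrow> x) (finite_subsets_at_top I)"
      using y \<open>x = y\<close> by (simp add: has_sum_def)
    then show ?thesis
    proof (rule Lim_in_closed_set[rotated 3])
      show "\<forall>\<^sub>F F in finite_subsets_at_top I. (\<Sum>p\<in>F. inner x (b p) *\<^sub>R b p) \<in> closure (span (b ` I))"
        by (intro eventually_finite_subsets_at_top_weakI set_mp[OF closure_subset] span_sum span_scale span_base) auto
    qed auto
  qed
  then show "orthonormal_basis I b"
    using b by (auto simp: orthonormal_basis_def orthonormal_family_def)
qed

text \<open>The elementary half of the Banach-Steinhaus theorem: uniform boundedness propagates strong
  convergence from a dense subspace. It gives the continuity of the semigroup at 0 and, applied to
  difference quotients, its generator.\<close>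

lemma tendsto_id_of_tendsto_on_dense_span:
  fixes M :: "'t \<Rightarrow> 'h::real_normed_vector \<Rightarrow> 'h"
  assumes lin: "\<forall>\<^sub>F t in F. bounded_linear (M t)"
    and bd: "\<forall>\<^sub>F t in F. \<forall>x. norm (M t x) \<le> B * norm x"
    and conv: "\<And>x. x \<in> S \<Longrightarrow> ((\<lambda>t. M t x) \<longlongrightarrow> x) F"
    and d: "closure (span S) = UNIV"
  shows "((\<lambda>t. M t x) \<longlongrightarrow> x) F"
proof (rule tendstoI)
  fix \<epsilon> :: real assume e: "\<epsilon> > 0"
  have sp: "((\<lambda>t. M t y) \<longlongrightarrow> y) F" if "y \<in> span S" for y
    using that
  proof (induction rule: span_induct_alt)
    case base
    have "\<forall>\<^sub>F t in F. M t 0 = 0"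
      using lin by eventually_elim (simp add: linear_0 bounded_linear.linear)
    then show ?case by (rule tendsto_eventually)
  next
    case (step c s y)
    have "\<forall>\<^sub>F t in F. c *\<^sub>R M t s + M t y = M t (c *\<^sub>R s + y)"
      using lin by eventually_elim (simp add: linear_add linear_scale bounded_linear.linear)
    moreover have "((\<lambda>t. c *\<^sub>R M t s + M t y) \<longlongrightarrow> c *\<^sub>R s + y) F"
      by (intro tendsto_intros step conv)
    ultimately show ?case by (rule Lim_transform_eventually[rotated])
  qed
  define \<delta> where "\<delta> = \<epsilon> / (\<bar>B\<bar> + 2)"
  have dpos: "\<delta> > 0" using e by (simp add: \<delta>_def add_nonneg_pos)
  have "x \<in> closure (span S)" using d by simp
  then obtain y where y: "y \<in> span S" "dist y x < \<delta>"
    using dpos unfolding closure_approachable by blast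
  have "\<forall>\<^sub>F t in F. dist (M t y) y < \<delta>"
    using sp[OF y(1)] dpos by (rule tendstoD)
  then show "\<forall>\<^sub>F t in F. dist (M t x) x < \<epsilon>"
    using lin bd
  proof eventually_elim
    case (elim t)
    have "M t x - x = M t (x - y) + (M t y - y) + (y - x)"
      using elim(2) by (simp add: linear_diff bounded_linear.linear)
    then have "norm (M t x - x) \<le> norm (M t (x - y)) + norm (M t y - y) + norm (y - x)"
      using norm_triangle_ineq[of "M t (x - y) + (M t y - y)" "y - x"]
        norm_triangle_ineq[of "M t (x - y)" "M t y - y"] by simp
    also have "norm (M t (x - y)) \<le> \<bar>B\<bar> * \<delta>"
    proof -
      have "norm (M t (x - y)) \<le> B * norm (x - y)" using elim(3) by blast
      also have "\<dots> \<le> \<bar>B\<bar> * \<delta>"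
        using y(2) by (intro mult_mono) (auto simp: dist_norm norm_minus_commute)
      finally show ?thesis .
    qed
    also have "\<bar>B\<bar> * \<delta> + norm (M t y - y) + norm (y - x) < \<bar>B\<bar> * \<delta> + \<delta> + \<delta>"
      using elim(1) y(2) by (simp add: dist_norm)
    also have "\<dots> = \<epsilon>"
      by (simp add: \<delta>_def divide_simps) (simp add: algebra_simps)
    finally show ?case by (simp add: dist_norm)
  qed
qed

section \<open>Riesz bases\<close>

text \<open>The next two rules replace the bijection and its inverse function by a pair of mutually inverse
  bounded operators, the form in which they are produced and used.\<close>

lemma riesz_basisE:
  fixes \<phi> :: "'i \<Rightarrow> 'h::real_inner"
  assumes "riesz_basis I \<phi>"
  obtains U U' :: "'h \<Rightarrow> 'h" and b where "bounded_linear U" "bounded_linear U'" "\<And>x. U (U' x) = x" "\<And>x. U' (U x) = x"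
    "orthonormal_basis I b" "\<And>p. p \<in> I \<Longrightarrow> \<phi> p = U (b p)"
proof -
  obtain U :: "'h \<Rightarrow> 'h" and b where "bounded_linear U" "bij U" "bounded_linear (inv U)"
    "orthonormal_basis I b" "\<forall>p\<in>I. \<phi> p = U (b p)"
    using assms unfolding riesz_basis_def by blast
  then show ?thesis
    by (intro that[of U "inv U" b]) (auto simp: bij_is_surj surj_f_inv_f bij_is_inj)
qed

lemma riesz_basisI:
  fixes \<phi> :: "'i \<Rightarrow> 'h::real_inner" and U U' :: "'h \<Rightarrow> 'h"
  assumes "bounded_linear U" "bounded_linear U'" "\<And>x. U (U' x) = x" "\<And>x. U' (U x) = x"
    "orthonormal_basis I b" "\<And>p. p \<in> I \<Longrightarrow> \<phi> p = U (b p)"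
  shows "riesz_basis I \<phi>"
proof -
  have "bij U" by (rule o_bij[of U']) (use assms in auto)
  moreover have "inv U = U'"
    using assms(3,4) by (intro inv_equality) auto
  ultimately show ?thesis
    using assms unfolding riesz_basis_def by blast
qed

lemma orthonormal_basis_family: "orthonormal_basis I b \<Longrightarrow> orthonormal_family I b"
  by (simp add: orthonormal_basis_def orthonormal_family_def)

lemma orthonormal_basis_eqI:
  assumes "orthonormal_basis I b" "\<And>p. p \<in> I \<Longrightarrow> inner x (b p) = inner y (b p)"
  shows "x = y"
proof -
  have "inner x z = inner y z" for z
    using assms by (intro bounded_linear_eq_on_dense_span[of "inner x" "inner y" "b ` I" z])
      (auto simp: orthonormal_basis_def bounded_linear_inner_right)
  then have "inner (x - y) (x - y) = 0"
    by (simp add: inner_diff_left)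
  then show ?thesis by simp
qed

text \<open>The adjoint is written down in coordinates as \<open>y \<mapsto> \<Sum> \<langle>y, S b\<^sub>p\<rangle> b\<^sub>p\<close>. The coefficients are square
  summable because their finite sums of squares are \<open>\<langle>y, S z\<rangle>\<close> for a vector \<open>z\<close> whose squared norm is
  that same sum.\<close>

lemma adjoint_exists:
  fixes S :: "'h::{real_inner, complete_space} \<Rightarrow> 'h" and b :: "'i \<Rightarrow> 'h"
  assumes b: "orthonormal_basis I b" and S: "bounded_linear S"
  obtains S' where "bounded_linear S'" "\<And>x y. inner (S x) y = inner x (S' y)"
proof -
  note ob = orthonormal_basis_family[OF b]
  have bb: "bessel_family I b 1"
    using bessel_multiple_orthonormal[OF ob, of "\<lambda>_. 1" 1] by simp
  obtain K where K: "\<And>x. norm (S x) \<le> norm x * K" "K > 0"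
    using bounded_linear.pos_bounded[OF S] by blast
  have sq: "(\<Sum>p\<in>F. (inner y (S (b p)))\<^sup>2) \<le> (norm y * K)\<^sup>2" if F: "finite F" "F \<subseteq> I" for y F
  proof -
    let ?c = "\<lambda>p. inner y (S (b p))"
    let ?z = "\<Sum>p\<in>F. ?c p *\<^sub>R b p"
    have z: "(norm ?z)\<^sup>2 = (\<Sum>p\<in>F. (?c p)\<^sup>2)"
      by (rule orthonormal_norm_sum[OF ob F])
    have "(\<Sum>p\<in>F. (?c p)\<^sup>2) = inner y (S ?z)"
      using S by (simp add: inner_sum_right linear_sum linear_scale bounded_linear.linear power2_eq_square)
    also have "\<dots> \<le> norm y * (norm ?z * K)"
      using norm_cauchy_schwarz[of y "S ?z"] mult_left_mono[OF K(1)[of ?z], of "norm y"] by auto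
    finally have "(norm ?z)\<^sup>2 \<le> norm y * K * norm ?z" using z by (simp add: mult_ac)
    then have "norm ?z \<le> norm y * K"
      using K(2) by (cases "norm ?z = 0") (auto simp: power2_eq_square)
    then show ?thesis unfolding z[symmetric] by (intro power_mono) auto
  qed
  have sm: "(\<lambda>p. (inner y (S (b p)))\<^sup>2) summable_on I" for y
    by (rule nonneg_bdd_above_summable_on) (auto intro!: bdd_aboveI2[where M = "(norm y * K)\<^sup>2"] sq)
  define S' where "S' y = infsum (\<lambda>p. inner y (S (b p)) *\<^sub>R b p) I" for y
  have hs: "((\<lambda>p. inner y (S (b p)) *\<^sub>R b p) has_sum S' y) I" for y
    unfolding S'_def by (intro has_sum_infsum bessel_summable[OF bb sm])
  have coeff: "inner (S' y) (b p) = inner y (S (b p))" if p: "p \<in> I" for y p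
  proof (rule has_sum_unique)
    show "((\<lambda>q. inner (inner y (S (b q)) *\<^sub>R b q) (b p)) has_sum inner (S' y) (b p)) I"
      using has_sum_bounded_linear[OF bounded_linear_inner_left hs] by (simp add: o_def)
    show "((\<lambda>q. inner (inner y (S (b q)) *\<^sub>R b q) (b p)) has_sum inner y (S (b p))) I"
      using has_sum_single[OF p, of "\<lambda>q. inner (inner y (S (b q)) *\<^sub>R b q) (b p)"] ob p
      by (auto simp: orthonormal_family_def)
  qed
  have adj: "inner (S x) y = inner x (S' y)" for x y
  proof (rule bounded_linear_eq_on_dense_span[of "\<lambda>x. inner (S x) y" "\<lambda>x. inner x (S' y)" "b ` I"])
    show "bounded_linear (\<lambda>x. inner (S x) y)"
      by (rule bounded_linear_compose[OF bounded_linear_inner_left S])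
    show "bounded_linear (\<lambda>x. inner x (S' y))"
      by (rule bounded_linear_inner_left)
    show "closure (span (b ` I)) = UNIV" using b by (simp add: orthonormal_basis_def)
    fix z assume "z \<in> b ` I"
    then show "inner (S z) y = inner z (S' y)"
      using coeff by (auto simp: inner_commute)
  qed
  have "bounded_linear S'"
  proof (rule bounded_linear_intro[of _ K])
    show "S' (x + y) = S' x + S' y" for x y
      by (rule orthonormal_basis_eqI[OF b]) (simp add: coeff inner_left_distrib)
    show "S' (c *\<^sub>R x) = c *\<^sub>R S' x" for c x
      by (rule orthonormal_basis_eqI[OF b]) (simp add: coeff)
    show "norm (S' y) \<le> norm y * K" for y
    proof -
      have "(norm (S' y))\<^sup>2 \<le> 1 * infsum (\<lambda>p. (inner y (S (b p)))\<^sup>2) I"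
        by (rule has_sum_bessel_bound[OF bb sm hs])
      also have "\<dots> \<le> (norm y * K)\<^sup>2"
        using sq infsum_le_finite_sums[OF sm, where b = "(norm y * K)\<^sup>2"] by (simp only: mult_1)
      finally show ?thesis
        by (rule power2_le_imp_le) (use K(2) in simp)
    qed
  qed
  then show ?thesis using adj that by blast
qed

text \<open>With \<open>\<phi> = U b\<close>, biorthogonality says that \<open>U\<^sup>* \<psi>\<^sub>p\<close> has the coefficients of \<open>b\<^sub>p\<close>. So \<open>\<psi>\<close> is the image of
  \<open>b\<close> under the inverse of \<open>U\<^sup>*\<close>, which is the adjoint of the inverse of \<open>U\<close>.\<close>

lemma biorthogonal_riesz_basis:
  fixes \<phi> \<psi> :: "'i \<Rightarrow> 'h::{real_inner, complete_space}"
  assumes phi: "riesz_basis I \<phi>"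
    and bi: "\<And>p q. p \<in> I \<Longrightarrow> q \<in> I \<Longrightarrow> inner (\<phi> p) (\<psi> q) = (if p = q then 1 else 0)"
  shows "riesz_basis I \<psi>"
proof -
  obtain U U' :: "'h \<Rightarrow> 'h" and b where U: "bounded_linear U" "bounded_linear U'" "\<And>x. U (U' x) = x" "\<And>x. U' (U x) = x"
    and b: "orthonormal_basis I b" and Ub: "\<And>p. p \<in> I \<Longrightarrow> \<phi> p = U (b p)"
    by (rule riesz_basisE[OF phi]) (rule that)
  obtain W where W: "bounded_linear W" "\<And>x y. inner (U x) y = inner x (W y)"
    using adjoint_exists[OF b U(1)] by blast
  obtain V where V: "bounded_linear V" "\<And>x y. inner (U' x) y = inner x (V y)"
    using adjoint_exists[OF b U(2)] by blast
  have inj: "y = z" if "\<And>x. inner x y = inner x z" for y z :: 'h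
    using that[of "y - z"] by (metis inner_diff_right inner_eq_zero_iff right_minus_eq)
  have WV: "W (V y) = y" for y
    by (rule inj) (simp add: W(2)[symmetric] V(2)[symmetric] U)
  have VW: "V (W y) = y" for y
    by (rule inj) (simp add: W(2)[symmetric] V(2)[symmetric] U)
  show ?thesis
  proof (rule riesz_basisI[OF V(1) W(1) VW WV b])
    fix p assume p: "p \<in> I"
    have "W (\<psi> p) = b p"
    proof (rule orthonormal_basis_eqI[OF b])
      fix q assume q: "q \<in> I"
      show "inner (W (\<psi> p)) (b q) = inner (b p) (b q)"
        using W(2)[of "b q" "\<psi> p"] Ub[OF q] bi[OF q p] b p q
        by (auto simp: orthonormal_basis_def inner_commute)
    qed
    then show "\<psi> p = V (b p)" using VW by metis
  qed
qed

section \<open>Semigroups that are diagonal in a Riesz basis\<close>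

text \<open>The function \<open>(e\<^sup>s - 1)/s\<close> with its continuous value at 0: the difference quotient at 0 of
  \<open>t \<mapsto> e\<^sup>t\<^sup>\<lambda>\<close> is \<open>\<lambda>\<close> times its value at \<open>t\<lambda>\<close>.\<close>

definition exp_quotient :: "real \<Rightarrow> real" where
  "exp_quotient s = (if s = 0 then 1 else (exp s - 1) / s)"

lemma exp_quotient_mult: "s * exp_quotient s = exp s - 1"
  by (simp add: exp_quotient_def)

lemma exp_quotient_bound: "\<bar>exp_quotient s\<bar> \<le> exp \<bar>w\<bar>" if "s \<le> \<bar>w\<bar>"
proof -
  have w1: "1 \<le> exp \<bar>w\<bar>" by simp
  consider "s = 0" | "s > 0" | "s < 0" by linarith
  then show ?thesis
  proof cases
    case 1 then show ?thesis using w1 by (simp add: exp_quotient_def)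
  next
    case 2
    have "1 - s \<le> exp (- s)" using exp_ge_add_one_self[of "-s"] by simp
    then have "(1 - s) * exp s \<le> 1"
      by (simp add: exp_minus field_simps)
    then have "exp s - 1 \<le> s * exp s" by (simp add: algebra_simps)
    then have "exp_quotient s \<le> exp s" "0 \<le> exp_quotient s" using 2 by (auto simp: exp_quotient_def field_simps)
    moreover have "exp s \<le> exp \<bar>w\<bar>" using that by simp
    ultimately show ?thesis by linarith
  next
    case 3
    have "s \<le> exp s - 1" using exp_ge_add_one_self[of s] by linarith
    moreover have "exp s - 1 \<le> 0" using 3 by simp
    ultimately have "exp_quotient s \<le> 1" "0 \<le> exp_quotient s"
      using 3 by (auto simp: exp_quotient_def divide_le_eq zero_le_divide_iff)
    then show ?thesis using w1 by linarith
  qed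
qed

lemma exp_quotient_tendsto: "((\<lambda>t. exp_quotient (t * l)) \<longlongrightarrow> 1) (at_right 0)"
proof -
  have "((\<lambda>s. (exp s - 1) / s) \<longlongrightarrow> (1::real)) (at 0)"
    using DERIV_exp[of "0::real"] by (simp add: DERIV_def)
  then have "(exp_quotient \<longlongrightarrow> 1) (at 0)"
    by (rule Lim_transform_eventually) (auto simp: exp_quotient_def eventually_at_filter)
  then have "isCont exp_quotient 0"
    by (simp add: isCont_def exp_quotient_def)
  moreover have "((\<lambda>t. t * l) \<longlongrightarrow> 0) (at_right 0)"
    by (auto intro!: tendsto_eq_intros)
  ultimately have "((\<lambda>t. exp_quotient (t * l)) \<longlongrightarrow> exp_quotient 0) (at_right 0)"
    by (rule isCont_tendsto_compose)
  then show ?thesis by (simp add: exp_quotient_def)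
qed

text \<open>After transport by \<open>U\<close> the semigroup multiplies the coefficient at \<open>p\<close> by \<open>e\<^sup>t\<^sup>\<mu>\<close> with \<open>\<mu> = \<mu>\<^sub>p\<close>. If the
  coefficients of \<open>h\<close> are \<open>\<mu>\<^sub>p\<close> times those of \<open>f\<close>, the difference quotient at \<open>f\<close> is a bounded
  multiplier applied to \<open>h\<close>, and these multipliers tend to 1 boundedly. The domain of the generator
  consists of those \<open>f\<close> for which such an \<open>h\<close> exists.\<close>

theorem riesz_basis_semigroup:
  fixes \<phi> \<psi> :: "'i \<Rightarrow> 'h::{real_inner, complete_space}"
  assumes phi: "riesz_basis I \<phi>"
    and bi: "\<And>p q. p \<in> I \<Longrightarrow> q \<in> I \<Longrightarrow> inner (\<phi> p) (\<psi> q) = (if p = q then 1 else 0)"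
    and lam: "\<And>p. p \<in> I \<Longrightarrow> \<mu> p \<le> w"
  obtains T where "C0_semigroup T"
    "\<And>f h. ((\<lambda>t. (1 / t) *\<^sub>R (T t f - f)) \<longlongrightarrow> h) (at_right 0) \<longleftrightarrow>
       (\<forall>p\<in>I. inner h (\<psi> p) = \<mu> p * inner f (\<psi> p))"
proof -
  obtain U U' :: "'h \<Rightarrow> 'h" and b where U: "bounded_linear U" "bounded_linear U'" "\<And>x. U (U' x) = x" "\<And>x. U' (U x) = x"
    and b: "orthonormal_basis I b" and Ub: "\<And>p. p \<in> I \<Longrightarrow> \<phi> p = U (b p)"
    by (rule riesz_basisE[OF phi]) (rule that)
  note ob = orthonormal_basis_family[OF b]
  have obD: "inner (b p) (b q) = (if p = q then 1 else 0)" if "p \<in> I" "q \<in> I" for p q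
    using ob that by (simp add: orthonormal_family_def)
  have dense: "closure (span (b ` I)) = UNIV" using b by (simp add: orthonormal_basis_def)
  \<comment> \<open>The dual family reads off the coefficients of the preimage under \<open>U\<close>.\<close>
  have coeff: "inner (U x) (\<psi> p) = inner x (b p)" if p: "p \<in> I" for x p
  proof (rule bounded_linear_eq_on_dense_span[where F = "\<lambda>x. inner (U x) (\<psi> p)", OF _ _ dense])
    show "bounded_linear (\<lambda>x. inner (U x) (\<psi> p))"
      by (rule bounded_linear_compose[OF bounded_linear_inner_left U(1)])
    show "bounded_linear (\<lambda>x. inner x (b p))" by (rule bounded_linear_inner_left)
    fix z assume "z \<in> b ` I"
    then show "inner (U z) (\<psi> p) = inner z (b p)"
      using p by (auto simp: Ub[symmetric] bi obD)
  qed
  \<comment> \<open>The operator that multiplies the coefficient at \<open>p\<close> by \<open>m p\<close>; meaningful for bounded \<open>m\<close>.\<close>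
  define D where "D m x = infsum (\<lambda>p. inner x (b p) *\<^sub>R m p *\<^sub>R b p) I" for m :: "'i \<Rightarrow> real" and x
  have D_props: "bounded_linear (D m) \<and> (\<forall>x. norm (D m x) \<le> \<bar>M\<bar> * norm x) \<and>
      (\<forall>p\<in>I. D m (b p) = m p *\<^sub>R b p) \<and> (\<forall>x. \<forall>p\<in>I. inner (D m x) (b p) = m p * inner x (b p))"
    if m: "\<forall>p\<in>I. \<bar>m p\<bar> \<le> M" for m M
  proof -
    obtain T where T: "bounded_linear T" "\<And>x. (norm (T x))\<^sup>2 \<le> M\<^sup>2 * (norm x)\<^sup>2"
      "\<And>p. p \<in> I \<Longrightarrow> T (b p) = m p *\<^sub>R b p"
      "\<And>x. ((\<lambda>p. inner x (b p) *\<^sub>R m p *\<^sub>R b p) has_sum T x) I"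
      using synthesis_operator[OF ob bessel_multiple_orthonormal[OF ob, of m M]] m by auto
    have "D m = T" using T(4) by (auto simp: D_def fun_eq_iff infsumI)
    moreover have "norm (T x) \<le> \<bar>M\<bar> * norm x" for x
      using real_sqrt_le_mono[OF T(2)[of x]] by (simp add: real_sqrt_mult)
    moreover have "inner (T x) (b p) = m p * inner x (b p)" if p: "p \<in> I" for x p
    proof (rule bounded_linear_eq_on_dense_span[where F = "\<lambda>x. inner (T x) (b p)", OF _ _ dense])
      show "bounded_linear (\<lambda>x. inner (T x) (b p))"
        by (rule bounded_linear_compose[OF bounded_linear_inner_left T(1)])
      show "bounded_linear (\<lambda>x. m p * inner x (b p))"
        by (intro bounded_linear_const_mult bounded_linear_inner_left)
      fix z assume "z \<in> b ` I"
      then show "inner (T z) (b p) = m p * inner z (b p)"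
        using p by (auto simp: T(3) obD)
    qed
    ultimately show ?thesis
      using T(1,3) by simp
  qed
  have D: "bounded_linear (D m)" "norm (D m x) \<le> \<bar>M\<bar> * norm x"
    "p \<in> I \<Longrightarrow> D m (b p) = m p *\<^sub>R b p" "p \<in> I \<Longrightarrow> inner (D m x) (b p) = m p * inner x (b p)"
    if m: "\<forall>p\<in>I. \<bar>m p\<bar> \<le> M" for m M x p
    using D_props[OF m] by blast+
  have Dlim: "((\<lambda>t. D (m t) x) \<longlongrightarrow> x) (at_right 0)"
    if m: "\<And>t p. 0 < t \<Longrightarrow> t < 1 \<Longrightarrow> p \<in> I \<Longrightarrow> \<bar>m t p\<bar> \<le> M"
      and l: "\<And>p. p \<in> I \<Longrightarrow> ((\<lambda>t. m t p) \<longlongrightarrow> 1) (at_right 0)" for m :: "real \<Rightarrow> 'i \<Rightarrow> real" and M x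
  proof (rule tendsto_id_of_tendsto_on_dense_span[OF _ _ _ dense])
    have ev: "\<forall>\<^sub>F t in at_right 0. \<forall>p\<in>I. \<bar>m t p\<bar> \<le> M"
      using eventually_at_right_real[of 0 1] by (auto elim!: eventually_mono intro: m)
    show "\<forall>\<^sub>F t in at_right 0. bounded_linear (D (m t))"
      using ev by eventually_elim (rule D(1))
    show "\<forall>\<^sub>F t in at_right 0. \<forall>x. norm (D (m t) x) \<le> \<bar>M\<bar> * norm x"
      using ev by eventually_elim (use D(2) in blast)
    fix z assume "z \<in> b ` I"
    then obtain p where p: "p \<in> I" "z = b p" by auto
    have "((\<lambda>t. m t p *\<^sub>R b p) \<longlongrightarrow> 1 *\<^sub>R b p) (at_right 0)"
      by (intro tendsto_intros l p)
    moreover have "\<forall>\<^sub>F t in at_right 0. m t p *\<^sub>R b p = D (m t) z"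
      using ev by eventually_elim (use D(3) p in auto)
    ultimately show "((\<lambda>t. D (m t) z) \<longlongrightarrow> z) (at_right 0)"
      using p by (auto intro: Lim_transform_eventually)
  qed
  define m where "m t p = exp (t * \<mu> p)" for t p
  have m_bd: "\<forall>p\<in>I. \<bar>m t p\<bar> \<le> exp (t * w)" if "t \<ge> 0" for t
    using that lam by (auto simp: m_def intro: mult_left_mono)
  define T where "T t x = U (D (m t) (U' x))" for t x
  have UT: "U' (T t x) = D (m t) (U' x)" for t x by (simp add: T_def U)
  have m_bd': "\<bar>m t p\<bar> \<le> exp \<bar>w\<bar>" if "0 < t" "t < 1" "p \<in> I" for t p
  proof -
    have "t * w \<le> t * \<bar>w\<bar>" using that by (intro mult_left_mono) auto
    also have "\<dots> \<le> \<bar>w\<bar>" using that by (simp add: mult_left_le_one_le)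
    finally have "exp (t * w) \<le> exp \<bar>w\<bar>" by simp
    moreover have "\<bar>m t p\<bar> \<le> exp (t * w)" using m_bd[of t] that by simp
    ultimately show ?thesis by linarith
  qed
  have m_lim: "((\<lambda>t. m t p) \<longlongrightarrow> 1) (at_right 0)" for p
    unfolding m_def by (auto intro!: tendsto_eq_intros)
  have U_lim: "((\<lambda>t. U (g t)) \<longlongrightarrow> U x) F" if "(g \<longlongrightarrow> x) F" for g :: "real \<Rightarrow> 'h" and x F
    by (rule bounded_linear.tendsto[OF U(1) that])
  have C0: "C0_semigroup T"
    unfolding C0_semigroup_def
  proof safe
    fix t :: real assume t: "0 \<le> t"
    show "bounded_linear (T t)"
      unfolding T_def using bounded_linear_compose[OF U(1) bounded_linear_compose[OF D(1)[OF m_bd[OF t]] U(2)]] .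
  next
    have "D (m 0) x = x" for x
      by (rule orthonormal_basis_eqI[OF b]) (simp add: D(4)[OF m_bd] m_def)
    then show "T 0 = id" by (simp add: T_def fun_eq_iff U)
  next
    fix s t :: real assume st: "0 \<le> s" "0 \<le> t"
    have "D (m (s + t)) x = D (m s) (D (m t) x)" for x
      by (rule orthonormal_basis_eqI[OF b])
        (use st in \<open>simp add: D(4)[OF m_bd], simp add: m_def exp_add distrib_right\<close>)
    then show "T (s + t) = T s \<circ> T t"
      by (simp add: T_def fun_eq_iff U)
  next
    fix f
    show "((\<lambda>t. T t f) \<longlongrightarrow> f) (at_right 0)"
      using U_lim[OF Dlim[of m "exp \<bar>w\<bar>" "U' f", OF m_bd' m_lim]] by (simp add: T_def U)
  qed
  have gen: "((\<lambda>t. (1 / t) *\<^sub>R (T t f - f)) \<longlongrightarrow> h) (at_right 0) \<longleftrightarrow>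
       (\<forall>p\<in>I. inner h (\<psi> p) = \<mu> p * inner f (\<psi> p))" (is "?L \<longleftrightarrow> ?R") for f h
  proof
    assume L: ?L
    show ?R
    proof
      fix p assume p: "p \<in> I"
      have "((\<lambda>t. inner ((1 / t) *\<^sub>R (T t f - f)) (\<psi> p)) \<longlongrightarrow> inner h (\<psi> p)) (at_right 0)"
        by (intro tendsto_intros L)
      moreover have "\<forall>\<^sub>F t in at_right 0. inner ((1 / t) *\<^sub>R (T t f - f)) (\<psi> p)
          = exp_quotient (t * \<mu> p) * (\<mu> p * inner f (\<psi> p))"
        using eventually_at_right_less[of 0]
      proof eventually_elim
        case (elim t)
        have "inner (T t f) (\<psi> p) = m t p * inner f (\<psi> p)"
          using coeff[OF p, of "D (m t) (U' f)"] coeff[OF p, of "U' f"] D(4)[OF m_bd[of t] p] elim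
          by (simp add: T_def U)
        then have "inner ((1 / t) *\<^sub>R (T t f - f)) (\<psi> p) = (1 / t) * ((m t p - 1) * inner f (\<psi> p))"
          by (simp add: inner_diff_left algebra_simps)
        also have "m t p - 1 = t * \<mu> p * exp_quotient (t * \<mu> p)" by (simp add: exp_quotient_mult m_def)
        finally show ?case using elim by simp
      qed
      ultimately have "((\<lambda>t. exp_quotient (t * \<mu> p) * (\<mu> p * inner f (\<psi> p))) \<longlongrightarrow> inner h (\<psi> p)) (at_right 0)"
        by (rule Lim_transform_eventually)
      moreover have "((\<lambda>t. exp_quotient (t * \<mu> p) * (\<mu> p * inner f (\<psi> p))) \<longlongrightarrow> 1 * (\<mu> p * inner f (\<psi> p))) (at_right 0)"
        by (intro tendsto_intros exp_quotient_tendsto)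
      ultimately show "inner h (\<psi> p) = \<mu> p * inner f (\<psi> p)"
        using tendsto_unique[OF trivial_limit_at_right_real] by (metis mult_1)
    qed
  next
    assume R: ?R
    define g where "g t p = exp_quotient (t * \<mu> p)" for t p
    have g_bd: "\<bar>g t p\<bar> \<le> exp \<bar>w\<bar>" if "0 < t" "t < 1" "p \<in> I" for t p
    proof -
      have "t * \<mu> p \<le> t * \<bar>w\<bar>" using lam[OF that(3)] that(1) by (intro mult_left_mono) auto
      also have "\<dots> \<le> \<bar>w\<bar>" using that by (simp add: mult_left_le_one_le)
      finally show ?thesis unfolding g_def by (rule exp_quotient_bound)
    qed
    have "((\<lambda>t. U (D (g t) (U' h))) \<longlongrightarrow> h) (at_right 0)"
      using U_lim[OF Dlim[of g "exp \<bar>w\<bar>" "U' h", OF g_bd]] by (simp add: g_def exp_quotient_tendsto U)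
    moreover have "\<forall>\<^sub>F t in at_right 0. U (D (g t) (U' h)) = (1 / t) *\<^sub>R (T t f - f)"
      using eventually_at_right_real[of 0 1, OF zero_less_one]
    proof eventually_elim
      case (elim t)
      have "D (g t) (U' h) = (1 / t) *\<^sub>R (D (m t) (U' f) - U' f)"
      proof (rule orthonormal_basis_eqI[OF b])
        fix p assume p: "p \<in> I"
        have gb: "\<forall>p\<in>I. \<bar>g t p\<bar> \<le> exp \<bar>w\<bar>" using g_bd elim by auto
        have h: "inner (U' h) (b p) = \<mu> p * inner (U' f) (b p)"
          using R p coeff[OF p, of "U' f"] coeff[OF p, of "U' h"] by (simp add: U)
        have "inner ((1 / t) *\<^sub>R (D (m t) (U' f) - U' f)) (b p) = (1 / t) * ((m t p - 1) * inner (U' f) (b p))"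
          using elim D(4)[OF m_bd[of t] p] by (simp add: inner_diff_left algebra_simps)
        also have "m t p - 1 = t * \<mu> p * exp_quotient (t * \<mu> p)" by (simp add: exp_quotient_mult m_def)
        finally show "inner (D (g t) (U' h)) (b p) = inner ((1 / t) *\<^sub>R (D (m t) (U' f) - U' f)) (b p)"
          using elim by (simp add: D(4)[OF gb p] h g_def)
      qed
      then show ?case
        using U(1) by (simp add: T_def linear_scale linear_diff bounded_linear.linear U(3))
    qed
    ultimately show ?L by (rule Lim_transform_eventually)
  qed
  show ?thesis using that[OF C0 gen] .
qed

section \<open>Nilpotent perturbations and componentwise operators\<close>

text \<open>The inverse is the Neumann series \<open>\<Sum> (-K)\<^sup>m\<close>, which is finite here, so that \<open>K\<close> only has to be bounded.\<close>

lemma nilpotent_perturbation_inverse: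
  fixes K :: "'h::real_normed_vector \<Rightarrow> 'h"
  assumes K: "bounded_linear K" and nil: "\<And>x. (K ^^ n) x = 0"
  obtains V where "bounded_linear V" "\<And>x. V x + K (V x) = x" "\<And>x. V (x + K x) = x"
proof
  define V where "V x = (\<Sum>m<n. (- 1) ^ m *\<^sub>R (K ^^ m) x)" for x
  have Km: "bounded_linear (K ^^ m)" for m
  proof (induction m)
    case (Suc m) then show ?case
      using bounded_linear_compose[OF K Suc] by (simp add: o_def)
  qed (simp add: bounded_linear_ident id_def)
  show "bounded_linear V"
    unfolding V_def by (intro bounded_linear_sum bounded_linear_const_scaleR Km)
  have lin: "linear K" using K by (rule bounded_linear.linear)
  define s where "s m x = ((- 1) ^ m *\<^sub>R (K ^^ m) x)" for m :: nat and x
  have tel: "(\<Sum>m<n. s m x - s (Suc m) x) = x" for x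
    by (subst sum_lessThan_telescope') (simp add: s_def nil)
  show 1: "V x + K (V x) = x" for x
  proof -
    have "V x + K (V x) = (\<Sum>m<n. s m x - s (Suc m) x)"
      by (simp add: V_def s_def linear_sum[OF lin] linear_scale[OF lin] sum.distrib[symmetric])
    then show ?thesis using tel by simp
  qed
  show "V (x + K x) = x" for x
  proof -
    have "V (x + K x) = (\<Sum>m<n. s m x - s (Suc m) x)"
      using bounded_linear.linear[OF Km]
      by (simp add: V_def s_def linear_add scaleR_add_right funpow_swap1)
    then show ?thesis using tel by simp
  qed
qed

lemma bounded_linear_vecI:
  fixes F :: "'a::real_normed_vector \<Rightarrow> 'b::real_normed_vector ^ 'n"
  assumes "\<And>l. bounded_linear (\<lambda>x. F x $ l)"
  shows "bounded_linear F"
proof -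
  have "\<exists>K. \<forall>x. norm (F x $ l) \<le> norm x * K" for l
    using bounded_linear.bounded[OF assms[of l]] .
  then obtain K where K: "\<And>l x. norm (F x $ l) \<le> norm x * K l" by metis
  show ?thesis
  proof (rule bounded_linear_intro)
    show "F (x + y) = F x + F y" for x y
      by (simp add: vec_eq_iff linear_add[OF bounded_linear.linear[OF assms]])
    show "F (c *\<^sub>R x) = c *\<^sub>R F x" for c x
      by (simp add: vec_eq_iff linear_scale[OF bounded_linear.linear[OF assms]])
    show "norm (F x) \<le> norm x * (\<Sum>l\<in>UNIV. K l)" for x
    proof -
      have "norm (F x) \<le> (\<Sum>l\<in>UNIV. norm (F x $ l))"
        unfolding norm_vec_def by (rule L2_set_le_sum) simp
      also have "\<dots> \<le> (\<Sum>l\<in>UNIV. norm x * K l)" by (rule sum_mono[OF K])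
      finally show ?thesis by (simp add: sum_distrib_left)
    qed
  qed
qed

section \<open>Square integrable functions and their classes\<close>

lemma finite_unit_measure: "finite_measure unit_measure"
  by (intro finite_measureI) (simp add: emeasure_restrict_space space_restrict_space)

lemma space_unit_measure [simp]: "space unit_measure = {0<..<1}"
  by (simp add: space_restrict_space)

lemma square_integrable_bounded:
  assumes m: "f \<in> borel_measurable unit_measure" and B: "\<And>x. x \<in> {0<..<1} \<Longrightarrow> \<bar>f x\<bar> \<le> B"
  shows "square_integrable f"
  unfolding square_integrable_def
proof (intro conjI m, rule Bochner_Integration.integrable_bound)
  show "integrable unit_measure (\<lambda>x. B\<^sup>2)"
    by (rule finite_measure.integrable_const[OF finite_unit_measure])
  show "(\<lambda>x. (f x)\<^sup>2) \<in> borel_measurable unit_measure"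
    using m by (rule borel_measurable_power)
  have "(f x)\<^sup>2 \<le> B\<^sup>2" if "x \<in> {0<..<1}" for x
    using B[of x] that abs_le_square_iff[of "f x" B] by auto
  then show "AE x in unit_measure. norm ((f x)\<^sup>2) \<le> norm (B\<^sup>2)"
    by (intro AE_I2) auto
qed

lemma square_integrable_const: "square_integrable (\<lambda>x. c)"
  by (rule square_integrable_bounded[where B = "\<bar>c\<bar>"]) auto

lemma square_integrable_indicator: "square_integrable (indicat_real {..x})"
proof (rule square_integrable_bounded[where B = 1])
  have "{..x} \<in> sets lebesgue" by simp
  then have "indicat_real {..x} \<in> borel_measurable lebesgue"
    by (rule borel_measurable_indicator)
  then show "indicat_real {..x} \<in> borel_measurable unit_measure"
    by (rule measurable_restrict_space1)
qed (auto simp: indicator_def)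

lemma square_integrable_integrable:
  assumes "square_integrable f" shows "integrable unit_measure f"
  using square_integrable_mult[OF assms square_integrable_const[of 1]] by simp

lemma square_integrable_diff:
  assumes "square_integrable f" "square_integrable g"
  shows "square_integrable (\<lambda>x. f x - g x)"
  using square_integrable_add[OF assms(1) square_integrable_scale[OF assms(2), of "- 1"]] by simp

lemma l2_eq_refl: "l2_eq f f \<longleftrightarrow> square_integrable f"
  by (simp add: l2_eq_def)

lemma rep_l2_square_integrable: "square_integrable (rep_l2 u)"
  using Quotient_rep_reflp[OF Quotient_l2] by (simp add: l2_eq_def)

lemma mk_rep_l2 [simp]: "mk_l2 (rep_l2 u) = u"
  by (rule Quotient_abs_rep[OF Quotient_l2])

lemma mk_l2_eq_iff:
  assumes "square_integrable f" "square_integrable g"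
  shows "mk_l2 f = mk_l2 g \<longleftrightarrow> (AE x in unit_measure. f x = g x)"
  using Quotient_rel[OF Quotient_l2, of f g] assms by (auto simp: l2_eq_def)

lemma plus_mk_l2:
  "square_integrable f \<Longrightarrow> square_integrable g \<Longrightarrow> mk_l2 f + mk_l2 g = mk_l2 (\<lambda>x. f x + g x)"
  by (rule plus_l2.abs_eq) (auto simp: l2_eq_refl)

lemma scaleR_mk_l2: "square_integrable f \<Longrightarrow> c *\<^sub>R mk_l2 f = mk_l2 (\<lambda>x. c * f x)"
  by (rule scaleR_l2.abs_eq) (auto simp: l2_eq_refl)

lemma diff_mk_l2:
  assumes "square_integrable f" "square_integrable g"
  shows "mk_l2 f - mk_l2 g = mk_l2 (\<lambda>x. f x - g x)"
proof -
  have "mk_l2 f - mk_l2 g = mk_l2 f + (- 1) *\<^sub>R mk_l2 g" by simp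
  also have "\<dots> = mk_l2 (\<lambda>x. f x + (- 1) * g x)"
    by (simp only: scaleR_mk_l2 plus_mk_l2 square_integrable_scale assms)
  finally show ?thesis by simp
qed

lemma inner_mk_l2:
  "square_integrable f \<Longrightarrow> square_integrable g \<Longrightarrow>
     inner (mk_l2 f) (mk_l2 g) = integral\<^sup>L unit_measure (\<lambda>x. f x * g x)"
  by (rule inner_l2.abs_eq) (auto simp: l2_eq_refl)

lemma inner_l2_mk:
  assumes "square_integrable g"
  shows "inner u (mk_l2 g) = integral\<^sup>L unit_measure (\<lambda>x. rep_l2 u x * g x)"
  using inner_mk_l2[OF rep_l2_square_integrable assms, of u] by simp

lemma norm_mk_l2:
  "square_integrable f \<Longrightarrow> (norm (mk_l2 f))\<^sup>2 = integral\<^sup>L unit_measure (\<lambda>x. (f x)\<^sup>2)"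
  unfolding power2_norm_eq_inner by (simp add: inner_mk_l2 power2_eq_square)

lemma norm_mk_l2_le:
  assumes m: "f \<in> borel_measurable unit_measure" and B: "\<And>x. x \<in> {0<..<1} \<Longrightarrow> \<bar>f x\<bar> \<le> B"
  shows "norm (mk_l2 f) \<le> \<bar>B\<bar>"
proof -
  have si: "square_integrable f" by (rule square_integrable_bounded[OF m B])
  have "(norm (mk_l2 f))\<^sup>2 = integral\<^sup>L unit_measure (\<lambda>x. (f x)\<^sup>2)"
    by (rule norm_mk_l2[OF si])
  also have "\<dots> \<le> integral\<^sup>L unit_measure (\<lambda>x. B\<^sup>2)"
  proof (rule integral_mono)
    show "integrable unit_measure (\<lambda>x. (f x)\<^sup>2)" using si by (simp add: square_integrable_def)
    show "integrable unit_measure (\<lambda>x. B\<^sup>2)"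
      by (rule finite_measure.integrable_const[OF finite_unit_measure])
    show "(f x)\<^sup>2 \<le> B\<^sup>2" if "x \<in> space unit_measure" for x
      using B[of x] that abs_le_square_iff[of "f x" B] by auto
  qed
  also have "\<dots> = \<bar>B\<bar>\<^sup>2"
    by (simp add: measure_restrict_space)
  finally show ?thesis by (rule power2_le_imp_le) simp
qed

section \<open>Completeness of L2\<close>

text \<open>Fatou's lemma turns the Cauchy property in norm into closeness to the almost everywhere limit; that
  the limit is square integrable is part of the conclusion.\<close>

lemma square_integrable_of_close:
  assumes fm: "\<And>n. square_integrable (f n)" and g: "g \<in> borel_measurable unit_measure"
    and lim: "AE x in unit_measure. (\<lambda>n. f n x) \<longlonglongrightarrow> g x"
    and close: "\<And>m. m \<ge> n \<Longrightarrow> norm (mk_l2 (f n) - mk_l2 (f m)) \<le> \<epsilon>" and e: "\<epsilon> \<ge> 0"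
  shows "square_integrable g \<and> norm (mk_l2 (f n) - mk_l2 g) \<le> \<epsilon>"
proof -
  have meas: "f m \<in> borel_measurable unit_measure" for m
    using fm[of m] by (simp add: square_integrable_def)
  let ?d = "\<lambda>x. f n x - g x"
  have dm: "?d \<in> borel_measurable unit_measure" using meas g by (rule borel_measurable_diff)
  have "(\<integral>\<^sup>+x. ennreal ((?d x)\<^sup>2) \<partial>unit_measure)
      = (\<integral>\<^sup>+x. liminf (\<lambda>m. ennreal ((f n x - f m x)\<^sup>2)) \<partial>unit_measure)"
  proof (rule nn_integral_cong_AE, use lim in eventually_elim)
    case (elim x)
    then have "(\<lambda>m. ennreal ((f n x - f m x)\<^sup>2)) \<longlonglongrightarrow> ennreal ((?d x)\<^sup>2)"
      by (intro tendsto_ennrealI tendsto_intros)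
    then show ?case by (metis lim_imp_Liminf sequentially_bot)
  qed
  also have "\<dots> \<le> liminf (\<lambda>m. \<integral>\<^sup>+x. ennreal ((f n x - f m x)\<^sup>2) \<partial>unit_measure)"
    using meas by (intro nn_integral_liminf measurable_compose[OF _ measurable_ennreal]
        borel_measurable_power borel_measurable_diff)
  also have "\<dots> \<le> ennreal (\<epsilon>\<^sup>2)"
  proof (rule Liminf_le)
    have "(\<integral>\<^sup>+x. ennreal ((f n x - f m x)\<^sup>2) \<partial>unit_measure) \<le> ennreal (\<epsilon>\<^sup>2)" if "m \<ge> n" for m
    proof -
      have si: "square_integrable (\<lambda>x. f n x - f m x)" by (intro square_integrable_diff fm)
      then have "(\<integral>\<^sup>+x. ennreal ((f n x - f m x)\<^sup>2) \<partial>unit_measure)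
          = ennreal (integral\<^sup>L unit_measure (\<lambda>x. (f n x - f m x)\<^sup>2))"
        by (intro nn_integral_eq_integral) (auto simp: square_integrable_def)
      also have "\<dots> = ennreal ((norm (mk_l2 (f n) - mk_l2 (f m)))\<^sup>2)"
        by (simp add: norm_mk_l2[OF si] diff_mk_l2 fm)
      also have "\<dots> \<le> ennreal (\<epsilon>\<^sup>2)"
        using close[OF that] by (intro ennreal_leI power_mono) auto
      finally show ?thesis .
    qed
    then show "\<forall>\<^sub>F m in sequentially. (\<integral>\<^sup>+x. ennreal ((f n x - f m x)\<^sup>2) \<partial>unit_measure) \<le> ennreal (\<epsilon>\<^sup>2)"
      by (auto simp: eventually_sequentially)
  qed simp
  finally have le: "(\<integral>\<^sup>+x. ennreal ((?d x)\<^sup>2) \<partial>unit_measure) \<le> ennreal (\<epsilon>\<^sup>2)" .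
  have int: "integrable unit_measure (\<lambda>x. (?d x)\<^sup>2)"
  proof (rule integrableI_bounded)
    show "(\<lambda>x. (?d x)\<^sup>2) \<in> borel_measurable unit_measure" using dm by (rule borel_measurable_power)
    show "(\<integral>\<^sup>+x. ennreal (norm ((?d x)\<^sup>2)) \<partial>unit_measure) < \<infinity>"
      using le by (simp add: le_less_trans)
  qed
  then have sd: "square_integrable ?d" using dm by (simp add: square_integrable_def)
  have sg: "square_integrable g"
    using square_integrable_diff[OF fm[of n] sd] by simp
  have "ennreal (integral\<^sup>L unit_measure (\<lambda>x. (?d x)\<^sup>2)) \<le> ennreal (\<epsilon>\<^sup>2)"
    using le nn_integral_eq_integral[OF int] by simp
  then have "(norm (mk_l2 (f n) - mk_l2 g))\<^sup>2 \<le> \<epsilon>\<^sup>2"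
    using e by (simp add: norm_mk_l2[OF sd] diff_mk_l2 fm sg)
  then have "norm (mk_l2 (f n) - mk_l2 g) \<le> \<epsilon>"
    using e by (rule power2_le_imp_le)
  then show ?thesis using sg by blast
qed

text \<open>On a space of measure one the \<open>L\<^sup>2\<close> norm dominates the \<open>L\<^sup>1\<close> norm. Hence the increments have a summable
  integral, and therefore are summable at almost every point.\<close>

lemma AE_convergent_of_rapidly_Cauchy:
  assumes f: "\<And>n. square_integrable (f n)"
    and rapid: "\<And>n. norm (mk_l2 (f (Suc n)) - mk_l2 (f n)) \<le> (1/2) ^ n"
  shows "AE x in unit_measure. convergent (\<lambda>n. f n x)"
proof -
  define d where "d n x = \<bar>f (Suc n) x - f n x\<bar>" for n x
  have sid: "square_integrable (d n)" for n
    using square_integrable_diff[OF f[of "Suc n"] f[of n]]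
    unfolding square_integrable_def d_def[abs_def] power2_abs by (auto intro: borel_measurable_abs)
  have I: "(\<integral>\<^sup>+x. ennreal (d n x) \<partial>unit_measure) \<le> ennreal ((1/2) ^ n)" for n
  proof -
    have sd: "square_integrable (\<lambda>x. f (Suc n) x - f n x)" by (intro square_integrable_diff f)
    have "(\<integral>\<^sup>+x. ennreal (d n x) \<partial>unit_measure) = ennreal (integral\<^sup>L unit_measure (d n))"
      by (rule nn_integral_eq_integral[OF square_integrable_integrable[OF sid]]) (simp add: d_def)
    also have "integral\<^sup>L unit_measure (d n) = inner (mk_l2 (d n)) (mk_l2 (\<lambda>x. 1))"
      by (simp add: inner_mk_l2 sid square_integrable_const)
    also have "\<dots> \<le> norm (mk_l2 (d n)) * norm (mk_l2 (\<lambda>x. 1))"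
      by (rule norm_cauchy_schwarz)
    also have "\<dots> \<le> norm (mk_l2 (d n)) * 1"
      using norm_mk_l2_le[of "\<lambda>x. 1" 1] by (intro mult_left_mono) auto
    also have "(norm (mk_l2 (d n)))\<^sup>2 = (norm (mk_l2 (f (Suc n)) - mk_l2 (f n)))\<^sup>2"
      by (simp add: norm_mk_l2 sid sd diff_mk_l2 f) (simp add: d_def)
    then have "norm (mk_l2 (d n)) * 1 \<le> (1/2) ^ n"
      using rapid[of n] by (simp add: power2_eq_iff_nonneg)
    finally show ?thesis by (simp add: ennreal_leI)
  qed
  have dmeas: "(\<lambda>x. ennreal (d n x)) \<in> borel_measurable unit_measure" for n
    using sid by (intro measurable_compose[OF _ measurable_ennreal]) (simp add: square_integrable_def)
  have "(\<integral>\<^sup>+x. (\<Sum>n. ennreal (d n x)) \<partial>unit_measure) = (\<Sum>n. \<integral>\<^sup>+x. ennreal (d n x) \<partial>unit_measure)"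
    by (rule nn_integral_suminf[OF dmeas])
  also have "\<dots> \<le> (\<Sum>n. ennreal ((1/2) ^ n))"
    by (intro suminf_le I summableI)
  also have "\<dots> = ennreal (\<Sum>n. (1/2) ^ n)"
    by (intro suminf_ennreal2 summable_geometric) auto
  finally have "(\<integral>\<^sup>+x. (\<Sum>n. ennreal (d n x)) \<partial>unit_measure) \<noteq> \<infinity>"
    by (auto simp: top_unique)
  then have "AE x in unit_measure. (\<Sum>n. ennreal (d n x)) \<noteq> \<infinity>"
    by (intro nn_integral_noteq_infinite borel_measurable_suminf_order dmeas)
  then show ?thesis
  proof eventually_elim
    case (elim x)
    then have "summable (\<lambda>n. d n x)"
      by (intro summable_suminf_not_top) (auto simp: d_def)
    then have "summable (\<lambda>n. f (Suc n) x - f n x)"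
      by (intro summable_norm_cancel[of "\<lambda>n. f (Suc n) x - f n x"]) (simp add: d_def)
    then have "convergent (\<lambda>n. \<Sum>i<n. f (Suc i) x - f i x)"
      by (simp add: summable_iff_convergent)
    then have "convergent (\<lambda>n. f n x - f 0 x)"
      by (subst (asm) sum_lessThan_telescope)
    then have "convergent (\<lambda>n. f n x - f 0 x + f 0 x)"
      by (intro convergent_add convergent_const)
    then show ?case by simp
  qed
qed

text \<open>The Riesz-Fischer argument: a subsequence is chosen that converges geometrically in norm, hence
  almost everywhere, and a Cauchy sequence follows its convergent subsequences.\<close>

instance l2 :: complete_space
proof
  fix X :: "nat \<Rightarrow> l2"
  assume X: "Cauchy X"
  have "\<exists>N. \<forall>n. \<forall>i\<ge>N n. \<forall>j\<ge>N n. dist (X i) (X j) < (1/2) ^ n"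
    using X unfolding Cauchy_def by (intro choice allI) simp
  then obtain N where N: "\<And>n i j. i \<ge> N n \<Longrightarrow> j \<ge> N n \<Longrightarrow> dist (X i) (X j) < (1/2) ^ n"
    by blast
  \<comment> \<open>The sum makes \<open>r n\<close> at least \<open>N n\<close>, and the summand \<open>n\<close> makes \<open>r\<close> strictly increasing.\<close>
  define r where "r n = (\<Sum>i\<le>n. N i) + n" for n
  have rN: "r m \<ge> N n" if "n \<le> m" for n m
    using that member_le_sum[of n "{..m}" N] by (auto simp: r_def intro: trans_le_add1)
  have r: "strict_mono r"
    by (rule strict_monoI_Suc) (simp add: r_def)
  define f where "f n = rep_l2 (X (r n))" for n
  have f: "square_integrable (f n)" "mk_l2 (f n) = X (r n)" for n
    by (auto simp: f_def rep_l2_square_integrable)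
  have close: "norm (mk_l2 (f n) - mk_l2 (f m)) \<le> (1/2) ^ n" if "m \<ge> n" for n m
    using N[of n "r n" "r m"] rN that by (simp add: f(2) dist_norm less_imp_le)
  have "AE x in unit_measure. convergent (\<lambda>n. f n x)"
    using f(1) close by (intro AE_convergent_of_rapidly_Cauchy) (auto simp: norm_minus_commute)
  then have lim: "AE x in unit_measure. (\<lambda>n. f n x) \<longlonglongrightarrow> lim (\<lambda>n. f n x)"
    by eventually_elim (simp add: convergent_LIMSEQ_iff)
  have g: "(\<lambda>x. lim (\<lambda>n. f n x)) \<in> borel_measurable unit_measure"
    using f(1) by (intro borel_measurable_lim_metric) (simp add: square_integrable_def)
  define u where "u = mk_l2 (\<lambda>x. lim (\<lambda>n. f n x))"
  have bd: "dist (X (r n)) u \<le> (1/2) ^ n" for n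
    using square_integrable_of_close[OF f(1) g lim close, of n] by (simp add: f(2) u_def dist_norm)
  have "(\<lambda>n. X (r n)) \<longlonglongrightarrow> u"
  proof (rule metric_tendsto_imp_tendsto)
    show "(\<lambda>n. (1/2::real) ^ n) \<longlonglongrightarrow> 0" by (intro LIMSEQ_power_zero) auto
    show "\<forall>\<^sub>F n in sequentially. dist (X (r n)) u \<le> dist ((1/2::real) ^ n) 0"
      using bd by (intro always_eventually) simp
  qed
  then have "X \<longlonglongrightarrow> u"
    by (intro Cauchy_converges_subseq[OF X r]) (simp add: o_def)
  then show "convergent X" by (auto simp: convergent_def)
qed

section \<open>The cosine basis\<close>

lemma borel_measurable_unit_continuous:
  assumes "continuous_on {0<..<1} g"
  shows "g \<in> borel_measurable unit_measure"
  using assms by (intro continuous_imp_measurable_on_sets_lebesgue) auto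

text \<open>The sign of \<open>f\<close> is an almost everywhere limit of continuous functions, which may be truncated to
  \<open>[-1, 1]\<close>. By dominated convergence the integral of \<open>f sgn f = \<bar>f\<bar>\<close> vanishes.\<close>

lemma AE_zero_of_orthogonal_continuous:
  fixes f :: "real \<Rightarrow> real"
  assumes f: "integrable unit_measure f"
    and orth: "\<And>g. continuous_on UNIV g \<Longrightarrow> integral\<^sup>L unit_measure (\<lambda>x. f x * g x) = 0"
  shows "AE x in unit_measure. f x = 0"
proof -
  have fm: "f \<in> borel_measurable unit_measure" using f by simp
  have "(\<lambda>x. sgn (f x)) \<in> borel_measurable unit_measure"
    by (rule measurable_compose[OF fm]) simp
  then have "(\<lambda>x. sgn (f x)) measurable_on {0<..<1}"
    by (subst measurable_on_iff_borel_measurable) auto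
  then obtain N g where N: "negligible N" and g: "\<And>n. continuous_on UNIV (g n)"
    and lim: "\<And>x. x \<notin> N \<Longrightarrow> (\<lambda>n. g n x) \<longlonglongrightarrow> (if x \<in> {0<..<1} then sgn (f x) else 0)"
    unfolding measurable_on_def by blast
  define h where "h n x = max (- 1) (min 1 (g n x))" for n x
  have h: "continuous_on UNIV (h n)" for n
    unfolding h_def by (intro continuous_intros g)
  have hm: "h n \<in> borel_measurable unit_measure" for n
    by (rule borel_measurable_unit_continuous[OF continuous_on_subset[OF h]]) simp
  have "AE x in lebesgue. x \<notin> N"
    using N by (simp add: negligible_iff_null_sets AE_not_in)
  then have "AE x in unit_measure. x \<notin> N"
    by (subst AE_restrict_space_iff) auto
  then have pw: "AE x in unit_measure. (\<lambda>n. f x * h n x) \<longlonglongrightarrow> \<bar>f x\<bar>"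
    using AE_space
  proof eventually_elim
    case (elim x)
    have "(\<lambda>n. f x * h n x) \<longlonglongrightarrow> f x * max (- 1) (min 1 (sgn (f x)))"
      unfolding h_def using lim[OF elim(1)] elim(2) by (intro tendsto_intros) auto
    also have "f x * max (- 1) (min 1 (sgn (f x))) = \<bar>f x\<bar>"
      by (simp add: sgn_if)
    finally show ?case .
  qed
  have "(\<lambda>n. integral\<^sup>L unit_measure (\<lambda>x. f x * h n x)) \<longlonglongrightarrow> integral\<^sup>L unit_measure (\<lambda>x. \<bar>f x\<bar>)"
  proof (rule integral_dominated_convergence[where w = "\<lambda>x. \<bar>f x\<bar>"])
    show "AE x in unit_measure. norm (f x * h n x) \<le> \<bar>f x\<bar>" for n
      by (intro AE_I2) (auto simp: h_def abs_mult intro!: mult_left_le)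
  qed (use f fm hm pw in \<open>auto intro: borel_measurable_times borel_measurable_abs\<close>)
  then have "integral\<^sup>L unit_measure (\<lambda>x. \<bar>f x\<bar>) = 0"
    using orth[OF h] by (simp add: LIMSEQ_const_iff)
  then have "AE x in unit_measure. \<bar>f x\<bar> = 0"
    using f by (subst (asm) integral_nonneg_eq_0_iff_AE) auto
  then show ?thesis by simp
qed

lemma integrable_times_continuous:
  fixes f :: "real \<Rightarrow> real"
  assumes f: "integrable unit_measure f" and g: "continuous_on {0..1} (g :: real \<Rightarrow> real)"
  shows "integrable unit_measure (\<lambda>x. f x * g x)"
proof -
  have "bounded (g ` {0..1})"
    using g by (intro compact_imp_bounded compact_continuous_image) auto
  then obtain B where B: "\<And>x. x \<in> {0..1} \<Longrightarrow> \<bar>g x\<bar> \<le> B"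
    unfolding bounded_iff by (metis image_eqI real_norm_def)
  have gm: "g \<in> borel_measurable unit_measure"
    by (rule borel_measurable_unit_continuous[OF continuous_on_subset[OF g]]) auto
  show ?thesis
  proof (rule Bochner_Integration.integrable_bound)
    show "integrable unit_measure (\<lambda>x. B * f x)" using f by (rule integrable_mult_right)
    show "(\<lambda>x. f x * g x) \<in> borel_measurable unit_measure"
      using f gm by (intro borel_measurable_times) auto
    have "\<bar>f x * g x\<bar> \<le> \<bar>B * f x\<bar>" if "x \<in> {0<..<1}" for x
    proof -
      have "\<bar>g x\<bar> \<le> \<bar>B\<bar>" using B[of x] that by auto
      then have "\<bar>g x\<bar> * \<bar>f x\<bar> \<le> \<bar>B\<bar> * \<bar>f x\<bar>" by (rule mult_right_mono) simp
      then show ?thesis by (simp add: abs_mult mult.commute)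
    qed
    then show "AE x in unit_measure. norm (f x * g x) \<le> norm (B * f x)"
      by (intro AE_I2) auto
  qed
qed

text \<open>By the Weierstrass theorem in the variable \<open>y = cos(\<pi>x)\<close>, polynomials in \<open>cos(\<pi>x)\<close> are uniformly dense in
  the continuous functions on \<open>[0, 1]\<close>. By the product formula, \<open>f\<close> is orthogonal to the powers of
  \<open>cos(\<pi>x)\<close>.\<close>

lemma AE_zero_of_orthogonal_cosines:
  fixes f :: "real \<Rightarrow> real"
  assumes f: "integrable unit_measure f"
    and orth: "\<And>k::nat. integral\<^sup>L unit_measure (\<lambda>x. f x * cos (real k * pi * x)) = 0"
  shows "AE x in unit_measure. f x = 0"
proof (rule AE_zero_of_orthogonal_continuous[OF f])
  fix g :: "real \<Rightarrow> real" assume g: "continuous_on UNIV g"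
  have int: "integrable unit_measure (\<lambda>x. f x * h x)" if "continuous_on UNIV h" for h
    using f continuous_on_subset[OF that] by (intro integrable_times_continuous) auto
  \<comment> \<open>The additional factor \<open>cos(k\<pi>x)\<close> makes the induction on the power work.\<close>
  have mono: "integral\<^sup>L unit_measure (\<lambda>x. f x * (cos (pi * x) ^ n * cos (real k * pi * x))) = 0" for n k
  proof (induction n arbitrary: k)
    case 0
    then show ?case using orth by simp
  next
    case (Suc n)
    have I: "integrable unit_measure (\<lambda>x. f x * (cos (pi * x) ^ n * cos (real j * pi * x)))" for j
      by (intro int continuous_intros)
    show ?case
    proof (cases k)
      case 0
      then show ?thesis using Suc.IH[of 1] by (simp add: mult_ac)
    next
      case (Suc l)
      have "f x * (cos (pi * x) ^ Suc n * cos (real k * pi * x)) =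
          (f x * (cos (pi * x) ^ n * cos (real (Suc k) * pi * x)) +
           f x * (cos (pi * x) ^ n * cos (real l * pi * x))) / 2" for x
      proof -
        have "cos (pi * x) * cos (real k * pi * x)
            = (cos (real (Suc k) * pi * x) + cos (real l * pi * x)) / 2"
        proof -
          have "real k * pi * x + pi * x = real (Suc k) * pi * x" by (simp add: algebra_simps)
          moreover have "real k * pi * x - pi * x = real l * pi * x"
            using Suc by (simp add: algebra_simps)
          ultimately show ?thesis
            using cos_times_cos[of "real k * pi * x" "pi * x"] by (simp add: mult.commute)
        qed
        note c = this
        have "f x * (cos (pi * x) ^ Suc n * cos (real k * pi * x))
            = f x * cos (pi * x) ^ n * (cos (pi * x) * cos (real k * pi * x))"
          by (simp only: power_Suc mult_ac)
        then show ?thesis unfolding c by (simp add: algebra_simps)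
      qed
      note e = this
      show ?thesis
        unfolding e using Suc.IH[of "Suc k"] Suc.IH[of l] I[of "Suc k"] I[of l]
        by (simp del: of_nat_Suc power_Suc)
    qed
  qed
  have mono': "integral\<^sup>L unit_measure (\<lambda>x. f x * cos (pi * x) ^ n) = 0" for n
    using mono[of n 0] by simp
  have "\<bar>integral\<^sup>L unit_measure (\<lambda>x. f x * g x)\<bar> \<le> e * integral\<^sup>L unit_measure (\<lambda>x. \<bar>f x\<bar>)" if e: "e > 0" for e
  proof -
    have "continuous_on {-1..1} (\<lambda>y. g (arccos y / pi))"
      using g by (intro continuous_intros continuous_on_compose2[OF g]) auto
    then obtain p where p: "real_polynomial_function p"
      "\<And>y. y \<in> {-1..1} \<Longrightarrow> \<bar>g (arccos y / pi) - p y\<bar> < e"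
      using Stone_Weierstrass_real_polynomial_function[of "{-1..1::real}" "\<lambda>y. g (arccos y / pi)" e] e
      by auto
    obtain a n where a: "p = (\<lambda>x. \<Sum>i\<le>n. a i * x ^ i)"
      using p(1) unfolding real_polynomial_function_iff_sum by blast
    have pI: "integrable unit_measure (\<lambda>x. f x * p (cos (pi * x)))"
      unfolding a by (intro int continuous_intros)
    have "f x * p (cos (pi * x)) = (\<Sum>i\<le>n. a i * (f x * cos (pi * x) ^ i))" for x
      by (simp add: a sum_distrib_left mult_ac)
    then have p0: "integral\<^sup>L unit_measure (\<lambda>x. f x * p (cos (pi * x))) = 0"
      using int by (simp add: mono' continuous_intros)
    have close: "\<bar>g x - p (cos (pi * x))\<bar> \<le> e" if "x \<in> {0<..<1}" for x
      using p(2)[of "cos (pi * x)"] that by (auto simp: arccos_cos)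
    have "integral\<^sup>L unit_measure (\<lambda>x. f x * g x) = integral\<^sup>L unit_measure (\<lambda>x. f x * g x - f x * p (cos (pi * x)))"
      using p0 int[OF g] pI by simp
    also have "\<bar>\<dots>\<bar> \<le> integral\<^sup>L unit_measure (\<lambda>x. \<bar>f x * g x - f x * p (cos (pi * x))\<bar>)"
      by (rule integral_abs_bound)
    also have "\<dots> \<le> integral\<^sup>L unit_measure (\<lambda>x. e * \<bar>f x\<bar>)"
    proof (rule integral_mono)
      show "\<bar>f x * g x - f x * p (cos (pi * x))\<bar> \<le> e * \<bar>f x\<bar>" if "x \<in> space unit_measure" for x
        using close[of x] that
        by (simp add: right_diff_distrib[symmetric] abs_mult mult.commute[of e] mult_left_mono)
    qed (use int[OF g] pI f in auto)
    finally show ?thesis by simp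
  qed
  then have lim: "\<forall>\<^sub>F e in at_right 0. \<bar>integral\<^sup>L unit_measure (\<lambda>x. f x * g x)\<bar> \<le> e * integral\<^sup>L unit_measure (\<lambda>x. \<bar>f x\<bar>)"
    using eventually_at_right_less[of 0] by (auto elim: eventually_mono)
  have "\<bar>integral\<^sup>L unit_measure (\<lambda>x. f x * g x)\<bar> \<le> 0 * integral\<^sup>L unit_measure (\<lambda>x. \<bar>f x\<bar>)"
  proof (rule tendsto_le[OF _ _ tendsto_const lim])
    show "((\<lambda>e. e * integral\<^sup>L unit_measure (\<lambda>x. \<bar>f x\<bar>)) \<longlongrightarrow> 0 * integral\<^sup>L unit_measure (\<lambda>x. \<bar>f x\<bar>)) (at_right 0)"
      by (intro tendsto_intros)
  qed simp
  then show "integral\<^sup>L unit_measure (\<lambda>x. f x * g x) = 0" by simp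
qed

lemma integral_unit_measure:
  fixes f :: "real \<Rightarrow> real"
  assumes "continuous_on {0..1} f"
  shows "integral\<^sup>L unit_measure f = integral {0..1} f"
  using square_integrable_integrable[OF square_integrable_continuous[OF assms]]
  by (simp add: lebesgue_integral_eq_integral integral_open_interval_real)

lemma inner_continuous:
  assumes "continuous_on {0..1} f" "continuous_on {0..1} g"
  shows "inner (mk_l2 f) (mk_l2 g) = integral {0..1} (\<lambda>x. f x * g x)"
  using assms by (simp add: inner_mk_l2 square_integrable_continuous integral_unit_measure
      continuous_on_mult)

lemma mk_l2_continuous_eqD:
  assumes f: "continuous_on {0..1} f" and g: "continuous_on {0..1} g"
    and eq: "mk_l2 f = mk_l2 g" and x: "x \<in> {0..1}"
  shows "f x = g x"
proof -
  let ?d = "\<lambda>x. (f x - g x) * (f x - g x)"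
  have d: "continuous_on {0..1} ?d" using f g by (intro continuous_intros)
  have "integral {0..1} ?d = inner (mk_l2 f - mk_l2 g) (mk_l2 f - mk_l2 g)"
    using f g by (simp add: diff_mk_l2 square_integrable_continuous inner_continuous continuous_on_diff)
  then have "(?d has_integral 0) {0..1}"
    using eq integrable_integral[OF integrable_continuous_real[OF d]] by simp
  then have "?d x = 0"
    using has_integral_0_cbox_imp_0[of 0 1 ?d x] d x by (auto simp: box_real)
  then show ?thesis by simp
qed

definition cos_mode :: "nat \<Rightarrow> real \<Rightarrow> real" where
  "cos_mode k x = mu k * cos (real k * pi * x)"

definition cosine :: "nat \<Rightarrow> l2" where
  "cosine k = mk_l2 (cos_mode k)"

lemma continuous_on_cos_mode [continuous_intros]: "continuous_on S (cos_mode k)"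
  unfolding cos_mode_def[abs_def] by (intro continuous_intros)

lemma cos_mode_deriv:
  "(cos_mode k has_real_derivative - (mu k * (real k * pi) * sin (real k * pi * x))) (at x within S)"
  "((\<lambda>x. - (mu k * (real k * pi) * sin (real k * pi * x))) has_real_derivative
     - ((real k)\<^sup>2 * pi\<^sup>2) * cos_mode k x) (at x within S)"
  unfolding cos_mode_def[abs_def] by (auto intro!: derivative_eq_intros simp: power2_eq_square)

lemma integral_cos_nat: "integral {0..1} (\<lambda>x. cos (real m * pi * x)) = (if m = 0 then 1 else 0)"
proof (cases "m = 0")
  case False
  have "((\<lambda>x. cos (real m * pi * x)) has_integral
      sin (real m * pi * 1) / (real m * pi) - sin (real m * pi * 0) / (real m * pi)) {0..1}"
  proof (rule fundamental_theorem_of_calculus)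
    show "((\<lambda>x. sin (real m * pi * x) / (real m * pi)) has_vector_derivative cos (real m * pi * x))
      (at x within {0..1})" for x
      using False by (auto intro!: derivative_eq_intros simp: has_real_derivative_iff_has_vector_derivative[symmetric])
  qed simp
  then show ?thesis using False by (simp add: integral_unique)
qed simp

lemma inner_cosine: "inner (cosine k) (cosine l) = (if k = l then 1 else 0)"
proof -
  define m where "m = (if k \<le> l then l - k else k - l)"
  have "cos_mode k x * cos_mode l x = mu k * mu l / 2 * (cos (real m * pi * x) + cos (real (k + l) * pi * x))" for x
  proof -
    have "cos (real k * pi * x) * cos (real l * pi * x)
        = (cos (real m * pi * x) + cos (real (k + l) * pi * x)) / 2"
    proof (cases "k \<le> l")
      case True
      then show ?thesis
        using cos_times_cos[of "real l * pi * x" "real k * pi * x"]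
        by (simp add: m_def of_nat_diff algebra_simps)
    next
      case False
      then show ?thesis
        using cos_times_cos[of "real k * pi * x" "real l * pi * x"]
        by (simp add: m_def of_nat_diff algebra_simps)
    qed
    then show ?thesis by (simp add: cos_mode_def)
  qed
  note prod = this
  have "inner (cosine k) (cosine l) = integral {0..1} (\<lambda>x. cos_mode k x * cos_mode l x)"
    unfolding cosine_def by (intro inner_continuous continuous_intros)
  also have "\<dots> = integral {0..1} (\<lambda>x. mu k * mu l / 2 * (cos (real m * pi * x) + cos (real (k + l) * pi * x)))"
    by (simp only: prod)
  also have "\<dots> = mu k * mu l / 2 * ((if m = 0 then 1 else 0) + (if k + l = 0 then 1 else 0))"
    by (simp only: integral_mult_right, subst Henstock_Kurzweil_Integration.integral_add)
       (auto intro!: integrable_continuous_real continuous_intros simp: integral_cos_nat simp del: of_nat_add)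
  also have "\<dots> = (if k = l then 1 else 0)"
    by (auto simp: m_def mu_def split: if_splits)
  finally show ?thesis .
qed

lemma mu_nonzero [simp]: "mu k \<noteq> 0"
  by (simp add: mu_def)

lemma orthonormal_basis_cosine: "orthonormal_basis UNIV cosine"
  unfolding orthonormal_basis_iff_total
proof (intro conjI allI impI)
  show "orthonormal_family UNIV cosine"
    by (simp add: orthonormal_family_def inner_cosine)
  fix u assume u: "\<forall>k\<in>UNIV. inner u (cosine k) = 0"
  have "AE x in unit_measure. rep_l2 u x = 0"
  proof (rule AE_zero_of_orthogonal_cosines)
    show "integrable unit_measure (rep_l2 u)"
      by (rule square_integrable_integrable[OF rep_l2_square_integrable])
    fix k
    have "inner u (cosine k) = integral\<^sup>L unit_measure (\<lambda>x. rep_l2 u x * cos_mode k x)"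
      unfolding cosine_def
      by (intro inner_l2_mk square_integrable_continuous continuous_intros)
    also have "\<dots> = mu k * integral\<^sup>L unit_measure (\<lambda>x. rep_l2 u x * cos (real k * pi * x))"
      by (simp add: cos_mode_def mult.left_commute)
    finally show "integral\<^sup>L unit_measure (\<lambda>x. rep_l2 u x * cos (real k * pi * x)) = 0"
      using u by simp
  qed
  then have "mk_l2 (rep_l2 u) = mk_l2 (\<lambda>x. 0)"
    by (subst mk_l2_eq_iff) (auto intro: rep_l2_square_integrable square_integrable_0)
  then show "u = 0" by (simp add: zero_l2_def)
qed

lemma l2_eq_by_cosines: "(\<And>k. inner u (cosine k) = inner v (cosine k)) \<Longrightarrow> u = v"
  by (rule orthonormal_basis_eqI[OF orthonormal_basis_cosine])

text \<open>This extends identities that are classical for trigonometric functions, such as integration by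
  parts, to the whole space.\<close>

lemma bounded_linear_eq_on_cosines:
  assumes "bounded_linear F" "bounded_linear G" "\<And>k. F (cosine k) = G (cosine k)"
  shows "F u = G u"
  using assms orthonormal_basis_cosine
  by (intro bounded_linear_eq_on_dense_span[of F G "range cosine" u]) (auto simp: orthonormal_basis_def)

section \<open>Primitives\<close>

text \<open>The integral of \<open>v\<close> from 0 to \<open>x\<close>, written as an inner product so that linearity, boundedness and
  the modulus of continuity come from the Hilbert space structure.\<close>

definition antideriv :: "l2 \<Rightarrow> real \<Rightarrow> real" where
  "antideriv v x = inner v (mk_l2 (indicat_real {..x}))"

text \<open>The elements of this form turn out to be exactly those of \<^const>\<open>H1\<close>; then \<open>v\<close> is the weak
  derivative and \<open>c\<close> the trace at 0.\<close>

definition primitive :: "real \<Rightarrow> l2 \<Rightarrow> l2" where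
  "primitive c v = mk_l2 (\<lambda>x. c + antideriv v x)"

lemma norm_mk_l2_indicator_diff: "(norm (mk_l2 (indicat_real {..x}) - mk_l2 (indicat_real {..y})))\<^sup>2 \<le> \<bar>x - y\<bar>"
proof -
  have *: "(norm (mk_l2 (indicat_real {..x}) - mk_l2 (indicat_real {..y})))\<^sup>2 \<le> x - y" if "y \<le> x" for x y
  proof -
    have si: "square_integrable (\<lambda>t. indicat_real {..x} t - indicat_real {..y} t)"
      by (intro square_integrable_diff square_integrable_indicator)
    have "(norm (mk_l2 (indicat_real {..x}) - mk_l2 (indicat_real {..y})))\<^sup>2
        = integral\<^sup>L unit_measure (\<lambda>t. (indicat_real {..x} t - indicat_real {..y} t)\<^sup>2)"
      by (simp add: diff_mk_l2 square_integrable_indicator norm_mk_l2[OF si])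
    also have "\<dots> = integral\<^sup>L unit_measure (indicat_real {y<..x})"
      using that by (intro Bochner_Integration.integral_cong) (auto simp: indicator_def)
    also have "\<dots> = measure lebesgue ({y<..x} \<inter> {0<..<1})"
      by (simp add: measure_restrict_space)
    also have "\<dots> \<le> measure lebesgue {y<..x}"
      by (intro measure_mono_fmeasurable) (auto intro: bounded_set_imp_lmeasurable)
    also have "\<dots> = x - y" using that by simp
    finally show ?thesis .
  qed
  show ?thesis
    using *[of x y] *[of y x] by (cases "y \<le> x") (auto simp: norm_minus_commute)
qed

lemma continuous_on_antideriv: "continuous_on S (antideriv v)"
proof -
  have "isCont (antideriv v) x" for x
  proof -
    have "((\<lambda>y. sqrt \<bar>y - x\<bar>) \<longlongrightarrow> 0) (at x)"
      by (auto intro!: tendsto_eq_intros)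
    moreover have "norm (mk_l2 (indicat_real {..y}) - mk_l2 (indicat_real {..x})) \<le> sqrt \<bar>y - x\<bar>" for y
      using real_sqrt_le_mono[OF norm_mk_l2_indicator_diff[of y x]] by simp
    then have "\<forall>\<^sub>F y in at x. norm (mk_l2 (indicat_real {..y}) - mk_l2 (indicat_real {..x})) \<le> sqrt \<bar>y - x\<bar>"
      by (rule always_eventually[OF allI])
    ultimately have "((\<lambda>y. mk_l2 (indicat_real {..y}) - mk_l2 (indicat_real {..x})) \<longlongrightarrow> 0) (at x)"
      by (rule Lim_null_comparison[rotated])
    then have "((\<lambda>y. mk_l2 (indicat_real {..y})) \<longlongrightarrow> mk_l2 (indicat_real {..x})) (at x)"
      by (rule LIM_zero_cancel)
    then show ?thesis
      unfolding isCont_def antideriv_def by (intro tendsto_intros)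
  qed
  then show ?thesis by (simp add: continuous_at_imp_continuous_on)
qed

lemma square_integrable_antideriv: "square_integrable (antideriv v)"
  by (rule square_integrable_continuous[OF continuous_on_antideriv])

lemma cosine_0: "cosine 0 = mk_l2 (\<lambda>x. 1)"
  by (simp add: cosine_def cos_mode_def[abs_def] mu_def)

lemma mk_l2_const: "mk_l2 (\<lambda>x. c) = c *\<^sub>R cosine 0"
  by (simp add: cosine_0 scaleR_mk_l2 square_integrable_const)

lemma primitive_eq: "primitive c v = c *\<^sub>R cosine 0 + mk_l2 (antideriv v)"
  by (simp add: primitive_def mk_l2_const[symmetric] plus_mk_l2 square_integrable_const
      square_integrable_antideriv)

lemma antideriv_add: "antideriv (u + v) x = antideriv u x + antideriv v x"
  by (simp add: antideriv_def inner_left_distrib)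

lemma antideriv_scaleR: "antideriv (c *\<^sub>R v) x = c * antideriv v x"
  by (simp add: antideriv_def)

lemma antideriv_0: "antideriv v 0 = 0"
proof -
  have "mk_l2 (indicat_real {..0}) = mk_l2 (\<lambda>x. 0)"
    by (subst mk_l2_eq_iff) (auto intro!: square_integrable_indicator square_integrable_0 AE_I2 simp: indicator_def)
  then show ?thesis by (simp add: antideriv_def zero_l2_def[symmetric])
qed

lemma antideriv_1: "antideriv v 1 = inner v (cosine 0)"
proof -
  have "mk_l2 (indicat_real {..1}) = mk_l2 (\<lambda>x. 1)"
    by (subst mk_l2_eq_iff) (auto intro!: square_integrable_indicator square_integrable_const AE_I2 simp: indicator_def)
  then show ?thesis by (simp add: antideriv_def cosine_0)
qed

lemma bounded_linear_mk_antideriv: "bounded_linear (\<lambda>v. mk_l2 (antideriv v))"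
proof (rule bounded_linear_intro[of _ 1])
  show "mk_l2 (antideriv (u + v)) = mk_l2 (antideriv u) + mk_l2 (antideriv v)" for u v
    by (simp add: plus_mk_l2 square_integrable_antideriv antideriv_add[abs_def])
  show "mk_l2 (antideriv (c *\<^sub>R v)) = c *\<^sub>R mk_l2 (antideriv v)" for c v
    by (simp add: scaleR_mk_l2 square_integrable_antideriv antideriv_scaleR[abs_def])
  show "norm (mk_l2 (antideriv v)) \<le> norm v * 1" for v
  proof -
    have "\<bar>antideriv v x\<bar> \<le> norm v" for x
    proof -
      have "norm (mk_l2 (indicat_real {..x})) \<le> \<bar>1\<bar>"
        by (rule norm_mk_l2_le) (use square_integrable_indicator in \<open>auto simp: square_integrable_def indicator_def\<close>)
      then have "norm v * norm (mk_l2 (indicat_real {..x})) \<le> norm v * 1"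
        by (intro mult_left_mono) auto
      then show ?thesis
        using Cauchy_Schwarz_ineq2[of v "mk_l2 (indicat_real {..x})"] by (simp add: antideriv_def)
    qed
    then have "norm (mk_l2 (antideriv v)) \<le> \<bar>norm v\<bar>"
      using square_integrable_antideriv by (intro norm_mk_l2_le) (auto simp: square_integrable_def)
    then show ?thesis by simp
  qed
qed

lemma antideriv_continuous:
  assumes v: "continuous_on {0..1} v" and x: "x \<in> {0..1}"
  shows "antideriv (mk_l2 v) x = integral {0..x} v"
proof -
  note si = square_integrable_continuous[OF v]
  have "antideriv (mk_l2 v) x = integral\<^sup>L unit_measure (\<lambda>t. v t * indicat_real {..x} t)"
    by (simp add: antideriv_def inner_mk_l2 si square_integrable_indicator)
  also have "\<dots> = integral {0<..<1} (\<lambda>t. v t * indicat_real {..x} t)"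
    by (intro lebesgue_integral_eq_integral square_integrable_mult si square_integrable_indicator) auto
  also have "\<dots> = integral {0..1} (\<lambda>t. if t \<in> {0..x} then v t else 0)"
    unfolding integral_open_interval_real
    by (intro Henstock_Kurzweil_Integration.integral_cong) (auto simp: indicator_def)
  also have "\<dots> = integral {0..x} v"
    using x by (subst Henstock_Kurzweil_Integration.integral_restrict_Int) (simp add: Int_absorb2)
  finally show ?thesis .
qed

text \<open>Integration by parts. Both sides are bounded linear in \<open>v\<close>, so it is enough to treat cosines, for
  which it is the fundamental theorem of calculus applied to a product of smooth functions.\<close>

lemma inner_mk_antideriv_deriv:
  assumes d: "\<And>x. x \<in> {0..1} \<Longrightarrow> (\<theta> has_real_derivative \<theta>' x) (at x within {0..1})"
    and c: "continuous_on {0..1} \<theta>'"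
  shows "inner (mk_l2 (antideriv v)) (mk_l2 \<theta>') = \<theta> 1 * antideriv v 1 - inner v (mk_l2 \<theta>)"
proof (rule bounded_linear_eq_on_cosines[where F = "\<lambda>v. inner (mk_l2 (antideriv v)) (mk_l2 \<theta>')"])
  show "bounded_linear (\<lambda>v. inner (mk_l2 (antideriv v)) (mk_l2 \<theta>'))"
    by (rule bounded_linear_compose[OF bounded_linear_inner_left bounded_linear_mk_antideriv])
  show "bounded_linear (\<lambda>v. \<theta> 1 * antideriv v 1 - inner v (mk_l2 \<theta>))"
    unfolding antideriv_def
    by (intro bounded_linear_sub bounded_linear_const_mult bounded_linear_inner_left)
  have tc: "continuous_on {0..1} \<theta>"
    using d by (rule DERIV_continuous_on)
  fix k
  let ?v = "cos_mode k"
  have vc: "continuous_on {0..1} ?v" by (intro continuous_intros)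
  define V where "V x = integral {0..x} ?v" for x
  have V: "(V has_real_derivative ?v x) (at x within {0..1})" if "x \<in> {0..1}" for x
    unfolding V_def[abs_def] using that vc by (intro integral_has_real_derivative) auto
  have Vc: "continuous_on {0..1} V"
    using V by (rule DERIV_continuous_on)
  have eq: "antideriv (cosine k) x = V x" if "x \<in> {0..1}" for x
    using antideriv_continuous[OF vc that] by (simp add: cosine_def V_def)
  have "((\<lambda>x. V x * \<theta>' x + ?v x * \<theta> x) has_integral V 1 * \<theta> 1 - V 0 * \<theta> 0) {0..1}"
  proof (rule fundamental_theorem_of_calculus)
    show "((\<lambda>x. V x * \<theta> x) has_vector_derivative V x * \<theta>' x + ?v x * \<theta> x) (at x within {0..1})"
      if "x \<in> {0..1}" for x
      unfolding has_real_derivative_iff_has_vector_derivative[symmetric]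
      using DERIV_mult[OF V[OF that] d[OF that]] by (simp add: algebra_simps)
  qed simp
  then have "integral {0..1} (\<lambda>x. V x * \<theta>' x + ?v x * \<theta> x) = V 1 * \<theta> 1"
    by (simp add: integral_unique V_def)
  moreover have "integral {0..1} (\<lambda>x. V x * \<theta>' x + ?v x * \<theta> x)
      = integral {0..1} (\<lambda>x. V x * \<theta>' x) + integral {0..1} (\<lambda>x. ?v x * \<theta> x)"
    by (intro Henstock_Kurzweil_Integration.integral_add integrable_continuous_real continuous_intros Vc c tc)
  moreover have "inner (mk_l2 (antideriv (cosine k))) (mk_l2 \<theta>') = integral {0..1} (\<lambda>x. V x * \<theta>' x)"
    using c by (subst inner_continuous)
      (auto intro!: Henstock_Kurzweil_Integration.integral_cong continuous_on_antideriv simp: eq)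
  moreover have "inner (cosine k) (mk_l2 \<theta>) = integral {0..1} (\<lambda>x. ?v x * \<theta> x)"
    unfolding cosine_def by (intro inner_continuous vc tc)
  ultimately show "inner (mk_l2 (antideriv (cosine k))) (mk_l2 \<theta>')
      = \<theta> 1 * antideriv (cosine k) 1 - inner (cosine k) (mk_l2 \<theta>)"
    by (simp add: eq mult.commute)
qed

lemma inner_const_deriv:
  assumes d: "\<And>x. x \<in> {0..1} \<Longrightarrow> (\<theta> has_real_derivative \<theta>' x) (at x within {0..1})"
    and c: "continuous_on {0..1} \<theta>'"
  shows "inner (cosine 0) (mk_l2 \<theta>') = \<theta> 1 - \<theta> 0"
proof -
  have "(\<theta>' has_integral \<theta> 1 - \<theta> 0) {0..1}"
    using d by (intro fundamental_theorem_of_calculus)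
      (auto simp: has_real_derivative_iff_has_vector_derivative)
  then show ?thesis
    using c by (simp add: cosine_0 inner_continuous integral_unique)
qed

lemma primitive_parts:
  assumes d: "\<And>x. x \<in> {0..1} \<Longrightarrow> (\<theta> has_real_derivative \<theta>' x) (at x within {0..1})"
    and c: "continuous_on {0..1} \<theta>'"
  shows "inner (primitive c v) (mk_l2 \<theta>') = (c + antideriv v 1) * \<theta> 1 - c * \<theta> 0 - inner v (mk_l2 \<theta>)"
proof -
  have "inner (cosine 0) (mk_l2 \<theta>') = \<theta> 1 - \<theta> 0"
    by (rule inner_const_deriv[OF assms])
  then have "c * inner (cosine 0) (mk_l2 \<theta>') = c * \<theta> 1 - c * \<theta> 0"
    by (simp only: right_diff_distrib)
  moreover have "inner (mk_l2 (antideriv v)) (mk_l2 \<theta>') = \<theta> 1 * antideriv v 1 - inner v (mk_l2 \<theta>)"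
    by (rule inner_mk_antideriv_deriv[OF assms])
  ultimately show ?thesis
    by (simp add: primitive_eq inner_left_distrib algebra_simps)
qed

lemma trace_at_mk_l2:
  assumes "continuous_on {0..1} g" "x \<in> {0..1}"
  shows "trace_at (mk_l2 g) x = g x"
  unfolding trace_at_def
proof (rule the_equality)
  show "\<exists>g'. continuous_on {0..1} g' \<and> mk_l2 g = mk_l2 g' \<and> g x = g' x"
    using assms by blast
  fix y assume "\<exists>g'. continuous_on {0..1} g' \<and> mk_l2 g = mk_l2 g' \<and> y = g' x"
  then show "y = g x"
    using mk_l2_continuous_eqD[OF assms(1) _ _ assms(2)] by metis
qed

lemma trace_at_primitive: "x \<in> {0..1} \<Longrightarrow> trace_at (primitive c v) x = c + antideriv v x"
  unfolding primitive_def by (intro trace_at_mk_l2 continuous_intros continuous_on_antideriv)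

text \<open>Equality of classes is equality of the continuous representatives on \<open>[0, 1]\<close>. Evaluating at 0 gives
  the constants, and integrating by parts against cosines recovers the coefficients of \<open>v\<close> from
  those of its primitive.\<close>

lemma primitive_eqD:
  assumes "primitive c v = primitive c' v'"
  shows "c = c'" "v = v'"
proof -
  have eq: "c + antideriv v x = c' + antideriv v' x" if "x \<in> {0..1}" for x
    using assms that unfolding primitive_def
    by (intro mk_l2_continuous_eqD[of "\<lambda>x. c + antideriv v x"]) (auto intro!: continuous_intros continuous_on_antideriv)
  show "c = c'" using eq[of 0] by (simp add: antideriv_0)
  show "v = v'"
  proof (rule l2_eq_by_cosines)
    fix k
    define s where "s x = - (mu k * (real k * pi) * sin (real k * pi * x))" for x
    have d: "(cos_mode k has_real_derivative s x) (at x within {0..1})" for x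
      unfolding s_def by (rule cos_mode_deriv)
    have s: "continuous_on {0..1} s" unfolding s_def[abs_def] by (intro continuous_intros)
    show "inner v (cosine k) = inner v' (cosine k)"
      using primitive_parts[OF d s, of c v] primitive_parts[OF d s, of c' v'] assms eq[of 1] \<open>c = c'\<close>
      by (simp add: cosine_def)
  qed
qed

section \<open>Weak derivatives\<close>

lemma test_functionD:
  assumes "test_function \<theta>"
  shows "(\<theta> has_real_derivative deriv \<theta> x) (at x within S)" "continuous_on S (deriv \<theta>)"
    "continuous_on S \<theta>" "\<theta> 0 = 0" "\<theta> 1 = 0"
proof -
  show d: "(\<theta> has_real_derivative deriv \<theta> x) (at x within S)" for x S
    using assms by (auto simp: test_function_def field_differentiable_derivI DERIV_subset intro: has_field_derivative_at_within)
  show "continuous_on S (deriv \<theta>)"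
    using assms by (auto simp: test_function_def intro: continuous_on_subset)
  show "continuous_on S \<theta>"
    using d by (rule DERIV_continuous_on)
  obtain c d where "0 < c" "d < 1" "\<And>x. x \<notin> {c..d} \<Longrightarrow> \<theta> x = 0"
    using assms by (auto simp: test_function_def)
  then show "\<theta> 0 = 0" "\<theta> 1 = 0" by auto
qed

lemma has_weak_deriv_iff_inner:
  "has_weak_deriv u v \<longleftrightarrow>
     (\<forall>\<theta>. test_function \<theta> \<longrightarrow> inner u (mk_l2 (deriv \<theta>)) = - inner v (mk_l2 \<theta>))"
  unfolding has_weak_deriv_def
  by (intro all_cong1 imp_cong refl)
     (simp add: inner_l2_mk square_integrable_continuous test_functionD)

lemma has_weak_deriv_primitive: "has_weak_deriv (primitive c v) v"
  unfolding has_weak_deriv_iff_inner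
  using primitive_parts[OF test_functionD(1,2), of _ c v] by (auto simp: test_functionD)

lemma extend_by_zero_derivative:
  fixes \<theta> \<theta>' :: "real \<Rightarrow> real"
  assumes d: "\<And>x. (\<theta> has_real_derivative \<theta>' x) (at x)"
    and z: "\<theta> 0 = 0" "\<theta> 1 = 0" "\<theta>' 0 = 0" "\<theta>' 1 = 0"
  shows "((\<lambda>x. if x \<in> {0..1} then \<theta> x else 0) has_real_derivative (if x \<in> {0..1} then \<theta>' x else 0)) (at x)"
    (is "(?g has_real_derivative ?g' x) (at x)")
proof -
  consider "x = 0 \<or> x = 1" | "x \<in> {0<..<1}" | "x \<in> {..<0}" | "x \<in> {1<..}" by force
  then show ?thesis
  proof cases
    case 1
    then have zx: "\<theta> x = 0" "\<theta>' x = 0" "?g x = 0" "?g' x = 0" using z by auto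
    have "((\<lambda>y. \<theta> y / (y - x)) \<longlongrightarrow> 0) (at x)"
      using d[of x] zx by (simp add: has_field_derivative_iff)
    then have "((\<lambda>y. norm (\<theta> y / (y - x))) \<longlongrightarrow> 0) (at x)"
      by (rule tendsto_norm_zero)
    moreover have "\<forall>\<^sub>F y in at x. norm (?g y / (y - x)) \<le> norm (\<theta> y / (y - x))"
      by (intro always_eventually) auto
    ultimately have "((\<lambda>y. ?g y / (y - x)) \<longlongrightarrow> 0) (at x)"
      by (rule Lim_null_comparison[rotated])
    then show ?thesis using zx by (simp add: has_field_derivative_iff)
  next
    case 2
    have "(?g has_real_derivative \<theta>' x) (at x)"
      using d by (rule has_field_derivative_transform_within_open[where S = "{0<..<1}"]) (use 2 in auto)
    then show ?thesis using 2 by auto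
  next
    case 3
    have "(?g has_real_derivative 0) (at x)"
      using DERIV_const by (rule has_field_derivative_transform_within_open[where S = "{..<0}"]) (use 3 in auto)
    then show ?thesis using 3 by auto
  next
    case 4
    have "(?g has_real_derivative 0) (at x)"
      using DERIV_const by (rule has_field_derivative_transform_within_open[where S = "{1<..}"]) (use 4 in auto)
    then show ?thesis using 4 by auto
  qed
qed

text \<open>A function that vanishes to first order at both ends, extended by zero, is continuously
  differentiable on the line; squeezing it into \<open>[\<epsilon>, 1 - \<epsilon>]\<close> makes it a test function. The derivatives
  converge boundedly as \<open>\<epsilon> \<rightarrow> 0\<close>.\<close>

lemma orthogonal_to_flat_derivative:
  assumes w: "\<And>\<theta>. test_function \<theta> \<Longrightarrow> inner w (mk_l2 (deriv \<theta>)) = 0"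
    and d: "\<And>x. (\<theta> has_real_derivative \<theta>' x) (at x)" and c: "continuous_on UNIV \<theta>'"
    and z: "\<theta> 0 = 0" "\<theta> 1 = 0" "\<theta>' 0 = 0" "\<theta>' 1 = 0"
  shows "inner w (mk_l2 \<theta>') = 0"
proof -
  define g where "g x = (if x \<in> {0..1} then \<theta> x else 0)" for x
  define g' where "g' x = (if x \<in> {0..1} then \<theta>' x else 0)" for x
  have g: "(g has_real_derivative g' x) (at x)" for x
    unfolding g_def[abs_def] g'_def by (rule extend_by_zero_derivative[OF d z])
  have clamp: "g' x = \<theta>' (max 0 (min 1 x))" for x
    using z by (auto simp: g'_def max_def min_def)
  have g'c: "continuous_on UNIV g'"
    unfolding clamp[abs_def] by (intro continuous_on_compose2[OF c] continuous_intros) auto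
  have "bounded (g' ` {0..1})"
    using continuous_on_subset[OF g'c] by (intro compact_imp_bounded compact_continuous_image) auto
  then obtain B where B: "\<And>x. x \<in> {0..1} \<Longrightarrow> \<bar>g' x\<bar> \<le> B"
    unfolding bounded_iff by (metis image_eqI real_norm_def)
  have B': "\<bar>g' x\<bar> \<le> \<bar>B\<bar>" for x
    using B[of x] by (cases "x \<in> {0..1}") (auto simp: g'_def)
  \<comment> \<open>The shift 3 keeps the width \<open>s n\<close> of the squeezed interval positive.\<close>
  define e where "e n = 1 / (real n + 3)" for n
  define s where "s n = 1 - 2 * e n" for n
  have e: "e n > 0" "s n > 0" for n by (auto simp: e_def s_def field_simps)
  define t where "t n x = s n * g ((x - e n) / s n)" for n x
  have dt: "(t n has_real_derivative g' ((x - e n) / s n)) (at x)" for n x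
  proof -
    have "((\<lambda>x. g ((x - e n) / s n)) has_real_derivative g' ((x - e n) / s n) * (1 / s n)) (at x)"
      using e(2)[of n] by (intro DERIV_chain2[OF g]) (auto intro!: derivative_eq_intros)
    then have "(t n has_real_derivative s n * (g' ((x - e n) / s n) * (1 / s n))) (at x)"
      unfolding t_def[abs_def] by (rule DERIV_cmult)
    then show ?thesis using e(2)[of n] by simp
  qed
  then have deriv_t: "deriv (t n) = (\<lambda>x. g' ((x - e n) / s n))" for n
    by (auto simp: fun_eq_iff DERIV_imp_deriv)
  have cn: "continuous_on S (\<lambda>x. g' ((x - e n) / s n))" for n S
    using e[of n] by (intro continuous_on_compose2[OF g'c] continuous_intros) auto
  have "test_function (t n)" for n
    unfolding test_function_def
  proof (intro conjI allI)
    show "t n field_differentiable at x" for x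
      using dt field_differentiable_def by blast
    show "continuous_on UNIV (deriv (t n))" unfolding deriv_t by (rule cn)
    show "\<exists>c d. 0 < c \<and> d < 1 \<and> (\<forall>x. x \<notin> {c..d} \<longrightarrow> t n x = 0)"
      using e[of n] by (intro exI[of _ "e n"] exI[of _ "1 - e n"])
        (auto simp: t_def g_def s_def field_simps)
  qed
  then have zero: "inner w (mk_l2 (\<lambda>x. g' ((x - e n) / s n))) = 0" for n
    using w[of "t n"] deriv_t by simp
  have wm: "rep_l2 w \<in> borel_measurable unit_measure"
    using rep_l2_square_integrable[of w] by (simp add: square_integrable_def)
  have wi: "integrable unit_measure (rep_l2 w)"
    by (rule square_integrable_integrable[OF rep_l2_square_integrable])
  have "(\<lambda>n. integral\<^sup>L unit_measure (\<lambda>x. rep_l2 w x * g' ((x - e n) / s n)))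
      \<longlonglongrightarrow> integral\<^sup>L unit_measure (\<lambda>x. rep_l2 w x * g' x)"
  proof (rule integral_dominated_convergence[where w = "\<lambda>x. \<bar>B\<bar> * \<bar>rep_l2 w x\<bar>"])
    have "(\<lambda>n. rep_l2 w x * g' ((x - e n) / s n)) \<longlonglongrightarrow> rep_l2 w x * g' x" for x
    proof (intro tendsto_intros)
      have e0: "e \<longlonglongrightarrow> 0" unfolding e_def by real_asymp
      have s0: "s \<longlonglongrightarrow> 1" unfolding s_def[abs_def] using e0 by (auto intro!: tendsto_eq_intros)
      have "(\<lambda>n. (x - e n) / s n) \<longlonglongrightarrow> x"
        using e0 s0 by (auto intro!: tendsto_eq_intros)
      moreover have "isCont g' x" using g'c by (simp add: continuous_on_eq_continuous_at)
      ultimately show "(\<lambda>n. g' ((x - e n) / s n)) \<longlonglongrightarrow> g' x"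
        by (rule isCont_tendsto_compose[rotated])
    qed
    then show "AE x in unit_measure. (\<lambda>n. rep_l2 w x * g' ((x - e n) / s n)) \<longlonglongrightarrow> rep_l2 w x * g' x"
      by simp
    show "AE x in unit_measure. norm (rep_l2 w x * g' ((x - e n) / s n)) \<le> \<bar>B\<bar> * \<bar>rep_l2 w x\<bar>" for n
      using B' by (intro AE_I2) (simp add: abs_mult mult.commute[of "\<bar>B\<bar>"] mult_left_mono)
    show "(\<lambda>x. rep_l2 w x * g' ((x - e n) / s n)) \<in> borel_measurable unit_measure" for n
      by (intro borel_measurable_times wm borel_measurable_unit_continuous cn)
    show "(\<lambda>x. rep_l2 w x * g' x) \<in> borel_measurable unit_measure"
      using continuous_on_subset[OF g'c] by (intro borel_measurable_times wm borel_measurable_unit_continuous) auto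
    show "integrable unit_measure (\<lambda>x. \<bar>B\<bar> * \<bar>rep_l2 w x\<bar>)" using wi by simp
  qed
  moreover have "integral\<^sup>L unit_measure (\<lambda>x. rep_l2 w x * g' ((x - e n) / s n)) = 0" for n
    using zero[of n] by (simp add: inner_l2_mk square_integrable_continuous cn)
  ultimately have "integral\<^sup>L unit_measure (\<lambda>x. rep_l2 w x * g' x) = 0"
    by (simp add: LIMSEQ_const_iff)
  moreover have "integral\<^sup>L unit_measure (\<lambda>x. rep_l2 w x * g' x) = integral\<^sup>L unit_measure (\<lambda>x. rep_l2 w x * \<theta>' x)"
    by (intro Bochner_Integration.integral_cong) (auto simp: g'_def)
  ultimately show ?thesis
    using continuous_on_subset[OF c] by (simp add: inner_l2_mk square_integrable_continuous)
qed

text \<open>A cosine of index \<open>k \<ge> 1\<close> is the derivative of a function vanishing at both ends, but not to first order. The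
  difference of the cosines of index \<open>k\<close> and \<open>k + 2\<close> is: these take the same values at 0 and at 1. So
  the coefficients of \<open>w\<close> have period 2 from index 1 on, and being square summable they vanish.\<close>

lemma constant_of_zero_weak_deriv:
  assumes w: "\<And>\<theta>. test_function \<theta> \<Longrightarrow> inner w (mk_l2 (deriv \<theta>)) = 0"
  shows "w = inner w (cosine 0) *\<^sub>R cosine 0"
proof (rule l2_eq_by_cosines)
  have step: "inner w (cosine k) = inner w (cosine (k + 2))" if k: "k \<ge> 1" for k
  proof -
    define \<theta> where "\<theta> x = sqrt 2 * (sin (real k * pi * x) / (real k * pi) - sin (real (k+2) * pi * x) / (real (k+2) * pi))" for x
    define \<theta>' where "\<theta>' x = cos_mode k x - cos_mode (k + 2) x" for x
    have "inner w (mk_l2 \<theta>') = 0"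
    proof (rule orthogonal_to_flat_derivative[OF w])
      show "(\<theta> has_real_derivative \<theta>' x) (at x)" for x
        unfolding \<theta>_def[abs_def] \<theta>'_def cos_mode_def using k
        by (auto intro!: derivative_eq_intros simp: mu_def right_diff_distrib simp del: of_nat_add)
      show "continuous_on UNIV \<theta>'" unfolding \<theta>'_def[abs_def] by (intro continuous_intros)
      show "\<theta> 0 = 0" by (simp add: \<theta>_def)
      show "\<theta> 1 = 0"
        using sin_npi[of k] sin_npi[of "k+2"] by (simp add: \<theta>_def del: of_nat_add)
      show "\<theta>' 0 = 0" using k by (simp add: \<theta>'_def cos_mode_def mu_def)
      show "\<theta>' 1 = 0"
        using k cos_npi[of k] cos_npi[of "k+2"] by (simp add: \<theta>'_def cos_mode_def mu_def del: of_nat_add)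
    qed
    moreover have "mk_l2 \<theta>' = cosine k - cosine (k + 2)"
      unfolding \<theta>'_def[abs_def] cosine_def
      by (intro diff_mk_l2[symmetric] square_integrable_continuous continuous_intros)
    ultimately show ?thesis by (simp add: inner_diff_right)
  qed
  have zero: "inner w (cosine k) = 0" if k: "k \<ge> 1" for k
  proof -
    have per: "inner w (cosine (k + 2 * n)) = inner w (cosine k)" for n
    proof (induction n)
      case (Suc n)
      then show ?case using step[of "k + 2 * n"] k by simp
    qed simp
    have "(\<lambda>l. (inner w (cosine l))\<^sup>2) summable_on UNIV"
      by (rule bessel_inequality(1)[OF orthonormal_basis_family[OF orthonormal_basis_cosine]])
    then have "summable (\<lambda>l. (inner w (cosine l))\<^sup>2)"
      by (rule summable_on_imp_summable)
    then have "(\<lambda>l. (inner w (cosine l))\<^sup>2) \<longlonglongrightarrow> 0"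
      by (rule summable_LIMSEQ_zero)
    then have "((\<lambda>l. (inner w (cosine l))\<^sup>2) \<circ> (\<lambda>n. k + 2 * n)) \<longlonglongrightarrow> 0"
      by (rule LIMSEQ_subseq_LIMSEQ) (auto simp: strict_mono_def)
    then show ?thesis by (simp add: o_def per LIMSEQ_const_iff)
  qed
  show "inner w (cosine k) = inner (inner w (cosine 0) *\<^sub>R cosine 0) (cosine k)" for k
    using zero[of k] by (cases "k = 0") (auto simp: inner_cosine)
qed

text \<open>The difference of \<open>u\<close> and the primitive of \<open>v\<close> has weak derivative zero.\<close>

lemma has_weak_deriv_iff: "has_weak_deriv u v \<longleftrightarrow> (\<exists>c. u = primitive c v)"
proof
  assume u: "has_weak_deriv u v"
  let ?w = "u - mk_l2 (antideriv v)"
  have V: "has_weak_deriv (mk_l2 (antideriv v)) v"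
    using has_weak_deriv_primitive[of 0 v] by (simp add: primitive_def)
  have "?w = inner ?w (cosine 0) *\<^sub>R cosine 0"
    using u V by (intro constant_of_zero_weak_deriv) (simp add: has_weak_deriv_iff_inner inner_diff_left)
  then have "u = primitive (inner ?w (cosine 0)) v"
    by (simp add: primitive_eq algebra_simps)
  then show "\<exists>c. u = primitive c v" ..
qed (auto simp: has_weak_deriv_primitive)

lemma weak_deriv_primitive: "weak_deriv (primitive c v) = v"
  unfolding weak_deriv_def has_weak_deriv_iff
  by (rule the_equality) (auto dest: primitive_eqD)

lemma H1_iff: "u \<in> H1 \<longleftrightarrow> (\<exists>c v. u = primitive c v)"
  unfolding H1_def has_weak_deriv_iff by blast

lemma primitive_H1: "primitive c v \<in> H1"
  unfolding H1_iff by blast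

section \<open>The Neumann problem\<close>

definition neumann :: "l2 \<Rightarrow> l2 \<Rightarrow> real \<Rightarrow> real \<Rightarrow> bool" where
  "neumann u w \<alpha> \<beta> \<longleftrightarrow> u \<in> H2 \<and> weak_deriv (weak_deriv u) = w \<and>
     trace_at (weak_deriv u) 0 = \<alpha> \<and> trace_at (weak_deriv u) 1 = \<beta>"

lemma neumann_iff: "neumann u w \<alpha> \<beta> \<longleftrightarrow>
    (\<exists>c. u = primitive c (primitive \<alpha> w)) \<and> inner w (cosine 0) = \<beta> - \<alpha>"
proof
  assume n: "neumann u w \<alpha> \<beta>"
  then obtain c v where u: "u = primitive c v" and "weak_deriv u \<in> H1"
    by (auto simp: neumann_def H2_def H1_iff)
  moreover obtain c' v' where v: "v = primitive c' v'"
    using calculation by (auto simp: weak_deriv_primitive H1_iff)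
  ultimately show "(\<exists>c. u = primitive c (primitive \<alpha> w)) \<and> inner w (cosine 0) = \<beta> - \<alpha>"
    using n by (auto simp: neumann_def weak_deriv_primitive trace_at_primitive antideriv_0 antideriv_1)
next
  assume "(\<exists>c. u = primitive c (primitive \<alpha> w)) \<and> inner w (cosine 0) = \<beta> - \<alpha>"
  then show "neumann u w \<alpha> \<beta>"
    by (auto simp: neumann_def H2_def weak_deriv_primitive trace_at_primitive antideriv_0 antideriv_1 primitive_H1)
qed

lemma neumann_green:
  assumes n: "neumann u w \<alpha> \<beta>"
    and d1: "\<And>x. x \<in> {0..1} \<Longrightarrow> (\<theta> has_real_derivative \<theta>' x) (at x within {0..1})"
    and d2: "\<And>x. x \<in> {0..1} \<Longrightarrow> (\<theta>' has_real_derivative \<theta>'' x) (at x within {0..1})"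
    and c: "continuous_on {0..1} \<theta>''"
  shows "inner w (mk_l2 \<theta>) = \<beta> * \<theta> 1 - \<alpha> * \<theta> 0 - trace_at u 1 * \<theta>' 1 + trace_at u 0 * \<theta>' 0
    + inner u (mk_l2 \<theta>'')"
proof -
  obtain a where u: "u = primitive a (primitive \<alpha> w)" and w: "inner w (cosine 0) = \<beta> - \<alpha>"
    using n by (auto simp: neumann_iff)
  have c1: "continuous_on {0..1} \<theta>'"
    using d2 by (rule DERIV_continuous_on)
  show ?thesis
    using primitive_parts[OF d1 c1, of \<alpha> w] primitive_parts[OF d2 c, of a "primitive \<alpha> w"] w
    by (simp add: u trace_at_primitive antideriv_0 antideriv_1)
qed

text \<open>The cosines satisfy homogeneous Neumann conditions, so Green's formula involves no boundary values
  of \<open>u\<close> itself. Conversely, index 0 gives the compatibility condition under which the problem can be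
  solved by integrating twice, and the other indices show that \<open>u\<close> differs from that solution by a
  constant. Regularity of \<open>u\<close> is thus a conclusion.\<close>

lemma neumann_iff_cosines:
  "neumann u w \<alpha> \<beta> \<longleftrightarrow>
     (\<forall>k. inner w (cosine k) = \<beta> * cos_mode k 1 - \<alpha> * cos_mode k 0 - (real k * pi)\<^sup>2 * inner u (cosine k))"
proof -
  have nec: "inner w (cosine k) = \<beta> * cos_mode k 1 - \<alpha> * cos_mode k 0 - (real k * pi)\<^sup>2 * inner u (cosine k)"
    if n: "neumann u w \<alpha> \<beta>" for u w \<alpha> \<beta> k
  proof -
    define s where "s x = - (mu k * (real k * pi) * sin (real k * pi * x))" for x
    have d1: "(cos_mode k has_real_derivative s x) (at x within {0..1})" for x
      unfolding s_def by (rule cos_mode_deriv)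
    have d2: "(s has_real_derivative - (real k * pi)\<^sup>2 * cos_mode k x) (at x within {0..1})" for x
      unfolding s_def[abs_def] power_mult_distrib by (rule cos_mode_deriv)
    have "mk_l2 (\<lambda>x. - (real k * pi)\<^sup>2 * cos_mode k x) = - (real k * pi)\<^sup>2 *\<^sub>R cosine k"
      unfolding cosine_def
      by (intro scaleR_mk_l2[symmetric] square_integrable_continuous continuous_intros)
    moreover have "s 0 = 0" "s 1 = 0" using sin_npi[of k] by (auto simp: s_def)
    ultimately show ?thesis
      using neumann_green[OF n d1 d2] by (simp add: cosine_def continuous_intros)
  qed
  show ?thesis
  proof
    assume R: "\<forall>k. inner w (cosine k) = \<beta> * cos_mode k 1 - \<alpha> * cos_mode k 0 - (real k * pi)\<^sup>2 * inner u (cosine k)"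
    have w0: "inner w (cosine 0) = \<beta> - \<alpha>"
      using R[rule_format, of 0] by (simp add: cos_mode_def mu_def)
    let ?v = "primitive 0 (primitive \<alpha> w)"
    have "neumann ?v w \<alpha> \<beta>" unfolding neumann_iff using w0 by blast
    note v = nec[OF this]
    have "u - ?v = inner (u - ?v) (cosine 0) *\<^sub>R cosine 0"
    proof (rule l2_eq_by_cosines)
      fix k
      show "inner (u - ?v) (cosine k) = inner (inner (u - ?v) (cosine 0) *\<^sub>R cosine 0) (cosine k)"
        using v[of k] R[rule_format, of k] by (cases "k = 0") (auto simp: inner_cosine inner_diff_left)
    qed
    then have "u = primitive (inner (u - ?v) (cosine 0)) (primitive \<alpha> w)"
      by (simp add: primitive_eq algebra_simps)
    then show "neumann u w \<alpha> \<beta>" unfolding neumann_iff using w0 by blast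
  qed (use nec in blast)
qed

section \<open>Smooth functions\<close>

lemma primitive_smooth:
  assumes d: "\<And>x. x \<in> {0..1} \<Longrightarrow> (\<theta> has_real_derivative \<theta>' x) (at x within {0..1})"
    and c: "continuous_on {0..1} \<theta>'"
  shows "mk_l2 \<theta> = primitive (\<theta> 0) (mk_l2 \<theta>')"
proof -
  have tc: "continuous_on {0..1} \<theta>" using d by (rule DERIV_continuous_on)
  have "\<theta> 0 + antideriv (mk_l2 \<theta>') x = \<theta> x" if x: "x \<in> {0..1}" for x
  proof -
    have "(\<theta>' has_integral \<theta> x - \<theta> 0) {0..x}"
    proof (rule fundamental_theorem_of_calculus)
      show "(\<theta> has_vector_derivative \<theta>' t) (at t within {0..x})" if "t \<in> {0..x}" for t
        unfolding has_real_derivative_iff_has_vector_derivative[symmetric]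
        using d[of t] x that by (auto intro: DERIV_subset)
    qed (use x in auto)
    then show ?thesis using antideriv_continuous[OF c x] by (simp add: integral_unique)
  qed
  then show ?thesis
    unfolding primitive_def
    by (subst mk_l2_eq_iff)
      (auto intro!: square_integrable_continuous tc continuous_intros continuous_on_antideriv AE_I2)
qed

lemma neumann_smooth:
  assumes d1: "\<And>x. x \<in> {0..1} \<Longrightarrow> (\<theta> has_real_derivative \<theta>' x) (at x within {0..1})"
    and d2: "\<And>x. x \<in> {0..1} \<Longrightarrow> (\<theta>' has_real_derivative \<theta>'' x) (at x within {0..1})"
    and c: "continuous_on {0..1} \<theta>''"
  shows "neumann (mk_l2 \<theta>) (mk_l2 \<theta>'') (\<theta>' 0) (\<theta>' 1)"
proof -
  have c1: "continuous_on {0..1} \<theta>'" using d2 by (rule DERIV_continuous_on)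
  show ?thesis
    unfolding neumann_iff
    using primitive_smooth[OF d1 c1] primitive_smooth[OF d2 c] inner_const_deriv[OF d2 c]
    by (auto simp: inner_commute)
qed

section \<open>Hyperbolic profiles\<close>

text \<open>The profile \<open>cosh(zx)\<close> and its derivative \<open>z sinh(zx)\<close>. Both are real when \<open>z\<^sup>2\<close> is, which covers
  hyperbolic and trigonometric behaviour at once; taking real parts only changes the type.\<close>

definition cosh_re :: "complex \<Rightarrow> real \<Rightarrow> real" where
  "cosh_re z x = Re (cosh (z * complex_of_real x))"

definition sinh_re :: "complex \<Rightarrow> real \<Rightarrow> real" where
  "sinh_re z x = Re (z * sinh (z * complex_of_real x))"

lemma cosh_re_0 [simp]: "cosh_re z 0 = 1" and sinh_re_0 [simp]: "sinh_re z 0 = 0"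
  by (simp_all add: cosh_re_def sinh_re_def)

lemma cosh_re_deriv: "(cosh_re z has_real_derivative sinh_re z x) (at x within S)"
proof -
  have "((\<lambda>w. cosh (z * w)) has_field_derivative z * sinh (z * of_real x)) (at (complex_of_real x))"
    by (auto intro!: derivative_eq_intros)
  then have "((\<lambda>x. cosh (z * of_real x)) has_vector_derivative z * sinh (z * of_real x)) (at x within S)"
    using has_vector_derivative_real_field has_vector_derivative_at_within by blast
  then show ?thesis
    unfolding cosh_re_def[abs_def] sinh_re_def has_real_derivative_iff_has_vector_derivative
    by (rule bounded_linear.has_vector_derivative[OF bounded_linear_Re])
qed

lemma sinh_re_deriv:
  assumes z: "z\<^sup>2 = complex_of_real c"
  shows "(sinh_re z has_real_derivative c * cosh_re z x) (at x within S)"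
proof -
  have "((\<lambda>w. z * sinh (z * w)) has_field_derivative z * (z * cosh (z * of_real x))) (at (complex_of_real x))"
    by (auto intro!: derivative_eq_intros)
  then have "((\<lambda>x. z * sinh (z * of_real x)) has_vector_derivative z * (z * cosh (z * of_real x))) (at x within S)"
    using has_vector_derivative_real_field has_vector_derivative_at_within by blast
  then have "(sinh_re z has_vector_derivative Re (z * (z * cosh (z * of_real x)))) (at x within S)"
    unfolding sinh_re_def[abs_def]
    by (rule bounded_linear.has_vector_derivative[OF bounded_linear_Re])
  also have "z * (z * cosh (z * of_real x)) = complex_of_real c * cosh (z * of_real x)"
    by (simp add: z[symmetric] power2_eq_square)
  finally show ?thesis
    by (simp add: cosh_re_def has_real_derivative_iff_has_vector_derivative)
qed

lemma of_real_cosh_re: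
  assumes "z\<^sup>2 = complex_of_real c"
  shows "complex_of_real (cosh_re z x) = cosh (z * complex_of_real x)"
  using cosh_root_real[OF assms, of x] by (simp add: cosh_re_def of_real_Re)

lemma of_real_sinh_re_1:
  assumes "z\<^sup>2 = complex_of_real c"
  shows "complex_of_real (sinh_re z 1) = z * sinh z"
  using sinh_root_real[OF assms] unfolding sinh_re_def of_real_1 mult_1_right by (rule of_real_Re)

text \<open>The zeros of \<open>z sinh z\<close>, including the double zero at 0, correspond to the eigenvalues of the Neumann
  problem on the interval.\<close>

lemma sinh_re_1_eq_0D:
  assumes z: "z\<^sup>2 = complex_of_real c" and 0: "sinh_re z 1 = 0"
  shows "\<exists>k::nat. c = - ((real k)\<^sup>2 * pi\<^sup>2)"
proof (cases "z = 0")
  case True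
  then show ?thesis using z by (intro exI[of _ 0]) simp
next
  case False
  then have "sinh z = 0" using of_real_sinh_re_1[OF z] 0 by simp
  then have "sin (\<i> * z) = 0" by (simp add: sinh_conv_sin)
  then obtain n :: int where n: "\<i> * z = of_real (real_of_int n * pi)"
    by (auto simp: Complex_Transcendental.sin_eq_0)
  have "complex_of_real c = - ((\<i> * z)\<^sup>2)"
    using z by (simp add: power_mult_distrib)
  also have "\<dots> = complex_of_real (- ((real_of_int n * pi)\<^sup>2))"
    unfolding n by simp
  finally have "c = - ((real_of_int n * pi)\<^sup>2)"
    by (simp only: of_real_eq_iff)
  then have "c = - ((real (nat \<bar>n\<bar>))\<^sup>2 * pi\<^sup>2)"
    by (simp add: power_mult_distrib)
  then show ?thesis by blast
qed

lemma profile_of_negative_root: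
  assumes z: "z\<^sup>2 = complex_of_real (- (w\<^sup>2))"
  shows "cosh_re z x = cos (w * x)" "sinh_re z 1 = - (w * sin w)"
proof -
  have "z\<^sup>2 = (\<i> * complex_of_real w)\<^sup>2" using z by (simp add: power_mult_distrib)
  then have zz: "z = \<i> * complex_of_real w \<or> z = - (\<i> * complex_of_real w)"
    by (simp only: power2_eq_iff)
  have c: "cosh (\<i> * complex_of_real (w * x)) = complex_of_real (cos (w * x))"
    by (simp add: cosh_conv_cos cos_of_real del: of_real_mult)
  have s: "\<i> * complex_of_real w * sinh (\<i> * complex_of_real w) = - complex_of_real (w * sin w)"
    by (simp add: sinh_conv_sin sin_of_real algebra_simps)
  show "cosh_re z x = cos (w * x)"
    using zz c by (auto simp: cosh_re_def mult.assoc)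
  have "z * sinh z = - complex_of_real (w * sin w)"
    using zz s by (auto simp del: of_real_mult)
  then have "Re (z * sinh z) = - (w * sin w)"
    by (simp only: uminus_complex.sel Re_complex_of_real)
  then show "sinh_re z 1 = - (w * sin w)"
    unfolding sinh_re_def of_real_1 mult_1_right .
qed

lemma sin_shift_npi: "\<bar>sin (x - real k * pi)\<bar> = \<bar>sin x\<bar>"
  by (simp add: sin_diff abs_mult cos_npi sin_npi power_abs)

text \<open>Write \<open>z\<close> as \<open>\<i>w\<close> up to sign. Then \<open>w - k\<pi>\<close> is asymptotic to \<open>d/(2k\<pi>)\<close>, and \<open>\<bar>w sin w\<bar> = \<bar>w sin(w - k\<pi>)\<bar>\<close>.\<close>

lemma abs_sinh_re_tendsto:
  assumes z: "\<And>k. (z k)\<^sup>2 = complex_of_real (- ((real k)\<^sup>2 * pi\<^sup>2) - d)"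
  shows "(\<lambda>k. \<bar>sinh_re (z k) 1\<bar>) \<longlonglongrightarrow> \<bar>d\<bar> / 2"
proof -
  define w where "w k = sqrt ((real k)\<^sup>2 * pi\<^sup>2 + d)" for k
  have "(\<lambda>k. w k * sin (w k - real k * pi)) \<longlonglongrightarrow> d / 2"
    unfolding w_def by real_asymp (simp add: power2_eq_square field_simps)
  then have "(\<lambda>k. \<bar>w k * sin (w k - real k * pi)\<bar>) \<longlonglongrightarrow> \<bar>d / 2\<bar>"
    by (rule tendsto_rabs)
  moreover have "\<forall>\<^sub>F k in sequentially. \<bar>w k * sin (w k - real k * pi)\<bar> = \<bar>sinh_re (z k) 1\<bar>"
  proof -
    have "\<forall>\<^sub>F k in sequentially. (real k)\<^sup>2 * pi\<^sup>2 + d > 0" by real_asymp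
    then show ?thesis
    proof eventually_elim
      case (elim k)
      then have "(z k)\<^sup>2 = complex_of_real (- ((w k)\<^sup>2))" by (simp add: z w_def)
      then show ?case
        using profile_of_negative_root(2)[of "z k" "w k"] by (simp add: abs_mult sin_shift_npi)
    qed
  qed
  ultimately show ?thesis by (simp add: Lim_transform_eventually)
qed

lemma cosh_re_cos_diff:
  assumes z: "z\<^sup>2 = complex_of_real (- ((real k)\<^sup>2 * pi\<^sup>2) - d)"
    and k: "k \<ge> 1" "(real k)\<^sup>2 * pi\<^sup>2 + d > 0" and x: "x \<in> {0..1}"
  shows "\<bar>cosh_re z x - cos (real k * pi * x)\<bar> \<le> \<bar>d\<bar> / real k"
proof -
  define w where "w = sqrt ((real k)\<^sup>2 * pi\<^sup>2 + d)"
  have w: "w > 0" "w\<^sup>2 = (real k)\<^sup>2 * pi\<^sup>2 + d" using k by (auto simp: w_def)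
  have z': "z\<^sup>2 = complex_of_real (- (w\<^sup>2))" using z w by simp
  \<comment> \<open>The frequency \<open>w\<close> differs from \<open>k\<pi>\<close> by at most \<open>\<bar>d\<bar>/k\<close>.\<close>
  have "(w - real k * pi) * (w + real k * pi) = d"
    using w(2) by (simp add: algebra_simps power2_eq_square)
  then have "\<bar>w - real k * pi\<bar> * (w + real k * pi) = \<bar>d\<bar>"
    using w(1) by (metis abs_mult abs_of_pos add_pos_nonneg mult_nonneg_nonneg of_nat_0_le_iff pi_ge_zero)
  moreover have "real k \<le> w + real k * pi"
  proof -
    have "real k * 1 \<le> real k * pi" using pi_ge_two by (intro mult_left_mono) auto
    then show ?thesis using w(1) by simp
  qed
  ultimately have "\<bar>w - real k * pi\<bar> * real k \<le> \<bar>d\<bar>"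
    by (metis abs_ge_zero mult_left_mono)
  then have wk: "\<bar>w - real k * pi\<bar> \<le> \<bar>d\<bar> / real k"
    using k(1) by (simp add: pos_le_divide_eq)
  have "\<bar>cos (w * x) - cos (real k * pi * x)\<bar> \<le> \<bar>w * x - real k * pi * x\<bar>"
  proof -
    have lip: "\<bar>cos b - cos a\<bar> \<le> \<bar>b - a\<bar>" for a b :: real
    proof -
      have "\<bar>cos b - cos a\<bar> = 2 * \<bar>sin ((b + a) / 2)\<bar> * \<bar>sin ((a - b) / 2)\<bar>"
        by (simp add: cos_diff_cos abs_mult)
      also have "\<dots> \<le> 2 * 1 * \<bar>(a - b) / 2\<bar>"
        by (intro mult_mono abs_sin_le_one abs_sin_x_le_abs_x) auto
      finally show ?thesis by (simp add: abs_minus_commute)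
    qed
    show ?thesis by (rule lip)
  qed
  also have "\<dots> = \<bar>w - real k * pi\<bar> * x"
    using x by (simp add: left_diff_distrib[symmetric] abs_mult)
  also have "\<dots> \<le> \<bar>w - real k * pi\<bar>" using x by (simp add: mult_left_le)
  finally show ?thesis using wk profile_of_negative_root(1)[OF z', of x] by linarith
qed

text \<open>The factor \<open>(-1)\<^sup>k\<close> turns \<open>cos(k\<pi>(1 - x))\<close> into \<open>cos(k\<pi>x)\<close>. So the images of the cosines are bounded
  multiples of the cosines themselves plus remainders of norm \<open>O(1/k)\<close>, and both families are Bessel.\<close>

lemma bounded_operator_of_profiles:
  assumes z: "\<And>k. (z k)\<^sup>2 = complex_of_real (- ((real k)\<^sup>2 * pi\<^sup>2) - d)"
    and c: "\<And>k. \<bar>c k\<bar> \<le> C"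
  obtains T where "bounded_linear T"
    "\<And>k. T (cosine k) = mk_l2 (\<lambda>x. c k * (- 1) ^ k * mu k * cosh_re (z k) (1 - x))"
proof -
  define \<rho> where "\<rho> k x = c k * (- 1) ^ k * mu k * (cosh_re (z k) (1 - x) - cos (real k * pi * (1 - x)))" for k x
  have cc: "continuous_on S (\<lambda>x. cosh_re (z k) (1 - x))" for S k
    by (intro continuous_on_compose2[OF DERIV_continuous_on[OF cosh_re_deriv, of UNIV "z k"]] continuous_intros) auto
  have \<rho>c: "continuous_on S (\<rho> k)" for S k
    unfolding \<rho>_def[abs_def] by (intro continuous_intros cc)
  have C0: "C \<ge> 0" using c[of 0] abs_ge_zero order_trans by blast
  have "\<forall>\<^sub>F k in sequentially. (real k)\<^sup>2 * pi\<^sup>2 + d > 0 \<and> k \<ge> 1"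
    by (intro eventually_conj eventually_ge_at_top) real_asymp
  then obtain K where K: "\<And>k. k \<ge> K \<Longrightarrow> (real k)\<^sup>2 * pi\<^sup>2 + d > 0 \<and> k \<ge> 1"
    by (auto simp: eventually_sequentially)
  have bound: "norm ((norm (mk_l2 (\<rho> k)))\<^sup>2) \<le> (2 * C * \<bar>d\<bar>)\<^sup>2 * inverse ((real k)\<^sup>2)" if k: "k \<ge> K" for k
  proof -
    have "\<bar>\<rho> k x\<bar> \<le> 2 * C * (\<bar>d\<bar> / real k)" if x: "x \<in> {0<..<1}" for x
    proof -
      have mu2: "\<bar>mu k\<bar> \<le> 2" by (simp add: mu_def real_le_lsqrt)
      have "\<bar>c k * (- 1) ^ k * mu k\<bar> \<le> C * 2"
        using mult_mono[OF c mu2 C0] by (simp add: abs_mult power_abs)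
      then have "\<bar>\<rho> k x\<bar> \<le> (C * 2) * (\<bar>d\<bar> / real k)"
        unfolding \<rho>_def abs_mult[of _ "_ - _"] using C0 x K[OF k] z
        by (intro mult_mono cosh_re_cos_diff) auto
      then show ?thesis by (simp add: mult_ac)
    qed
    then have "norm (mk_l2 (\<rho> k)) \<le> \<bar>2 * C * (\<bar>d\<bar> / real k)\<bar>"
      by (intro norm_mk_l2_le borel_measurable_unit_continuous \<rho>c)
    then have "(norm (mk_l2 (\<rho> k)))\<^sup>2 \<le> (\<bar>2 * C * (\<bar>d\<bar> / real k)\<bar>)\<^sup>2"
      by (intro power_mono) auto
    also have "\<dots> = (2 * C * \<bar>d\<bar>)\<^sup>2 * inverse ((real k)\<^sup>2)"
      by (simp add: power_mult_distrib power_divide divide_inverse power_inverse)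
    finally show ?thesis by simp
  qed
  have "summable (\<lambda>k. (2 * C * \<bar>d\<bar>)\<^sup>2 * inverse ((real k)\<^sup>2))"
    using inverse_power_summable[of 2, where 'a = real] by (intro summable_mult) simp
  then have sm: "summable (\<lambda>k. (norm (mk_l2 (\<rho> k)))\<^sup>2)"
    using bound by (rule summable_comparison_test')
  define B where "B = (\<Sum>k. (norm (mk_l2 (\<rho> k)))\<^sup>2)"
  have ob: "orthonormal_family UNIV cosine"
    by (rule orthonormal_basis_family[OF orthonormal_basis_cosine])
  have b1: "bessel_family UNIV (\<lambda>k. c k *\<^sub>R cosine k) (C\<^sup>2)"
    using ob c by (intro bessel_multiple_orthonormal)
  have b2: "bessel_family UNIV (\<lambda>k. mk_l2 (\<rho> k)) B"
    unfolding B_def using sm by (intro bessel_square_summable sum_le_suminf) auto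
  have B0: "B \<ge> 0" unfolding B_def using sm by (intro suminf_nonneg) auto
  obtain T where T: "bounded_linear T" "\<And>k. T (cosine k) = c k *\<^sub>R cosine k + mk_l2 (\<rho> k)"
    by (rule synthesis_operator[OF ob bessel_add[OF b1 b2]]) (use B0 in auto)
  have "T (cosine k) = mk_l2 (\<lambda>x. c k * (- 1) ^ k * mu k * cosh_re (z k) (1 - x))" for k
  proof -
    have "cos (real k * pi * (1 - x)) = (- 1) ^ k * cos (real k * pi * x)" for x
      by (simp add: right_diff_distrib cos_diff cos_npi sin_npi)
    note shift = this
    have "c k * cos_mode k x + \<rho> k x = c k * (- 1) ^ k * mu k * cosh_re (z k) (1 - x)" for x
      unfolding \<rho>_def shift cos_mode_def minus_one_power_iff by (simp add: algebra_simps)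
    note profile = this
    have "T (cosine k) = c k *\<^sub>R mk_l2 (cos_mode k) + mk_l2 (\<rho> k)"
      unfolding T(2) by (simp only: cosine_def)
    also have "\<dots> = mk_l2 (\<lambda>x. c k * cos_mode k x + \<rho> k x)"
      by (simp add: scaleR_mk_l2 plus_mk_l2 square_integrable_continuous square_integrable_scale \<rho>c continuous_intros)
    finally show ?thesis unfolding profile .
  qed
  then show ?thesis using that T(1) by blast
qed

section \<open>Components and eigenvalues of the cascade\<close>

locale cascade =
  fixes N :: nat and e :: "nat \<Rightarrow> 'n::finite" and a :: "nat \<Rightarrow> real"
    and r :: "nat \<Rightarrow> nat \<Rightarrow> nat \<Rightarrow> complex"
  assumes N_pos: "N \<ge> 1"
    and enum: "bij_betw e {1..N} (UNIV :: 'n set)"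
    and roots: "square_roots N a r"
    and disjoint: "disjoint_family_on (ev_set a) {1..N}"
begin

lemma root_square: "i \<in> {1..N} \<Longrightarrow> j \<in> {1..N} \<Longrightarrow> (r i k j)\<^sup>2 = complex_of_real (ev a i k - a j)"
  using roots by (simp add: square_roots_def)

lemma ev_neq: 
  assumes "i \<in> {1..N}" "j \<in> {1..N}" "i \<noteq> j"
  shows "ev a i k \<noteq> ev a j l"
  using disjoint assms unfolding disjoint_family_on_def ev_set_def by blast

text \<open>A vanishing denominator would be a coincidence between an eigenvalue of index \<open>i\<close> and one of
  index \<open>j\<close>.\<close>

lemma sinh_re_nonzero:
  assumes "i \<in> {1..N}" "j \<in> {1..N}" "i \<noteq> j"
  shows "sinh_re (r i k j) 1 \<noteq> 0"
proof
  assume "sinh_re (r i k j) 1 = 0"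
  then obtain l where "ev a i k - a j = - ((real l)\<^sup>2 * pi\<^sup>2)"
    using sinh_re_1_eq_0D[OF root_square[OF assms(1,2)]] by blast
  then have "ev a i k = ev a j l" by (simp add: ev_def)
  then show False using ev_neq[OF assms] by blast
qed

lemma comp_vec_of: "j \<in> {1..N} \<Longrightarrow> vec_of N e F $ e j = F j"
  by (rule vec_of_nth[OF enum])

lemma all_components: "(\<forall>l. P l) \<longleftrightarrow> (\<forall>j\<in>{1..N}. P (e j))"
  using enum unfolding bij_betw_def by (metis UNIV_I imageE)

lemma vec_eqI: "(\<And>j. j \<in> {1..N} \<Longrightarrow> f $ e j = g $ e j) \<Longrightarrow> f = g"
  using all_components[of "\<lambda>l. f $ l = g $ l"] by (simp add: vec_eq_iff)

lemma inner_components: "inner f g = (\<Sum>j=1..N. inner (f $ e j) (g $ e j))"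
  unfolding inner_vec_def by (rule sum.reindex_bij_betw[OF enum, symmetric])

section \<open>The eigenvectors\<close>

text \<open>Real versions of the two families. At \<open>j = i\<close> the products are empty, so that \<open>phi_coeff i k i\<close> is
  the value of the \<open>i\<close>-th component at 1 and \<open>psi_coeff i k i\<close> its value at 0; this lets the
  boundary conditions be checked uniformly.\<close>

definition phi_coeff :: "nat \<Rightarrow> nat \<Rightarrow> nat \<Rightarrow> real" where
  "phi_coeff i k j = (- 1) ^ (k + i - j) * mu k / (\<Prod>j'=j..i-1. sinh_re (r i k j') 1)"

definition phi_fun :: "nat \<Rightarrow> nat \<Rightarrow> nat \<Rightarrow> real \<Rightarrow> real" where
  "phi_fun i k j x = (if j < i then phi_coeff i k j * cosh_re (r i k j) (1 - x)
     else if j = i then cos_mode k x else 0)"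

definition psi_coeff :: "nat \<Rightarrow> nat \<Rightarrow> nat \<Rightarrow> real" where
  "psi_coeff i k j = (- 1) ^ (j - i) * mu k / (\<Prod>j'=i+1..j. sinh_re (r i k j') 1)"

definition psi_fun :: "nat \<Rightarrow> nat \<Rightarrow> nat \<Rightarrow> real \<Rightarrow> real" where
  "psi_fun i k j x = (if j < i then 0 else if j = i then cos_mode k x
     else psi_coeff i k j * cosh_re (r i k j) x)"

lemma phi_component:
  assumes "i \<in> {1..N}" "j \<in> {1..N}"
  shows "phi N e r (i, k) $ e j = mk_l2 (phi_fun i k j)"
proof -
  have "phi_expr r i k j x = complex_of_real (phi_fun i k j x)" for x
  proof -
    have "(\<Prod>j'=j..i-1. r i k j' * sinh (r i k j')) = complex_of_real (\<Prod>j'=j..i-1. sinh_re (r i k j') 1)"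
      unfolding of_real_prod using assms by (intro prod.cong refl of_real_sinh_re_1[OF root_square, symmetric]) auto
    then show ?thesis
      using of_real_cosh_re[OF root_square[OF assms], of k "1 - x"]
      by (simp add: phi_expr_def phi_fun_def phi_coeff_def cos_mode_def)
  qed
  then show ?thesis
    using assms by (simp add: phi_def comp_vec_of)
qed

lemma psi_component:
  assumes "i \<in> {1..N}" "j \<in> {1..N}"
  shows "psi N e r (i, k) $ e j = mk_l2 (psi_fun i k j)"
proof -
  have "psi_expr r i k j x = complex_of_real (psi_fun i k j x)" for x
  proof -
    have "(\<Prod>j'=i+1..j. r i k j' * sinh (r i k j')) = complex_of_real (\<Prod>j'=i+1..j. sinh_re (r i k j') 1)"
      unfolding of_real_prod using assms by (intro prod.cong refl of_real_sinh_re_1[OF root_square, symmetric]) auto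
    then show ?thesis
      using of_real_cosh_re[OF root_square[OF assms], of k x]
      by (simp add: psi_expr_def psi_fun_def psi_coeff_def cos_mode_def)
  qed
  then show ?thesis
    using assms by (simp add: psi_def comp_vec_of)
qed

definition phi_fun' :: "nat \<Rightarrow> nat \<Rightarrow> nat \<Rightarrow> real \<Rightarrow> real" where
  "phi_fun' i k j x = (if j < i then - (phi_coeff i k j * sinh_re (r i k j) (1 - x))
     else if j = i then - (mu k * (real k * pi) * sin (real k * pi * x)) else 0)"

definition psi_fun' :: "nat \<Rightarrow> nat \<Rightarrow> nat \<Rightarrow> real \<Rightarrow> real" where
  "psi_fun' i k j x = (if j < i then 0 else if j = i then - (mu k * (real k * pi) * sin (real k * pi * x))
     else psi_coeff i k j * sinh_re (r i k j) x)"

lemma phi_fun_deriv: "(phi_fun i k j has_real_derivative phi_fun' i k j x) (at x within S)"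
proof -
  consider "j < i" | "j = i" | "j > i" by linarith
  then show ?thesis
  proof cases
    case 1
    have "((\<lambda>x. cosh_re (r i k j) (1 - x)) has_real_derivative sinh_re (r i k j) (1 - x) * (- 1)) (at x within S)"
      by (rule DERIV_chain2[OF cosh_re_deriv]) (auto intro!: derivative_eq_intros)
    from DERIV_cmult[OF this, of "phi_coeff i k j"] 1 show ?thesis
      by (simp add: phi_fun_def[abs_def] phi_fun'_def)
  qed (use cos_mode_deriv(1)[of k x S] in \<open>simp_all add: phi_fun_def[abs_def] phi_fun'_def\<close>)
qed

lemma phi_fun'_deriv:
  assumes ij: "i \<in> {1..N}" "j \<in> {1..N}"
  shows "(phi_fun' i k j has_real_derivative (ev a i k - a j) * phi_fun i k j x) (at x within S)"
proof -
  consider "j < i" | "j = i" | "j > i" by linarith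
  then show ?thesis
  proof cases
    case 1
    have "((\<lambda>x. sinh_re (r i k j) (1 - x)) has_real_derivative
        ((ev a i k - a j) * cosh_re (r i k j) (1 - x)) * (- 1)) (at x within S)"
      by (rule DERIV_chain2[OF sinh_re_deriv[OF root_square[OF ij]]]) (auto intro!: derivative_eq_intros)
    from DERIV_cmult[OF this, of "- phi_coeff i k j"] 1 show ?thesis
      by (simp add: phi_fun'_def[abs_def] phi_fun_def mult_ac)
  next
    case 2
    then show ?thesis using cos_mode_deriv(2)[of k x S]
      by (simp add: phi_fun'_def[abs_def] phi_fun_def ev_def)
  qed (simp add: phi_fun'_def[abs_def] phi_fun_def)
qed

lemma psi_fun_deriv: "(psi_fun i k j has_real_derivative psi_fun' i k j x) (at x within S)"
proof -
  consider "j < i" | "j = i" | "j > i" by linarith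
  then show ?thesis
  proof cases
    case 3
    from DERIV_cmult[OF cosh_re_deriv[of "r i k j" x S], of "psi_coeff i k j"] 3 show ?thesis
      by (simp add: psi_fun_def[abs_def] psi_fun'_def)
  qed (use cos_mode_deriv(1)[of k x S] in \<open>simp_all add: psi_fun_def[abs_def] psi_fun'_def\<close>)
qed

lemma psi_fun'_deriv:
  assumes ij: "i \<in> {1..N}" "j \<in> {1..N}"
  shows "(psi_fun' i k j has_real_derivative (ev a i k - a j) * psi_fun i k j x) (at x within S)"
proof -
  consider "j < i" | "j = i" | "j > i" by linarith
  then show ?thesis
  proof cases
    case 3
    from DERIV_cmult[OF sinh_re_deriv[OF root_square[OF ij], of k x S], of "psi_coeff i k j"] 3 show ?thesis
      by (simp add: psi_fun'_def[abs_def] psi_fun_def mult_ac)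
  next
    case 2
    then show ?thesis using cos_mode_deriv(2)[of k x S]
      by (simp add: psi_fun'_def[abs_def] psi_fun_def ev_def)
  qed (simp add: psi_fun'_def[abs_def] psi_fun_def)
qed

lemma phi_fun_continuous: "continuous_on S (phi_fun i k j)"
  by (rule DERIV_continuous_on[OF phi_fun_deriv])

lemma psi_fun_continuous: "continuous_on S (psi_fun i k j)"
  by (rule DERIV_continuous_on[OF psi_fun_deriv])

text \<open>Passing from \<open>j + 1\<close> to \<open>j\<close> divides the coefficient by \<open>- r sinh r\<close>, which is the factor that
  differentiating \<open>cosh(r(1 - x))\<close> at 0 produces.\<close>

lemma phi_boundary:
  assumes i: "i \<in> {1..N}" and j: "j \<in> {1..N}"
  shows "phi_fun' i k j 1 = 0" "phi_fun' i k j 0 = phi_fun i k (j + 1) 1"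
proof -
  show "phi_fun' i k j 1 = 0"
    using sin_npi[of k] by (simp add: phi_fun'_def)
  have "phi_fun' i k j 0 = phi_fun i k (j + 1) 1" if ji: "j < i"
  proof -
    have at1: "phi_fun i k (j + 1) 1 = phi_coeff i k (j + 1)"
    proof (cases "j + 1 < i")
      case False
      then have "i = j + 1" using ji by simp
      then show ?thesis by (simp add: phi_fun_def phi_coeff_def cos_mode_def cos_npi)
    qed (simp add: phi_fun_def)
    have "{j..i - 1} = insert j {j + 1..i - 1}" using ji by auto
    then have "(\<Prod>j'=j..i-1. sinh_re (r i k j') 1)
        = sinh_re (r i k j) 1 * (\<Prod>j'=j+1..i-1. sinh_re (r i k j') 1)"
      by simp
    moreover have "(- 1 :: real) ^ (k + i - j) = - ((- 1) ^ (k + i - (j + 1)))"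
    proof -
      have "k + i - j = Suc (k + i - (j + 1))" using ji by simp
      then show ?thesis by simp
    qed
    moreover have "sinh_re (r i k j) 1 \<noteq> 0"
      using sinh_re_nonzero i j ji by auto
    ultimately have "- (phi_coeff i k j * sinh_re (r i k j) 1) = phi_coeff i k (j + 1)"
      by (simp add: phi_coeff_def)
    then show ?thesis using ji at1 by (simp add: phi_fun'_def)
  qed
  then show "phi_fun' i k j 0 = phi_fun i k (j + 1) 1"
    by (cases "j < i") (auto simp: phi_fun'_def phi_fun_def)
qed

lemma phi_fun_beyond: "j > N \<Longrightarrow> i \<in> {1..N} \<Longrightarrow> phi_fun i k j x = 0"
  by (simp add: phi_fun_def)

text \<open>The value of the \<open>j\<close>-th component of \<open>\<psi>\<^sub>i\<^sub>,\<^sub>k\<close> at 0, with the value 0 at \<open>j = 0\<close>: the first component has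
  a homogeneous Neumann condition at 1, as if preceded by a component that vanishes.\<close>

definition psi_trace :: "nat \<Rightarrow> nat \<Rightarrow> nat \<Rightarrow> real" where
  "psi_trace i k j = (if j < i then 0 else psi_coeff i k j)"

lemma psi_at_0: "psi_fun i k j 0 = psi_trace i k j"
  by (simp add: psi_fun_def psi_trace_def psi_coeff_def cos_mode_def)

text \<open>These are the boundary conditions of the adjoint operator: information flows from component
  \<open>j - 1\<close> to component \<open>j\<close>, and from 0 to 1.\<close>

lemma psi_boundary:
  assumes i: "i \<in> {1..N}" and j: "j \<in> {1..N}"
  shows "psi_fun' i k j 0 = 0" "psi_fun' i k j 1 = - psi_trace i k (j - 1)"
proof -
  show "psi_fun' i k j 0 = 0" by (simp add: psi_fun'_def)
  have "psi_fun' i k j 1 = - psi_trace i k (j - 1)" if ij: "i < j"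
  proof -
    have "{i + 1..j} = insert j {i + 1..j - 1}" using ij by auto
    then have "(\<Prod>j'=i+1..j. sinh_re (r i k j') 1)
        = sinh_re (r i k j) 1 * (\<Prod>j'=i+1..j-1. sinh_re (r i k j') 1)"
      using ij by simp
    moreover have "(- 1 :: real) ^ (j - i) = - ((- 1) ^ (j - 1 - i))"
    proof -
      have "j - i = Suc (j - 1 - i)" using ij by simp
      then show ?thesis by simp
    qed
    moreover have "sinh_re (r i k j) 1 \<noteq> 0"
      using sinh_re_nonzero i j ij by auto
    ultimately have "psi_coeff i k j * sinh_re (r i k j) 1 = - psi_coeff i k (j - 1)"
      by (simp add: psi_coeff_def)
    then show ?thesis using ij by (simp add: psi_fun'_def psi_trace_def)
  qed
  then show "psi_fun' i k j 1 = - psi_trace i k (j - 1)"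
    using i sin_npi[of k] by (cases "i < j") (auto simp: psi_fun'_def psi_trace_def)
qed

section \<open>The operator in weak form\<close>

text \<open>The value 0 at \<open>N + 1\<close> turns the homogeneous condition on the last component into an instance of
  the coupling condition.\<close>

definition end_value :: "l2 ^ 'n \<Rightarrow> nat \<Rightarrow> real" where
  "end_value f j = (if j \<le> N then trace_at (f $ e j) 1 else 0)"

definition solves :: "l2 ^ 'n \<Rightarrow> l2 ^ 'n \<Rightarrow> nat \<Rightarrow> bool" where
  "solves f h j \<longleftrightarrow> neumann (f $ e j) (h $ e j - a j *\<^sub>R f $ e j) (end_value f (j + 1)) 0"

lemma cascade_op_iff_solves:
  "f \<in> cascade_dom N e \<and> cascade_op N e a f = h \<longleftrightarrow> (\<forall>j\<in>{1..N}. solves f h j)"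
proof -
  have op: "cascade_op N e a f = h \<longleftrightarrow>
      (\<forall>j\<in>{1..N}. weak_deriv (weak_deriv (f $ e j)) = h $ e j - a j *\<^sub>R f $ e j)"
  proof -
    have "cascade_op N e a f = h \<longleftrightarrow> (\<forall>j\<in>{1..N}. cascade_op N e a f $ e j = h $ e j)"
      using vec_eqI by metis
    also have "\<dots> \<longleftrightarrow> (\<forall>j\<in>{1..N}. weak_deriv (weak_deriv (f $ e j)) = h $ e j - a j *\<^sub>R f $ e j)"
      by (intro ball_cong refl) (simp add: cascade_op_def comp_vec_of eq_diff_eq)
    finally show ?thesis .
  qed
  have dom: "f \<in> cascade_dom N e \<longleftrightarrow> (\<forall>j\<in>{1..N}. f $ e j \<in> H2 \<and>
      trace_at (weak_deriv (f $ e j)) 0 = end_value f (j + 1) \<and> trace_at (weak_deriv (f $ e j)) 1 = 0)"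
  proof -
    have "{1..N} = insert N {1..N - 1}" using N_pos by auto
    moreover have "end_value f (j + 1) = trace_at (f $ e (j + 1)) 1" if "j \<in> {1..N - 1}" for j
      using that N_pos by (auto simp: end_value_def)
    moreover have "end_value f (N + 1) = 0" by (simp add: end_value_def)
    ultimately show ?thesis unfolding cascade_dom_def by auto
  qed
  show ?thesis unfolding op dom solves_def neumann_def by blast
qed

text \<open>The contribution of the component \<open>j\<close> to \<open>\<langle>h, \<psi>\<^sub>i\<^sub>,\<^sub>k\<rangle> - \<lambda>\<^sub>i\<^sub>,\<^sub>k \<langle>f, \<psi>\<^sub>i\<^sub>,\<^sub>k\<rangle>\<close>.\<close>

definition defect :: "l2 ^ 'n \<Rightarrow> l2 ^ 'n \<Rightarrow> nat \<Rightarrow> nat \<Rightarrow> nat \<Rightarrow> real" where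
  "defect f h i k j = inner (h $ e j - ev a i k *\<^sub>R f $ e j) (mk_l2 (psi_fun i k j))"

lemma sum_defect:
  assumes "i \<in> {1..N}"
  shows "inner h (psi N e r (i, k)) - ev a i k * inner f (psi N e r (i, k)) = (\<Sum>j=1..N. defect f h i k j)"
  unfolding inner_components[of h] inner_components[of f] defect_def
  using assms by (simp add: psi_component inner_diff_left sum_subtractf sum_distrib_left)

text \<open>Since \<open>\<psi>\<close> solves the eigenvalue equation, Green's formula leaves only boundary terms. The coupling of
  \<open>f\<close> at 0 and the adjoint coupling of \<open>\<psi>\<close> at 1 make them a difference of consecutive terms.\<close>

lemma defect_telescopes:
  assumes s: "solves f h j" and i: "i \<in> {1..N}" and j: "j \<in> {1..N}"
  shows "defect f h i k j = end_value f j * psi_trace i k (j - 1) - end_value f (j + 1) * psi_trace i k j"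
proof -
  have c: "continuous_on {0..1} (\<lambda>x. (ev a i k - a j) * psi_fun i k j x)"
    by (intro continuous_intros psi_fun_continuous)
  have "inner (h $ e j - a j *\<^sub>R f $ e j) (mk_l2 (psi_fun i k j))
    = - end_value f (j + 1) * psi_trace i k j + trace_at (f $ e j) 1 * psi_trace i k (j - 1)
      + inner (f $ e j) (mk_l2 (\<lambda>x. (ev a i k - a j) * psi_fun i k j x))"
    using neumann_green[OF s[unfolded solves_def] psi_fun_deriv psi_fun'_deriv[OF i j] c]
    by (simp add: psi_boundary[OF i j] psi_at_0)
  also have "mk_l2 (\<lambda>x. (ev a i k - a j) * psi_fun i k j x) = (ev a i k - a j) *\<^sub>R mk_l2 (psi_fun i k j)"
    by (intro scaleR_mk_l2[symmetric] square_integrable_continuous psi_fun_continuous)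
  finally show ?thesis
    using j by (simp add: defect_def end_value_def inner_diff_left algebra_simps)
qed

lemma sum_defect_tail:
  assumes s: "\<And>j'. j' \<in> {j+1..N} \<Longrightarrow> solves f h j'" and i: "i \<in> {1..N}" and j: "j \<le> N"
  shows "(\<Sum>j'=j+1..N. defect f h i k j') = end_value f (j + 1) * psi_trace i k j"
proof -
  define G where "G j' = end_value f j' * psi_trace i k (j' - 1)" for j'
  have "(\<Sum>j'=j+1..N. defect f h i k j') = (\<Sum>j'=j+1..N. - (G (Suc j') - G j'))"
    using defect_telescopes[OF s i] by (intro sum.cong refl) (auto simp: G_def)
  also have "\<dots> = - (G (Suc N) - G (j + 1))"
    unfolding sum_negf using j by (subst sum_Suc_diff) auto
  also have "\<dots> = end_value f (j + 1) * psi_trace i k j"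
    by (simp add: G_def end_value_def)
  finally show ?thesis .
qed

text \<open>Testing with \<open>\<psi>\<^sub>j\<^sub>,\<^sub>k\<close> does not see the components before \<open>j\<close>. Those after \<open>j\<close> contribute the single
  boundary term left by the telescoping sum, and the component \<open>j\<close> contributes its cosine coefficients.
  Together they are the coefficients of a Neumann problem whose datum at 0 is the end value of
  component \<open>j + 1\<close>.\<close>

lemma solves_of_tail:
  assumes z: "\<And>k. (\<Sum>j'=1..N. defect f h j k j') = 0" and j: "j \<in> {1..N}"
    and tail: "\<And>j'. j' \<in> {j+1..N} \<Longrightarrow> solves f h j'"
  shows "solves f h j"
proof -
  have "inner (h $ e j - a j *\<^sub>R f $ e j) (cosine k)
      = 0 * cos_mode k 1 - end_value f (j + 1) * cos_mode k 0 - (real k * pi)\<^sup>2 * inner (f $ e j) (cosine k)" for k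
  proof -
    have "{1..N} = {1..<j} \<union> (insert j {j+1..N})" using j by auto
    then have "(\<Sum>j'=1..N. defect f h j k j')
        = (\<Sum>j'=1..<j. defect f h j k j') + (defect f h j k j + (\<Sum>j'=j+1..N. defect f h j k j'))"
      by (simp only: , subst sum.union_disjoint) auto
    also have "(\<Sum>j'=1..<j. defect f h j k j') = 0"
      by (intro sum.neutral) (auto simp: defect_def psi_fun_def[abs_def] zero_l2_def[symmetric])
    also have "(\<Sum>j'=j+1..N. defect f h j k j') = end_value f (j + 1) * cos_mode k 0"
    proof -
      have "(\<Sum>j'=j+1..N. defect f h j k j') = end_value f (j + 1) * psi_trace j k j"
        using tail j by (intro sum_defect_tail) auto
      then show ?thesis using psi_at_0[of j k j] by (simp add: psi_fun_def)
    qed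
    finally have "defect f h j k j = - end_value f (j + 1) * cos_mode k 0" using z[of k] by simp
    moreover have "mk_l2 (psi_fun j k j) = cosine k"
      by (simp add: cosine_def psi_fun_def[abs_def])
    ultimately show ?thesis
      by (simp add: defect_def ev_def inner_diff_left algebra_simps)
  qed
  then show ?thesis unfolding solves_def neumann_iff_cosines by blast
qed

text \<open>Forwards the boundary terms telescope to zero; backwards the components are treated from the last
  to the first.\<close>

lemma cascade_op_iff_weak:
  "f \<in> cascade_dom N e \<and> cascade_op N e a f = h \<longleftrightarrow>
     (\<forall>p\<in>{1..N} \<times> UNIV. inner h (psi N e r p) = (case p of (i, k) \<Rightarrow> ev a i k) * inner f (psi N e r p))"
    (is "_ \<longleftrightarrow> ?R")
proof -
  have R: "?R \<longleftrightarrow> (\<forall>i\<in>{1..N}. \<forall>k. (\<Sum>j=1..N. defect f h i k j) = 0)"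
  proof -
    have "inner h (psi N e r (i, k)) = ev a i k * inner f (psi N e r (i, k)) \<longleftrightarrow>
        (\<Sum>j=1..N. defect f h i k j) = 0" if "i \<in> {1..N}" for i k
      unfolding sum_defect[OF that, symmetric] by simp
    moreover have "?R \<longleftrightarrow> (\<forall>i\<in>{1..N}. \<forall>k.
        inner h (psi N e r (i, k)) = ev a i k * inner f (psi N e r (i, k)))"
      by auto
    ultimately show ?thesis by simp
  qed
  show ?thesis
    unfolding cascade_op_iff_solves R
  proof (intro iffI ballI allI)
    fix i k assume s: "\<forall>j\<in>{1..N}. solves f h j" and i: "i \<in> {1..N}"
    then show "(\<Sum>j=1..N. defect f h i k j) = 0"
      using sum_defect_tail[of 0 f h i k] by (simp add: psi_trace_def)
  next
    fix j assume z: "\<forall>i\<in>{1..N}. \<forall>k. (\<Sum>j=1..N. defect f h i k j) = 0" and j: "j \<in> {1..N}"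
    from j show "solves f h j"
    proof (induction "N - j" arbitrary: j rule: less_induct)
      case less
      show ?case
      proof (rule solves_of_tail)
        show "(\<Sum>j'=1..N. defect f h j k j') = 0" for k using z less.prems by blast
        show "j \<in> {1..N}" by (rule less.prems)
        show "solves f h j'" if "j' \<in> {j+1..N}" for j'
        proof (rule less.hyps)
          show "N - j' < N - j" "j' \<in> {1..N}" using that by auto
        qed
      qed
    qed
  qed
qed

section \<open>Biorthogonality\<close>

lemma phi_solves:
  assumes i: "i \<in> {1..N}" and j: "j \<in> {1..N}"
  shows "solves (phi N e r (i, k)) (ev a i k *\<^sub>R phi N e r (i, k)) j"
proof -
  have c: "continuous_on {0..1} (\<lambda>x. (ev a i k - a j) * phi_fun i k j x)"
    by (intro continuous_intros phi_fun_continuous)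
  have "mk_l2 (\<lambda>x. (ev a i k - a j) * phi_fun i k j x) = (ev a i k - a j) *\<^sub>R mk_l2 (phi_fun i k j)"
    by (intro scaleR_mk_l2[symmetric] square_integrable_continuous phi_fun_continuous)
  moreover have "end_value (phi N e r (i, k)) (j + 1) = phi_fun i k (j + 1) 1"
    using i j by (simp add: end_value_def phi_component trace_at_mk_l2 phi_fun_continuous phi_fun_beyond)
  ultimately show ?thesis
    using neumann_smooth[OF phi_fun_deriv phi_fun'_deriv[OF i j] c] phi_boundary[OF i j, of k] i j
    by (simp add: solves_def phi_component scaleR_left_diff_distrib)
qed

text \<open>For equal \<open>i\<close> the two supports meet only in component \<open>i\<close>, where both vectors are cosines. For
  different \<open>i\<close> the eigenvalues differ, and \<open>\<phi>\<close> being an eigenvector forces orthogonality.\<close>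

lemma biorthogonal:
  assumes p: "p \<in> {1..N} \<times> UNIV" and q: "q \<in> {1..N} \<times> UNIV"
  shows "inner (phi N e r p) (psi N e r q) = (if p = q then 1 else 0)"
proof -
  obtain i k i' k' where pq: "p = (i, k)" "q = (i', k')" by (cases p, cases q)
  then have i: "i \<in> {1..N}" "i' \<in> {1..N}" using p q by auto
  show ?thesis
  proof (cases "i = i'")
    case True
    have "inner (phi N e r p) (psi N e r q)
        = (\<Sum>j=1..N. inner (mk_l2 (phi_fun i k j)) (mk_l2 (psi_fun i k' j)))"
      unfolding inner_components using i True by (simp add: pq phi_component psi_component)
    also have "\<dots> = (\<Sum>j=1..N. if j = i then inner (cosine k) (cosine k') else 0)"
    proof (intro sum.cong refl)
      fix j
      show "inner (mk_l2 (phi_fun i k j)) (mk_l2 (psi_fun i k' j)) = (if j = i then inner (cosine k) (cosine k') else 0)"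
        by (cases j i rule: linorder_cases)
          (auto simp: phi_fun_def[abs_def] psi_fun_def[abs_def] cosine_def zero_l2_def[symmetric])
    qed
    also have "\<dots> = inner (cosine k) (cosine k')" using i by simp
    finally show ?thesis using True by (simp add: inner_cosine pq)
  next
    case False
    have "\<forall>j\<in>{1..N}. solves (phi N e r (i, k)) (ev a i k *\<^sub>R phi N e r (i, k)) j"
      using phi_solves i by blast
    then have "inner (ev a i k *\<^sub>R phi N e r (i, k)) (psi N e r q) = ev a i' k' * inner (phi N e r (i, k)) (psi N e r q)"
      using q unfolding cascade_op_iff_solves[symmetric] cascade_op_iff_weak by (auto simp: pq)
    then have "(ev a i k - ev a i' k') * inner (phi N e r p) (psi N e r q) = 0"
      by (simp add: pq left_diff_distrib)
    then show ?thesis using ev_neq[OF i False] False by (simp add: pq)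
  qed
qed

section \<open>The Riesz basis property\<close>

text \<open>Each factor converges to a nonzero limit, because \<open>a\<^sub>i\<close> and the numbers \<open>a\<^sub>j\<close> for other \<open>j\<close> are
  eigenvalues with \<open>k = 0\<close> and hence distinct.\<close>

lemma phi_coeff_bounded:
  assumes i: "i \<in> {1..N}" and j: "j \<in> {1..N}"
  obtains C where "\<And>k. \<bar>1 / (\<Prod>j'=j..i-1. sinh_re (r i k j') 1)\<bar> \<le> C"
proof -
  have "(\<lambda>k. \<Prod>j'=j..i-1. 1 / \<bar>sinh_re (r i k j') 1\<bar>) \<longlonglongrightarrow> (\<Prod>j'=j..i-1. 1 / (\<bar>a j' - a i\<bar> / 2))"
  proof (intro tendsto_prod tendsto_divide tendsto_const)
    fix j' assume "j' \<in> {j..i-1}"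
    then have j': "j' \<in> {1..N}" "j' \<noteq> i" using i j by auto
    have "(r i k j')\<^sup>2 = complex_of_real (- ((real k)\<^sup>2 * pi\<^sup>2) - (a j' - a i))" for k
      using root_square[OF i j'(1), of k] by (simp add: ev_def algebra_simps)
    then show "(\<lambda>k. \<bar>sinh_re (r i k j') 1\<bar>) \<longlonglongrightarrow> \<bar>a j' - a i\<bar> / 2"
      by (rule abs_sinh_re_tendsto)
    show "\<bar>a j' - a i\<bar> / 2 \<noteq> 0"
      using ev_neq[OF i j'(1), of 0 0] j'(2) by (auto simp: ev_def)
  qed
  then have "Bseq (\<lambda>k. \<Prod>j'=j..i-1. 1 / \<bar>sinh_re (r i k j') 1\<bar>)"
    by (rule convergent_imp_Bseq[OF convergentI])
  then obtain C where C: "\<And>k. norm (\<Prod>j'=j..i-1. 1 / \<bar>sinh_re (r i k j') 1\<bar>) \<le> C"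
    unfolding Bseq_def by blast
  have "\<bar>1 / (\<Prod>j'=j..i-1. sinh_re (r i k j') 1)\<bar> \<le> C" for k
    using C[of k] by (simp add: abs_prod prod_dividef)
  then show ?thesis by (rule that)
qed

text \<open>The entry in position \<open>(j, i)\<close> of the triangular perturbation \<open>K\<close>.\<close>

lemma phi_operator:
  assumes i: "i \<in> {1..N}" and j: "j \<in> {1..N}" and ji: "j < i"
  shows "\<exists>T. bounded_linear T \<and> (\<forall>k. T (cosine k) = mk_l2 (phi_fun i k j))"
proof -
  obtain C where C: "\<And>k. \<bar>1 / (\<Prod>j'=j..i-1. sinh_re (r i k j') 1)\<bar> \<le> C"
    using phi_coeff_bounded[OF i j] by blast
  define c where "c k = (- 1) ^ (i - j) / (\<Prod>j'=j..i-1. sinh_re (r i k j') 1)" for k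
  have "\<bar>c k\<bar> \<le> C" for k using C[of k] by (simp add: c_def power_abs abs_divide)
  moreover have "(r i k j)\<^sup>2 = complex_of_real (- ((real k)\<^sup>2 * pi\<^sup>2) - (a j - a i))" for k
    using root_square[OF i j, of k] by (simp add: ev_def algebra_simps)
  ultimately obtain T where T: "bounded_linear T"
    "\<And>k. T (cosine k) = mk_l2 (\<lambda>x. c k * (- 1) ^ k * mu k * cosh_re (r i k j) (1 - x))"
    using bounded_operator_of_profiles[where c = c and z = "\<lambda>k. r i k j" and d = "a j - a i" and C = C] by blast
  have "(- 1 :: real) ^ (k + i - j) = (- 1) ^ (i - j) * (- 1) ^ k" for k
  proof -
    have "k + i - j = (i - j) + k" using ji by simp
    then show ?thesis by (simp only: power_add)
  qed
  then have "phi_fun i k j x = c k * (- 1) ^ k * mu k * cosh_re (r i k j) (1 - x)" for k x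
    using ji by (simp add: phi_fun_def phi_coeff_def c_def)
  then have "mk_l2 (phi_fun i k j) = mk_l2 (\<lambda>x. c k * (- 1) ^ k * mu k * cosh_re (r i k j) (1 - x))" for k
    by presburger
  then show ?thesis using T by auto
qed

definition mode :: "nat \<times> nat \<Rightarrow> l2 ^ 'n" where
  "mode p = vec_of N e (\<lambda>j. if j = fst p then cosine (snd p) else 0)"

lemma mode_component: "j \<in> {1..N} \<Longrightarrow> mode (i, k) $ e j = (if j = i then cosine k else 0)"
  by (simp add: mode_def comp_vec_of)

lemma inner_mode:
  assumes "i \<in> {1..N}"
  shows "inner f (mode (i, k)) = inner (f $ e i) (cosine k)"
proof -
  have "inner f (mode (i, k)) = (\<Sum>j=1..N. if j = i then inner (f $ e j) (cosine k) else 0)"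
    unfolding inner_components by (intro sum.cong refl) (simp add: mode_component)
  also have "\<dots> = inner (f $ e i) (cosine k)" using assms by simp
  finally show ?thesis .
qed

lemma orthonormal_basis_mode: "orthonormal_basis ({1..N} \<times> UNIV) mode"
  unfolding orthonormal_basis_iff_total
proof (intro conjI allI impI)
  show "orthonormal_family ({1..N} \<times> UNIV) mode"
    unfolding orthonormal_family_def
    by (auto simp: inner_mode mode_component inner_cosine)
  fix f :: "l2 ^ 'n" assume f: "\<forall>p\<in>{1..N} \<times> UNIV. inner f (mode p) = 0"
  show "f = 0"
  proof (rule vec_eqI)
    fix j assume j: "j \<in> {1..N}"
    show "f $ e j = 0 $ e j"
      using f j inner_mode[OF j, of f] by (intro l2_eq_by_cosines) auto
  qed
qed

text \<open>The operator \<open>K\<close> uses only the components after \<open>j\<close> to produce component \<open>j\<close>, so its \<open>N\<close>-th power is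
  zero.\<close>

lemma riesz_basis_phi: "riesz_basis ({1..N} \<times> UNIV) (phi N e r)"
proof -
  have "\<forall>i\<in>{1..N}. \<forall>j\<in>{1..N}. \<exists>T. j < i \<longrightarrow> bounded_linear T \<and> (\<forall>k. T (cosine k) = mk_l2 (phi_fun i k j))"
    using phi_operator by blast
  then obtain T where T: "\<And>i j. i \<in> {1..N} \<Longrightarrow> j \<in> {1..N} \<Longrightarrow> j < i \<Longrightarrow> bounded_linear (T i j)"
    "\<And>i j k. i \<in> {1..N} \<Longrightarrow> j \<in> {1..N} \<Longrightarrow> j < i \<Longrightarrow> T i j (cosine k) = mk_l2 (phi_fun i k j)"
    by metis
  define K where "K f = vec_of N e (\<lambda>j. \<Sum>i=j+1..N. T i j (f $ e i))" for f
  have K_comp: "K f $ e j = (\<Sum>i=j+1..N. T i j (f $ e i))" if "j \<in> {1..N}" for f j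
    using that by (simp add: K_def comp_vec_of)
  have K: "bounded_linear K"
  proof (rule bounded_linear_vecI)
    fix l
    obtain j where j: "j \<in> {1..N}" "l = e j" using enum unfolding bij_betw_def by (metis UNIV_I imageE)
    have "bounded_linear (\<lambda>f. \<Sum>i=j+1..N. T i j (f $ e i))"
      using j by (intro bounded_linear_sum bounded_linear_compose[OF T(1) bounded_linear_vec_nth]) auto
    then show "bounded_linear (\<lambda>f. K f $ l)" using j by (simp add: K_comp)
  qed
  have nil_comp: "(K ^^ m) f $ e j = 0" if "j \<in> {1..N}" "N < j + m" for f j m
    using that
  proof (induction m arbitrary: j)
    case (Suc m)
    have "T i j ((K ^^ m) f $ e i) = 0" if "i \<in> {j+1..N}" for i
      using Suc that linear_0[OF bounded_linear.linear[OF T(1)[of i j]]] by simp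
    then show ?case using Suc.prems by (simp add: K_comp)
  qed simp
  have nil: "(K ^^ N) f = 0" for f
    by (rule vec_eqI) (simp add: nil_comp)
  obtain V where V: "bounded_linear V" "\<And>f. V f + K (V f) = f" "\<And>f. V (f + K f) = f"
    using nilpotent_perturbation_inverse[OF K nil] by blast
  show ?thesis
  proof (rule riesz_basisI[where U = "\<lambda>f. f + K f", OF _ V orthonormal_basis_mode])
    show "bounded_linear (\<lambda>f. f + K f)" by (intro bounded_linear_add bounded_linear_ident K)
    fix p :: "nat \<times> nat" assume "p \<in> {1..N} \<times> UNIV"
    then obtain i k where p: "p = (i, k)" and i: "i \<in> {1..N}" by auto
    show "phi N e r p = mode p + K (mode p)"
    proof (rule vec_eqI)
      fix j assume j: "j \<in> {1..N}"
      have "K (mode p) $ e j = (\<Sum>i'=j+1..N. if i' = i then T i j (cosine k) else 0)"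
        unfolding K_comp[OF j]
      proof (intro sum.cong refl)
        fix i' assume i': "i' \<in> {j+1..N}"
        then have "T i' j 0 = 0"
          using linear_0[OF bounded_linear.linear[OF T(1)[of i' j]]] j by simp
        then show "T i' j (mode p $ e i') = (if i' = i then T i j (cosine k) else 0)"
          using i' by (auto simp: p mode_component)
      qed
      also have "\<dots> = (if j < i then mk_l2 (phi_fun i k j) else 0)"
        using i j T(2) by simp
      finally show "phi N e r p $ e j = (mode p + K (mode p)) $ e j"
        using i j by (cases i j rule: linorder_cases)
          (auto simp: p phi_component mode_component phi_fun_def[abs_def] cosine_def zero_l2_def[symmetric])
    qed
  qed
qed

lemma ev_le: "i \<in> {1..N} \<Longrightarrow> ev a i k \<le> Max (a ` {1..N})"
proof -
  assume i: "i \<in> {1..N}"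
  have "ev a i k \<le> a i" by (simp add: ev_def)
  also have "\<dots> \<le> Max (a ` {1..N})" using i by (intro Max_ge) auto
  finally show ?thesis .
qed

lemma cascade_generates: "generates_C0_semigroup (cascade_dom N e) (cascade_op N e a)"
proof -
  let ?ev = "\<lambda>p. case p of (i, k) \<Rightarrow> ev a i k"
  have ev_bound: "?ev p \<le> Max (a ` {1..N})" if "p \<in> {1..N} \<times> UNIV" for p
    using that ev_le by (cases p) (simp only: case_prod_conv mem_Times_iff fst_conv)
  obtain S where S: "C0_semigroup S"
    and lim: "\<And>f h. ((\<lambda>t. (1 / t) *\<^sub>R (S t f - f)) \<longlongrightarrow> h) (at_right 0) \<longleftrightarrow>
       (\<forall>p\<in>{1..N} \<times> UNIV. inner h (psi N e r p) = ?ev p * inner f (psi N e r p))"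
    by (rule riesz_basis_semigroup[where \<mu> = ?ev, OF riesz_basis_phi biorthogonal ev_bound])
      (assumption | rule that)+
  have lim': "((\<lambda>t. (1 / t) *\<^sub>R (S t f - f)) \<longlongrightarrow> h) (at_right 0) \<longleftrightarrow>
      f \<in> cascade_dom N e \<and> cascade_op N e a f = h" for f h
    unfolding lim cascade_op_iff_weak ..
  have "generator_dom S = cascade_dom N e"
    unfolding generator_dom_def lim' by auto
  moreover have "generator S f = cascade_op N e a f" if "f \<in> cascade_dom N e" for f
    unfolding generator_def using that lim'[of f "cascade_op N e a f"]
    by (intro tendsto_Lim) auto
  ultimately show ?thesis
    unfolding generates_C0_semigroup_def using S by blast
qed

end

theorem lemma3:
  fixes N :: nat
    and e :: "nat \<Rightarrow> 'n::finite"
    and a :: "nat \<Rightarrow> real"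
    and r :: "nat \<Rightarrow> nat \<Rightarrow> nat \<Rightarrow> complex"
  assumes "N \<ge> 1"
    and "bij_betw e {1..N} (UNIV :: 'n set)"
    and "square_roots N a r"
    and "disjoint_family_on (ev_set a) {1..N}"
  shows "riesz_basis ({1..N} \<times> (UNIV :: nat set)) (phi N e r) \<and>
    dual_riesz_basis ({1..N} \<times> (UNIV :: nat set)) (phi N e r) (psi N e r) \<and>
    generates_C0_semigroup (cascade_dom N e) (cascade_op N e a)"
proof -
  interpret cascade N e a r by standard (fact assms)+
  have "dual_riesz_basis ({1..N} \<times> UNIV) (phi N e r) (psi N e r)"
    unfolding dual_riesz_basis_def
    using biorthogonal_riesz_basis[OF riesz_basis_phi biorthogonal] biorthogonal by blast
  then show ?thesis
    using riesz_basis_phi cascade_generates by blast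
qed

end
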